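(* Suppose that the Data Assumption and the Kernel and Bandwidth Assumption stated in the context hold. Then $$\mathbb{E}\left[\sup_{w\in\mathcal{W}}\big|\widehat f_W(w)-f_W(w)\big|\right]\lesssim h^{p\wedge\beta}+\frac{D_{\mathrm{up}}}{\sqrt n}+\sqrt{\frac{\log n}{n^2h}},$$ where $D_{\mathrm{up}}^2=\sup_{w\in\mathcal{W}}\mathrm{Var}\left[f_{W\mid A}(w\mid A_i)\right]$.
   Context: Limits are as $n\to\infty$ and $n\ge 2$. For non-negative sequences, $a_n\lesssim b_n$ means $a_n/b_n$ is bounded over $n$ (i.e. $a_n\le Cb_n$ for a constant $C$ not depending on $n$). $a\wedge b=\min\{a,b\}$. Hölder class: for $\beta>0$, $C>0$, with $\underline\beta$ the largest integer strictly less than $\beta$, $\mathcal{H}^\beta_C(\mathcal{X})$ is the set of $\underline\beta$-times continuously differentiable real functions $g$ on $\mathcal{X}$ with $\max_{1\le r\le\underline\beta}|g^{(r)}(x)|\le C$ and $|g^{(\underline\beta)}(x)-g^{(\underline\beta)}(x')|\le C|x-x'|^{\beta-\underline\beta}$ for all $x,x'\in\mathcal{X}$. Total variation norm: $\|g\|_{\mathrm{TV}}=\sup_{m\ge1}\sup_{x_1\le\cdots\le x_m}\sum_{i=1}^{m-1}|g(x_{i+1})-g(x_i)|$. Data Assumption: $\mathbf{A}_n=(A_i:1\le i\le n)$ are i.i.d. random variables supported on $\mathcal{A}\subseteq\mathbb{R}$, $\mathbf{V}_n=(V_{ij}:1\le i<j\le n)$ are i.i.d. random variables with a Lebesgue density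 $f_V$ on $\mathbb{R}$, and $\mathbf{A}_n$ is independent of $\mathbf{V}_n$. $W_{ij}=W(A_i,A_j,V_{ij})$ and $\mathbf{W}_n=(W_{ij}:1\le i<j\le n)$, where $W$ is an unknown real-valued function symmetric in its first two arguments. $\mathcal{W}\subseteq\mathbb{R}$ is a compact interval with positive Lebesgue measure. The conditional distribution of $W_{ij}$ given $A_i,A_j$ admits a Lebesgue density $f_{W\mid AA}(w\mid A_i,A_j)$. For some $C_{\mathrm H}>0$ and $\beta\ge1$, $f_W\in\mathcal{H}^\beta_{C_{\mathrm H}}(\mathcal{W})$, where $f_W(w)=\mathbb{E}[f_{W\mid AA}(w\mid A_i,A_j)]$, and $f_{W\mid AA}(\cdot\mid a,a')\in\mathcal{H}^1_{C_{\mathrm H}}(\mathcal{W})$ for all $a,a'\in\mathcal{A}$. Also $\sup_{w\in\mathcal{W}}\|f_{W\mid A}(w\mid\cdot)\|_{\mathrm{TV}}<\infty$, where $f_{W\mid A}(w\mid a)=\mathbb{E}[f_{W\mid AA}(w\mid A_i,a)]$. Kernel and Bandwidth Assumption: $h=h(n)>0$ is a sequence of bandwidths with $h\log n\to0$ and $\frac{\log n}{n^2h}\to0$. For each $w\in\mathcal{W}$, $k_h(\cdot,w)$ is a real-valued function supported on $[w-h,w+h]\cap\mathcal{W}$. For an integer $p\ge1$, $k_h$ belongs to a family of boundary bias-corrected kernels of order $p$, i.e. $\int_{\mathcal{W}}(s-w)^rk_h(s,w)\,\mathrm{d}s$ equals $1$ for all $w\in\mathcal{W}$ if $r=0$, equals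 $0$ for all $w\in\mathcal{W}$ if $1\le r\le p-1$, and is nonzero for some $w\in\mathcal{W}$ if $r=p$. For some $C_{\mathrm L}>0$, $k_h(s,\cdot)\in\mathcal{H}^1_{C_{\mathrm L}h^{-2}}(\mathcal{W})$ for all $s\in\mathcal{W}$. Dyadic kernel density estimator: $\widehat f_W(w)=\frac{2}{n(n-1)}\sum_{i=1}^{n-1}\sum_{j=i+1}^nk_h(W_{ij},w)$ for $w\in\mathcal{W}$. *)

theory Defs
  imports "HOL-Probability.Probability"
begin

(* The largest integer strictly less than beta is ceiling beta - 1; it is nonnegative for beta > 0.
   D r is the r-th derivative of g on X, one-sided at boundary points of X. When X is an
   interval of positive length, g determines D 1, ..., D m on X. *)
definition holder_class :: "real \<Rightarrow> real \<Rightarrow> real set \<Rightarrow> (real \<Rightarrow> real) set" where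
  "holder_class \<beta> C X = {g. let m = nat (\<lceil>\<beta>\<rceil> - 1) in
     \<exists>D :: nat \<Rightarrow> real \<Rightarrow> real.
       (\<forall>x\<in>X. D 0 x = g x) \<and>
       (\<forall>r<m. \<forall>x\<in>X. (D r has_real_derivative D (Suc r) x) (at x within X)) \<and>
       continuous_on X (D m) \<and>
       (\<forall>r\<in>{1..m}. \<forall>x\<in>X. \<bar>D r x\<bar> \<le> C) \<and>
       (\<forall>x\<in>X. \<forall>x'\<in>X. \<bar>D m x - D m x'\<bar> \<le> C * \<bar>x - x'\<bar> powr (\<beta> - real m))}"

definition tv_norm :: "real set \<Rightarrow> (real \<Rightarrow> real) \<Rightarrow> ennreal" where
  "tv_norm X g =
     (SUP (m, x) \<in> {(m :: nat, x :: nat \<Rightarrow> real).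
                      1 \<le> m \<and> (\<forall>i\<in>{1..m}. x i \<in> X) \<and> (\<forall>i\<in>{1..<m}. x i \<le> x (i + 1))}.
        \<Sum>i\<in>{1..<m}. ennreal \<bar>g (x (i + 1)) - g (x i)\<bar>)"

(* f is a Lebesgue density of the conditional distribution of Y given X, in the sense that
   P(Y \<in> B | X) = (integral over B of f y X dy) almost surely, for every Borel set B. *)
definition conditional_density ::
  "'w measure \<Rightarrow> ('w \<Rightarrow> real) \<Rightarrow> ('w \<Rightarrow> 'b::topological_space) \<Rightarrow> (real \<Rightarrow> 'b \<Rightarrow> real) \<Rightarrow> bool" where
  "conditional_density M Y X f \<longleftrightarrow>
     (\<forall>B\<in>sets borel. AE \<omega> in M.
        nn_cond_exp M (vimage_algebra (space M) X borel) (indicator (Y -` B \<inter> space M)) \<omega>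
          = (\<integral>\<^sup>+y\<in>B. ennreal (f y (X \<omega>)) \<partial>lborel))"

(* Below, f w a a' is f_{W|AA}(w | a, a'). Since the A_i are identically distributed and
   independent, A 1 and A 2 stand for a generic A_i, respectively a generic pair A_i, A_j. *)
definition dens_W ::
  "'w measure \<Rightarrow> (nat \<Rightarrow> 'w \<Rightarrow> real) \<Rightarrow> (real \<Rightarrow> real \<Rightarrow> real \<Rightarrow> real) \<Rightarrow> real \<Rightarrow> real" where
  "dens_W M A f w = prob_space.expectation M (\<lambda>\<omega>. f w (A 1 \<omega>) (A 2 \<omega>))"

definition dens_W_given_A ::
  "'w measure \<Rightarrow> (nat \<Rightarrow> 'w \<Rightarrow> real) \<Rightarrow> (real \<Rightarrow> real \<Rightarrow> real \<Rightarrow> real) \<Rightarrow> real \<Rightarrow> real \<Rightarrow> real" where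
  "dens_W_given_A M A f w a = prob_space.expectation M (\<lambda>\<omega>. f w (A 1 \<omega>) a)"

definition D_up ::
  "'w measure \<Rightarrow> (nat \<Rightarrow> 'w \<Rightarrow> real) \<Rightarrow> (real \<Rightarrow> real \<Rightarrow> real \<Rightarrow> real) \<Rightarrow> real set \<Rightarrow> real" where
  "D_up M A f \<W> =
     sqrt (SUP w\<in>\<W>. prob_space.variance M (\<lambda>\<omega>. dens_W_given_A M A f w (A 1 \<omega>)))"

(* A i and V i j are only constrained, and only used, for i \<ge> 1 and 1 \<le> i < j. *)
locale dyadic_data = prob_space M
  for M :: "'w measure"
    and A :: "nat \<Rightarrow> 'w \<Rightarrow> real"
    and V :: "nat \<Rightarrow> nat \<Rightarrow> 'w \<Rightarrow> real"
    and W :: "real \<Rightarrow> real \<Rightarrow> real \<Rightarrow> real"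
    and f_V :: "real \<Rightarrow> ennreal"
    and f_WAA :: "real \<Rightarrow> real \<Rightarrow> real \<Rightarrow> real"
    and \<A> :: "real set"
    and \<W> :: "real set"
    and \<beta> :: real
    and C_H :: real +
  assumes A_indep: "\<And>n. 2 \<le> n \<Longrightarrow> indep_vars (\<lambda>_. borel) A {1..n}"
    and A_ident: "\<And>i. 1 \<le> i \<Longrightarrow> distr M borel (A i) = distr M borel (A 1)"
    and A_supp: "\<And>i. 1 \<le> i \<Longrightarrow> AE \<omega> in M. A i \<omega> \<in> \<A>"
    and V_indep: "\<And>n. 2 \<le> n \<Longrightarrow>
          indep_vars (\<lambda>_. borel) (\<lambda>(i, j). V i j) {(i, j). 1 \<le> i \<and> i < j \<and> j \<le> n}"
    and V_density: "\<And>i j. 1 \<le> i \<Longrightarrow> i < j \<Longrightarrow> distributed M lborel (V i j) f_V"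
    and A_V_indep: "\<And>n. 2 \<le> n \<Longrightarrow>
          indep_set
            (sets (vimage_algebra (space M) (\<lambda>\<omega>. \<lambda>i\<in>{1..n}. A i \<omega>)
                     (Pi\<^sub>M {1..n} (\<lambda>_. borel))))
            (sets (vimage_algebra (space M)
                     (\<lambda>\<omega>. \<lambda>(i, j)\<in>{(i, j). 1 \<le> i \<and> i < j \<and> j \<le> n}. V i j \<omega>)
                     (Pi\<^sub>M {(i, j). 1 \<le> i \<and> i < j \<and> j \<le> n} (\<lambda>_. borel))))"
    and W_measurable: "(\<lambda>(a, a', v). W a a' v) \<in> borel_measurable borel"
    and W_sym: "\<And>a a' v. a \<in> \<A> \<Longrightarrow> a' \<in> \<A> \<Longrightarrow> W a a' v = W a' a v"
    and W_set: "compact \<W>" "is_interval \<W>" "0 < emeasure lborel \<W>"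
    and f_WAA_measurable: "(\<lambda>(w, a, a'). f_WAA w a a') \<in> borel_measurable borel"
    and f_WAA_nonneg: "\<And>w a a'. a \<in> \<A> \<Longrightarrow> a' \<in> \<A> \<Longrightarrow> 0 \<le> f_WAA w a a'"
    and f_WAA_density: "\<And>i j. 1 \<le> i \<Longrightarrow> i < j \<Longrightarrow>
          conditional_density M
            (\<lambda>\<omega>. W (A i \<omega>) (A j \<omega>) (V i j \<omega>)) (\<lambda>\<omega>. (A i \<omega>, A j \<omega>))
            (\<lambda>w (a, a'). f_WAA w a a')"
    and C_H_pos: "0 < C_H"
    and beta_ge_1: "1 \<le> \<beta>"
    and f_W_holder: "dens_W M A f_WAA \<in> holder_class \<beta> C_H \<W>"
    and f_WAA_holder: "\<And>a a'. a \<in> \<A> \<Longrightarrow> a' \<in> \<A> \<Longrightarrow>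
          (\<lambda>w. f_WAA w a a') \<in> holder_class 1 C_H \<W>"
    and f_WA_tv: "(SUP w\<in>\<W>. tv_norm \<A> (dens_W_given_A M A f_WAA w)) < \<infinity>"

(* k n s w is k_h(s, w) for the bandwidth h = h n. If a Bochner integral below has a nonzero
   value, its integrand is integrable; so the case r = 0 makes every k n _ w integrable. *)
locale kernel_bandwidth =
  fixes \<W> :: "real set"
    and h :: "nat \<Rightarrow> real"
    and k :: "nat \<Rightarrow> real \<Rightarrow> real \<Rightarrow> real"
    and p :: nat
    and C_L :: real
  assumes h_pos: "\<And>n. 2 \<le> n \<Longrightarrow> 0 < h n"
    and h_log: "(\<lambda>n. h n * ln (real n)) \<longlonglongrightarrow> 0"
    and log_n2h: "(\<lambda>n. ln (real n) / ((real n)\<^sup>2 * h n)) \<longlonglongrightarrow> 0"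
    and k_supp: "\<And>n s w. 2 \<le> n \<Longrightarrow> w \<in> \<W> \<Longrightarrow> s \<notin> {w - h n..w + h n} \<inter> \<W> \<Longrightarrow> k n s w = 0"
    and p_ge_1: "1 \<le> p"
    and k_order_0: "\<And>n w. 2 \<le> n \<Longrightarrow> w \<in> \<W> \<Longrightarrow> (LINT s:\<W>|lborel. (s - w) ^ 0 * k n s w) = 1"
    and k_order_less: "\<And>n r w. 2 \<le> n \<Longrightarrow> 1 \<le> r \<Longrightarrow> r \<le> p - 1 \<Longrightarrow> w \<in> \<W> \<Longrightarrow>
          (LINT s:\<W>|lborel. (s - w) ^ r * k n s w) = 0"
    and k_order_p: "\<And>n. 2 \<le> n \<Longrightarrow> \<exists>w\<in>\<W>. (LINT s:\<W>|lborel. (s - w) ^ p * k n s w) \<noteq> 0"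
    and C_L_pos: "0 < C_L"
    and k_holder: "\<And>n s. 2 \<le> n \<Longrightarrow> s \<in> \<W> \<Longrightarrow> k n s \<in> holder_class 1 (C_L / (h n)\<^sup>2) \<W>"

definition kde ::
  "(nat \<Rightarrow> 'w \<Rightarrow> real) \<Rightarrow> (nat \<Rightarrow> nat \<Rightarrow> 'w \<Rightarrow> real) \<Rightarrow> (real \<Rightarrow> real \<Rightarrow> real \<Rightarrow> real) \<Rightarrow>
   (nat \<Rightarrow> real \<Rightarrow> real \<Rightarrow> real) \<Rightarrow> nat \<Rightarrow> real \<Rightarrow> 'w \<Rightarrow> real" where
  "kde A V W k n w \<omega> =
     2 / (real n * (real n - 1)) *
       (\<Sum>i=1..n - 1. \<Sum>j=i + 1..n. k n (W (A i \<omega>) (A j \<omega>) (V i j \<omega>)) w)"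

(* E[sup_w |kde - f_W|], as a [0, \<infinity>]-valued integral. The integrand is measurable under the
   locale assumptions: \<W> is separable, and k n s (for s \<in> \<W>) and f_W are continuous on \<W>. *)
definition expected_sup_error ::
  "'w measure \<Rightarrow> (nat \<Rightarrow> 'w \<Rightarrow> real) \<Rightarrow> (nat \<Rightarrow> nat \<Rightarrow> 'w \<Rightarrow> real) \<Rightarrow>
   (real \<Rightarrow> real \<Rightarrow> real \<Rightarrow> real) \<Rightarrow> (real \<Rightarrow> real \<Rightarrow> real \<Rightarrow> real) \<Rightarrow> real set \<Rightarrow>
   (nat \<Rightarrow> real \<Rightarrow> real \<Rightarrow> real) \<Rightarrow> nat \<Rightarrow> ennreal" where
  "expected_sup_error M A V W f \<W> k n =
     (\<integral>\<^sup>+\<omega>. (SUP w\<in>\<W>. ennreal \<bar>kde A V W k n w \<omega> - dens_W M A f w\<bar>) \<partial>M)"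

end

theory Submission
  imports Defs
begin

text \<open>Let \<open>g\<^sub>w(a, a')\<close> be the integral of \<open>k\<^sub>h(s, w) f\<^sub>W\<^sub>|\<^sub>A\<^sub>A(s | a, a')\<close> over \<open>s\<close> and let \<open>F(s)\<close> be the average of
  \<open>f\<^sub>W\<^sub>|\<^sub>A\<^sub>A(s | A\<^sub>i, A\<^sub>j) - f\<^sub>W(s)\<close> over the pairs \<open>i < j\<close>. The estimation error is the sum of the average of
  \<open>k\<^sub>h(W\<^sub>i\<^sub>j, w) - g\<^sub>w(A\<^sub>i, A\<^sub>j)\<close>, the integral of \<open>k\<^sub>h(s, w) F(s)\<close>, and the smoothing bias, which Taylor's
  theorem bounds by a multiple of \<open>h powr min p \<beta>\<close>.

  The first average is conditionally on the \<open>A\<^sub>i\<close> a sum of independent centred variables; Bernstein's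
  exponential moment bound on a grid of \<open>n ^ 4\<close> points gives the rate \<open>sqrt (ln n / (n\<^sup>2 h))\<close>.

  The process \<open>F\<close> does not involve \<open>h\<close>. Its increments have second moments of order \<open>(s - t)\<^sup>2 r\<^sup>2\<close>, so its total
  variation over an interval, hence its supremum, has expectation of order \<open>r\<close> and no chaining or entropy
  bound is needed. Here \<open>r = 1 / sqrt n\<close> in general, while \<open>r = 1 / n\<close> if \<open>D_up = 0\<close>, because the U-statistic
  is then degenerate (by the symmetry of \<open>W\<close>, in both arguments). As \<open>D_up\<close> does not depend on \<open>n\<close>, these two cases suffice.\<close>

section \<open>Second moments of U-statistics\<close>

text \<open>The average of the conditional means \<open>gk n w\<close> is not treated as a process
  in \<open>w\<close>: the available Lipschitz constant in \<open>w\<close> is of order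
  \<open>1 / h\<^sup>2\<close>. Written as the integral of the kernel against \<open>F\<close>, it
  sees the kernel only through its L1 norm, which is at most \<open>6 * C_L\<close> whatever the
  bandwidth, while \<open>F\<close> is Lipschitz with a constant free of \<open>h\<close>. On
  \<open>n\<close> cells, \<open>n\<close> increments of expected size of order \<open>r / n\<close>
  add up to \<open>r\<close>, and the Lipschitz bound inside a cell costs \<open>1 / n\<close>.
  Terms of order \<open>1 / n\<close> are absorbed by \<open>sqrt (ln n / (n\<^sup>2 h))\<close>
  because \<open>h\<close> is bounded and \<open>ln n\<close> is at least \<open>1 / 2\<close>. The
  final constant may depend on everything except \<open>n\<close>; it contains
  \<open>4 / D_up\<close>. The pointwise kernel bound needs a small bandwidth, hence large
  \<open>n\<close>; for the finitely many other \<open>n\<close> it suffices that the expected error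
  is finite.\<close>

definition pairs :: "nat \<Rightarrow> (nat \<times> nat) set" where
  "pairs n = {(i, j). 1 \<le> i \<and> i < j \<and> j \<le> n}"

lemma finite_pairs [simp]: "finite (pairs n)"
  by (rule finite_subset[of _ "{..n} \<times> {..n}"]) (auto simp: pairs_def)

lemma sum_pairs: "(\<Sum>i=1..n - 1. \<Sum>j=i + 1..n. F i j) = (\<Sum>(i, j)\<in>pairs n. F i j)"
proof -
  have "pairs n = Sigma {1..n - 1} (\<lambda>i. {i + 1..n})"
    by (auto simp: pairs_def)
  then show ?thesis by (simp add: sum.Sigma)
qed

lemma card_pairs: "real (card (pairs n)) = real n * (real n - 1) / 2"
proof (induction n)
  case 0
  have "pairs 0 = {}" by (auto simp: pairs_def)
  then show ?case by simp
next
  case (Suc n)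
  have eq: "pairs (Suc n) = pairs n \<union> {1..n} \<times> {Suc n}"
    by (auto simp: pairs_def)
  have "card (pairs (Suc n)) = card (pairs n) + card ({1..n} \<times> {Suc n})"
    unfolding eq by (rule card_Un_disjoint[OF finite_pairs]) (auto simp: pairs_def)
  then have "card (pairs (Suc n)) = card (pairs n) + n"
    by (simp add: card_cartesian_product)
  with Suc show ?case by (simp add: field_simps)
qed

context prob_space
begin

lemma distr_PiM_pair:
  assumes "i \<in> I" "j \<in> I" "i \<noteq> j"
  shows "distr (PiM I (\<lambda>_. M)) (M \<Otimes>\<^sub>M M) (\<lambda>x. (x i, x j)) = M \<Otimes>\<^sub>M M"
proof (rule sym, rule pair_measure_eqI)
  interpret P: product_prob_space "\<lambda>_. M" I ..
  fix A B assume A[measurable]: "A \<in> sets M" and B[measurable]: "B \<in> sets M"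
  have [measurable]: "(\<lambda>x. x i) \<in> measurable (PiM I (\<lambda>_. M)) M" "(\<lambda>x. x j) \<in> measurable (PiM I (\<lambda>_. M)) M"
    using assms by auto
  have "emeasure (distr (PiM I (\<lambda>_. M)) (M \<Otimes>\<^sub>M M) (\<lambda>x. (x i, x j))) (A \<times> B)
     = emeasure (PiM I (\<lambda>_. M)) {x\<in>space (PiM I (\<lambda>_. M)). \<forall>l\<in>{i, j}. x l \<in> (if l = i then A else B)}"
    using assms by (subst emeasure_distr) (auto intro!: arg_cong2[where f=emeasure])
  also have "\<dots> = (\<Prod>l\<in>{i,j}. emeasure M (if l = i then A else B))"
    using assms by (intro P.emeasure_PiM_Collect) auto
  finally show "emeasure M A * emeasure M B
      = emeasure (distr (PiM I (\<lambda>_. M)) (M \<Otimes>\<^sub>M M) (\<lambda>x. (x i, x j))) (A \<times> B)"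
    using assms by simp
qed (auto intro: sigma_finite_measure_axioms)

lemma AE_PiM_pair:
  assumes "i \<in> I" "j \<in> I" "i \<noteq> j" "AE z in M \<Otimes>\<^sub>M M. P (fst z) (snd z)"
  shows "AE x in PiM I (\<lambda>_. M). P (x i) (x j)"
proof -
  have [measurable]: "(\<lambda>x. x i) \<in> measurable (PiM I (\<lambda>_. M)) M" "(\<lambda>x. x j) \<in> measurable (PiM I (\<lambda>_. M)) M"
    using assms by auto
  have "AE z in distr (PiM I (\<lambda>_. M)) (M \<Otimes>\<^sub>M M) (\<lambda>x. (x i, x j)). P (fst z) (snd z)"
    unfolding distr_PiM_pair[OF assms(1-3)] by (rule assms(4))
  from AE_distrD[OF _ this] show ?thesis by simp
qed

text \<open>The two index pairs may overlap, so the factors need not be independent; the almost sure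
  bound \<open>B\<close> gives integrability instead.\<close>

lemma integrable_PiM_mult:
  fixes \<phi> \<psi> :: "'a \<Rightarrow> 'a \<Rightarrow> real"
  assumes I: "i \<in> I" "j \<in> I" "k \<in> I" "l \<in> I" "i \<noteq> j" "k \<noteq> l"
    and [measurable]: "case_prod \<phi> \<in> borel_measurable (M \<Otimes>\<^sub>M M)" "case_prod \<psi> \<in> borel_measurable (M \<Otimes>\<^sub>M M)"
    and B: "AE z in M \<Otimes>\<^sub>M M. \<bar>\<phi> (fst z) (snd z)\<bar> \<le> B" "AE z in M \<Otimes>\<^sub>M M. \<bar>\<psi> (fst z) (snd z)\<bar> \<le> B"
  shows "integrable (PiM I (\<lambda>_. M)) (\<lambda>x. \<phi> (x i) (x j) * \<psi> (x k) (x l))"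
    and "\<bar>\<integral>x. \<phi> (x i) (x j) * \<psi> (x k) (x l) \<partial>PiM I (\<lambda>_. M)\<bar> \<le> B\<^sup>2"
proof -
  interpret P: prob_space "PiM I (\<lambda>_. M)" by (intro prob_space_PiM) (rule prob_space_axioms)
  have [measurable]: "(\<lambda>x. x r) \<in> measurable (PiM I (\<lambda>_. M)) M" if "r \<in> {i, j, k, l}" for r
    using that I by auto
  have ae: "AE x in PiM I (\<lambda>_. M). \<bar>\<phi> (x i) (x j) * \<psi> (x k) (x l)\<bar> \<le> B\<^sup>2"
    using AE_PiM_pair[where P="\<lambda>x y. \<bar>\<phi> x y\<bar> \<le> B", OF I(1,2,5) B(1)] AE_PiM_pair[where P="\<lambda>x y. \<bar>\<psi> x y\<bar> \<le> B", OF I(3,4,6) B(2)]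
    by eventually_elim (auto simp: abs_mult power2_eq_square intro!: mult_mono)
  have meas: "(\<lambda>x. \<phi> (x i) (x j) * \<psi> (x k) (x l)) \<in> borel_measurable (PiM I (\<lambda>_. M))"
    by measurable
  show int: "integrable (PiM I (\<lambda>_. M)) (\<lambda>x. \<phi> (x i) (x j) * \<psi> (x k) (x l))"
    using ae by (intro P.integrable_const_bound[where B="B\<^sup>2"] meas) auto
  have "\<bar>\<integral>x. \<phi> (x i) (x j) * \<psi> (x k) (x l) \<partial>PiM I (\<lambda>_. M)\<bar>
      \<le> (\<integral>x. \<bar>\<phi> (x i) (x j) * \<psi> (x k) (x l)\<bar> \<partial>PiM I (\<lambda>_. M))"
    by (rule integral_abs_bound)
  also have "\<dots> \<le> (\<integral>x. B\<^sup>2 \<partial>PiM I (\<lambda>_. M))"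
    using ae int by (intro integral_mono_AE) auto
  finally show "\<bar>\<integral>x. \<phi> (x i) (x j) * \<psi> (x k) (x l) \<partial>PiM I (\<lambda>_. M)\<bar> \<le> B\<^sup>2"
    by (simp add: P.prob_space)
qed

text \<open>Fubini in the coordinate \<open>l\<close>, on which only the second factor depends. The
  index \<open>k\<close> may coincide with \<open>i\<close> or \<open>j\<close>.\<close>

lemma integral_PiM_mult_insert:
  fixes \<phi> \<psi> :: "'a \<Rightarrow> 'a \<Rightarrow> real"
  assumes fin: "finite J" and I: "i \<in> J" "j \<in> J" "k \<in> J" "l \<notin> J" "i \<noteq> j"
    and [measurable]: "case_prod \<phi> \<in> borel_measurable (M \<Otimes>\<^sub>M M)" "case_prod \<psi> \<in> borel_measurable (M \<Otimes>\<^sub>M M)"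
    and B: "AE z in M \<Otimes>\<^sub>M M. \<bar>\<phi> (fst z) (snd z)\<bar> \<le> B" "AE z in M \<Otimes>\<^sub>M M. \<bar>\<psi> (fst z) (snd z)\<bar> \<le> B"
  shows "(\<integral>x. \<phi> (x i) (x j) * \<psi> (x k) (x l) \<partial>PiM (insert l J) (\<lambda>_. M))
    = (\<integral>x. \<phi> (x i) (x j) * (\<integral>y. \<psi> (x k) y \<partial>M) \<partial>PiM J (\<lambda>_. M))"
proof -
  interpret P: product_prob_space "\<lambda>_. M" J ..
  have "integrable (PiM (insert l J) (\<lambda>_. M)) (\<lambda>x. \<phi> (x i) (x j) * \<psi> (x k) (x l))"
    using I by (intro integrable_PiM_mult[OF _ _ _ _ _ _ assms(7,8) B]) auto
  from P.product_integral_insert[OF fin I(4) this]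
  have "(\<integral>x. \<phi> (x i) (x j) * \<psi> (x k) (x l) \<partial>PiM (insert l J) (\<lambda>_. M))
    = (\<integral>x. (\<integral>y. \<phi> ((x(l := y)) i) ((x(l := y)) j) * \<psi> ((x(l := y)) k) ((x(l := y)) l) \<partial>M) \<partial>PiM J (\<lambda>_. M))"
    by simp
  also have "\<dots> = (\<integral>x. (\<integral>y. \<phi> (x i) (x j) * \<psi> (x k) y \<partial>M) \<partial>PiM J (\<lambda>_. M))"
  proof -
    have "(x(l := y)) i = x i" "(x(l := y)) j = x j" "(x(l := y)) k = x k" for x and y :: 'a
      using I by auto
    then show ?thesis by simp
  qed
  finally show ?thesis by simp
qed

text \<open>Integrating out \<open>x l\<close> first leaves the conditional mean of \<psi> given its
  first argument, which vanishes. This works even if the pairs share the index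
  \<open>k\<close>.\<close>

lemma integral_PiM_mult_eq_0_degenerate:
  fixes \<phi> \<psi> :: "'a \<Rightarrow> 'a \<Rightarrow> real"
  assumes fin: "finite I" and I: "i \<in> I" "j \<in> I" "k \<in> I" "l \<in> I" "i \<noteq> j" "l \<notin> {i, j, k}"
    and [measurable]: "case_prod \<phi> \<in> borel_measurable (M \<Otimes>\<^sub>M M)" "case_prod \<psi> \<in> borel_measurable (M \<Otimes>\<^sub>M M)"
    and B: "AE z in M \<Otimes>\<^sub>M M. \<bar>\<phi> (fst z) (snd z)\<bar> \<le> B" "AE z in M \<Otimes>\<^sub>M M. \<bar>\<psi> (fst z) (snd z)\<bar> \<le> B"
    and 0: "AE a in M. (\<integral>y. \<psi> a y \<partial>M) = 0"
  shows "(\<integral>x. \<phi> (x i) (x j) * \<psi> (x k) (x l) \<partial>PiM I (\<lambda>_. M)) = 0"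
proof -
  have "(\<integral>x. \<phi> (x i) (x j) * \<psi> (x k) (x l) \<partial>PiM (insert l (I - {l})) (\<lambda>_. M))
     = (\<integral>x. \<phi> (x i) (x j) * (\<integral>y. \<psi> (x k) y \<partial>M) \<partial>PiM (I - {l}) (\<lambda>_. M))"
    using assms by (intro integral_PiM_mult_insert[OF _ _ _ _ _ _ assms(8,9) B]) auto
  also have "\<dots> = 0"
  proof (rule integral_eq_zero_AE)
    have "AE x in PiM (I - {l}) (\<lambda>_. M). (\<integral>y. \<psi> (x k) y \<partial>M) = 0"
      using I by (intro AE_PiM_component[where P="\<lambda>a. (\<integral>y. \<psi> a y \<partial>M) = 0"] prob_space_axioms 0) auto
    then show "AE x in PiM (I - {l}) (\<lambda>_. M). \<phi> (x i) (x j) * (\<integral>y. \<psi> (x k) y \<partial>M) = 0"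
      by eventually_elim simp
  qed
  finally show ?thesis using I by (simp add: insert_absorb)
qed

lemma AE_pair_swap:
  assumes "AE z in M \<Otimes>\<^sub>M M. P (fst z) (snd z)"
  shows "AE z in M \<Otimes>\<^sub>M M. P (snd z) (fst z)"
proof -
  interpret P: pair_sigma_finite M M ..
  have "AE z in distr (M \<Otimes>\<^sub>M M) (M \<Otimes>\<^sub>M M) (\<lambda>(x, y). (y, x)). P (fst z) (snd z)"
    unfolding P.distr_pair_swap[symmetric] by (rule assms)
  from AE_distrD[OF _ this] show ?thesis by (simp add: split_beta)
qed

text \<open>Here \<psi> has only total mean 0. Integrating out \<open>x l\<close> leaves a function
  of \<open>x k\<close>, a coordinate that the first factor does not see, and integrating that one
  too produces the total mean.\<close>

lemma integral_PiM_mult_eq_0_disjoint: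
  fixes \<phi> \<psi> :: "'a \<Rightarrow> 'a \<Rightarrow> real"
  assumes fin: "finite I" and I: "i \<in> I" "j \<in> I" "k \<in> I" "l \<in> I" "i \<noteq> j" "k \<noteq> l" "{i, j} \<inter> {k, l} = {}"
    and [measurable]: "case_prod \<phi> \<in> borel_measurable (M \<Otimes>\<^sub>M M)" "case_prod \<psi> \<in> borel_measurable (M \<Otimes>\<^sub>M M)"
    and B: "AE z in M \<Otimes>\<^sub>M M. \<bar>\<phi> (fst z) (snd z)\<bar> \<le> B" "AE z in M \<Otimes>\<^sub>M M. \<bar>\<psi> (fst z) (snd z)\<bar> \<le> B"
    and 0: "(\<integral>z. \<psi> (fst z) (snd z) \<partial>(M \<Otimes>\<^sub>M M)) = 0"
  shows "(\<integral>x. \<phi> (x i) (x j) * \<psi> (x k) (x l) \<partial>PiM I (\<lambda>_. M)) = 0"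
proof -
  interpret P: pair_sigma_finite M M ..
  interpret PP: pair_prob_space M M ..
  have [measurable]: "(\<lambda>z. \<psi> (fst z) (snd z)) \<in> borel_measurable (M \<Otimes>\<^sub>M M)" by measurable
  \<comment> \<open>The dummy first argument makes the partial integral a function of two arguments,
    so that the degenerate case applies with \<open>k\<close> in the role of
    \<open>l\<close>.\<close>
  define \<psi>' where "\<psi>' = (\<lambda>(b::'a) a. \<integral>y. \<psi> a y \<partial>M)"
  have int: "integrable (M \<Otimes>\<^sub>M M) (\<lambda>(a, y). \<psi> a y)"
    using B(2) by (intro PP.integrable_const_bound[where B=B]) (auto simp: split_beta)
  have bd: "AE a in M. \<bar>\<integral>y. \<psi> a y \<partial>M\<bar> \<le> B"
  proof -
    have "AE a in M. AE y in M. \<bar>\<psi> a y\<bar> \<le> B"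
      using P.AE_pair[OF B(2)] by simp
    then show ?thesis
    proof eventually_elim
      case (elim a)
      show ?case
      proof (cases "integrable M (\<psi> a)")
        case True
        have "\<bar>\<integral>y. \<psi> a y \<partial>M\<bar> \<le> (\<integral>y. \<bar>\<psi> a y\<bar> \<partial>M)" by (rule integral_abs_bound)
        also have "\<dots> \<le> (\<integral>y. B \<partial>M)" using elim True by (intro integral_mono_AE) auto
        finally show ?thesis by (simp add: prob_space)
      next
        \<comment> \<open>The integral is then 0 by convention, so only \<open>0 \<le> B\<close> is
          needed; it follows from the almost sure bound because a probability space is not
          null.\<close>
        case False
        from elim have "AE y in M. 0 \<le> B" by eventually_elim auto
        then have "0 \<le> B" by simp
        with False show ?thesis by (simp add: not_integrable_integral_eq)
      qed
    qed
  qed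
  have [measurable]: "case_prod \<psi>' \<in> borel_measurable (M \<Otimes>\<^sub>M M)"
    unfolding \<psi>'_def by measurable
  have bd': "AE z in M \<Otimes>\<^sub>M M. \<bar>\<psi>' (fst z) (snd z)\<bar> \<le> B"
  proof (rule P.AE_pair_measure)
    show "AE b in M. AE a in M. \<bar>\<psi>' (fst (b, a)) (snd (b, a))\<bar> \<le> B"
      using bd by (simp add: \<psi>'_def)
  qed measurable
  have zero': "AE a in M. (\<integral>y. \<psi>' a y \<partial>M) = 0"
    using 0 P.integral_fst'[OF int] by (simp add: \<psi>'_def case_prod_unfold)
  have "(\<integral>x. \<phi> (x i) (x j) * \<psi> (x k) (x l) \<partial>PiM (insert l (I - {l})) (\<lambda>_. M))
     = (\<integral>x. \<phi> (x i) (x j) * \<psi>' (x i) (x k) \<partial>PiM (I - {l}) (\<lambda>_. M))"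
    unfolding \<psi>'_def
    using assms by (intro integral_PiM_mult_insert[OF _ _ _ _ _ _ assms(9,10) B]) auto
  also have "\<dots> = 0"
    using assms by (intro integral_PiM_mult_eq_0_degenerate[OF _ _ _ _ _ _ _ assms(9) _ B(1) bd' zero']) auto
  finally show ?thesis using I by (simp add: insert_absorb)
qed

text \<open>Hoeffding's variance computation. In the expanded square only overlapping index pairs
  contribute, at most \<open>4 * n\<close> for each pair; for a degenerate \<open>q\<close> only the
  diagonal is left. Each surviving term is at most \<open>B\<^sup>2\<close>.\<close>

lemma integral_sum_pairs_square_le:
  fixes q :: "'a \<Rightarrow> 'a \<Rightarrow> real"
  assumes [measurable]: "case_prod q \<in> borel_measurable (M \<Otimes>\<^sub>M M)"
    and B: "AE z in M \<Otimes>\<^sub>M M. \<bar>q (fst z) (snd z)\<bar> \<le> B"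
    and 0: "(\<integral>z. q (fst z) (snd z) \<partial>(M \<Otimes>\<^sub>M M)) = 0"
  shows "integrable (PiM {1..n} (\<lambda>_. M)) (\<lambda>x. (\<Sum>(i, j)\<in>pairs n. q (x i) (x j))\<^sup>2)"
    and "(\<integral>x. (\<Sum>(i, j)\<in>pairs n. q (x i) (x j))\<^sup>2 \<partial>PiM {1..n} (\<lambda>_. M)) \<le> B\<^sup>2 * (4 * real n * real (card (pairs n)))"
    and "(AE a in M. (\<integral>y. q a y \<partial>M) = 0) \<Longrightarrow> (AE a in M. (\<integral>y. q y a \<partial>M) = 0) \<Longrightarrow>
      (\<integral>x. (\<Sum>(i, j)\<in>pairs n. q (x i) (x j))\<^sup>2 \<partial>PiM {1..n} (\<lambda>_. M)) \<le> B\<^sup>2 * real (card (pairs n))"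
proof -
  define c where "c = (\<lambda>(i, j) (k, l). \<integral>x. q (x i) (x j) * q (x k) (x l) \<partial>PiM {1..n} (\<lambda>_. M))"
  have sq: "(\<Sum>(i, j)\<in>pairs n. q (x i) (x j))\<^sup>2
     = (\<Sum>r\<in>pairs n. \<Sum>s\<in>pairs n. q (x (fst r)) (x (snd r)) * q (x (fst s)) (x (snd s)))" for x
    by (simp add: power2_eq_square sum_product split_beta)
  have int: "integrable (PiM {1..n} (\<lambda>_. M)) (\<lambda>x. q (x (fst r)) (x (snd r)) * q (x (fst s)) (x (snd s)))"
    if "r \<in> pairs n" "s \<in> pairs n" for r s
    using that by (intro integrable_PiM_mult[OF _ _ _ _ _ _ assms(1,1) B B]) (auto simp: pairs_def)
  show "integrable (PiM {1..n} (\<lambda>_. M)) (\<lambda>x. (\<Sum>(i, j)\<in>pairs n. q (x i) (x j))\<^sup>2)"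
    unfolding sq using int by (intro Bochner_Integration.integrable_sum) auto
  have eq: "(\<integral>x. (\<Sum>(i, j)\<in>pairs n. q (x i) (x j))\<^sup>2 \<partial>PiM {1..n} (\<lambda>_. M)) = (\<Sum>r\<in>pairs n. \<Sum>s\<in>pairs n. c r s)"
    unfolding sq using int
    by (simp add: Bochner_Integration.integral_sum Bochner_Integration.integrable_sum c_def split_beta)
  have c_le: "c r s \<le> B\<^sup>2" if "r \<in> pairs n" "s \<in> pairs n" for r s
  proof -
    have "\<bar>c r s\<bar> \<le> B\<^sup>2"
      unfolding c_def split_beta using that
      by (intro integrable_PiM_mult[OF _ _ _ _ _ _ assms(1,1) B B]) (auto simp: pairs_def)
    then show ?thesis by simp
  qed
  have *: "(\<Sum>r\<in>pairs n. \<Sum>s\<in>pairs n. c r s) \<le> B\<^sup>2 * (real N * real (card (pairs n)))"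
    if S: "\<And>r. r \<in> pairs n \<Longrightarrow> finite (S r) \<and> card (S r) \<le> N"
    and c0: "\<And>r s. r \<in> pairs n \<Longrightarrow> s \<in> pairs n \<Longrightarrow> s \<notin> S r \<Longrightarrow> c r s = 0" for S N
  proof -
    have "(\<Sum>s\<in>pairs n. c r s) \<le> B\<^sup>2 * real N" if r: "r \<in> pairs n" for r
    proof -
      have "(\<Sum>s\<in>pairs n. c r s) = (\<Sum>s\<in>pairs n \<inter> S r. c r s)"
        using c0 r by (intro sum.mono_neutral_right) auto
      also have "\<dots> \<le> real (card (pairs n \<inter> S r)) * B\<^sup>2"
        using c_le r by (intro sum_bounded_above) auto
      also have "card (pairs n \<inter> S r) \<le> N"
        using S[OF r] card_mono[of "S r" "pairs n \<inter> S r"] by auto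
      then have "real (card (pairs n \<inter> S r)) * B\<^sup>2 \<le> real N * B\<^sup>2"
        by (intro mult_right_mono) auto
      finally show ?thesis by (simp add: mult.commute)
    qed
    then have "(\<Sum>r\<in>pairs n. \<Sum>s\<in>pairs n. c r s) \<le> real (card (pairs n)) * (B\<^sup>2 * real N)"
      by (intro sum_bounded_above) auto
    then show ?thesis by (simp add: mult_ac)
  qed
  \<comment> \<open>Four strips of \<open>n\<close> pairs each, which cover every pair that shares
    an index with \<open>(i, j)\<close>; this is the origin of the factor 4.\<close>
  define S where "S = (\<lambda>(i, j). {i} \<times> {1..n} \<union> {j} \<times> {1..n} \<union> {1..n} \<times> {i} \<union> {1..n} \<times> {j} :: (nat \<times> nat) set)"
  have "(\<Sum>r\<in>pairs n. \<Sum>s\<in>pairs n. c r s) \<le> B\<^sup>2 * (real (4 * n) * real (card (pairs n)))"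
  proof (rule *[of S])
    fix r assume "r \<in> pairs n"
    obtain i j where r: "r = (i, j)" by force
    have "card (S r) \<le> card ({i} \<times> {1..n}) + card ({j} \<times> {1..n}) + card ({1..n} \<times> {i}) + card ({1..n} \<times> {j})"
      unfolding S_def r prod.case by (intro order.trans[OF card_Un_le] add_mono) auto
    then show "finite (S r) \<and> card (S r) \<le> 4 * n"
      by (auto simp: S_def r card_cartesian_product)
  next
    fix r s assume rs: "r \<in> pairs n" "s \<in> pairs n" "s \<notin> S r"
    then show "c r s = 0"
      unfolding c_def split_beta
      by (intro integral_PiM_mult_eq_0_disjoint[OF _ _ _ _ _ _ _ _ assms(1,1) B B 0])
         (auto simp: pairs_def S_def)
  qed
  then show "(\<integral>x. (\<Sum>(i, j)\<in>pairs n. q (x i) (x j))\<^sup>2 \<partial>PiM {1..n} (\<lambda>_. M)) \<le> B\<^sup>2 * (4 * real n * real (card (pairs n)))"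
    unfolding eq by simp
  assume deg: "AE a in M. (\<integral>y. q a y \<partial>M) = 0" "AE a in M. (\<integral>y. q y a \<partial>M) = 0"
  have "(\<Sum>r\<in>pairs n. \<Sum>s\<in>pairs n. c r s) \<le> B\<^sup>2 * (real 1 * real (card (pairs n)))"
  proof (rule *[of "\<lambda>r. {r}"])
    fix r s assume rs: "r \<in> pairs n" "s \<in> pairs n" "s \<notin> {r}"
    obtain i j k l where r: "r = (i, j)" and s: "s = (k, l)" by force
    \<comment> \<open>As \<open>i < j\<close> and \<open>k < l\<close>, distinct pairs have distinct
      index sets, so some index of the second pair is missing from the first and can be integrated
      out.\<close>
    have "l \<notin> {i, j, k} \<or> k \<notin> {i, j, l}"
      using rs by (auto simp: r s pairs_def)
    then consider "l \<notin> {i, j, k}" | "k \<notin> {i, j, l}" by blast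
    then show "c r s = 0"
    proof cases
      case 1
      with rs show ?thesis
        unfolding r s c_def prod.case
        by (intro integral_PiM_mult_eq_0_degenerate[OF _ _ _ _ _ _ _ assms(1,1) B B deg(1)])
           (auto simp: pairs_def)
    next
      case 2
      \<comment> \<open>The free coordinate is now the first argument of the second factor. Reading
        that factor with its arguments swapped reduces this to the previous case, with
        \<open>deg(2)\<close> as the degeneracy.\<close>
      have "(\<integral>x. q (x i) (x j) * q (x k) (x l) \<partial>PiM {1..n} (\<lambda>_. M)) = 0"
      proof (rule integral_PiM_mult_eq_0_degenerate[where \<psi>="\<lambda>a b. q b a", OF _ _ _ _ _ _ _ assms(1) _ B])
        show "AE z in M \<Otimes>\<^sub>M M. \<bar>q (snd z) (fst z)\<bar> \<le> B" by (rule AE_pair_swap[OF B])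
      qed (use 2 rs deg in \<open>auto simp: r s pairs_def\<close>)
      then show ?thesis
        by (simp add: r s c_def)
    qed
  qed auto
  then show "(\<integral>x. (\<Sum>(i, j)\<in>pairs n. q (x i) (x j))\<^sup>2 \<partial>PiM {1..n} (\<lambda>_. M)) \<le> B\<^sup>2 * real (card (pairs n))"
    unfolding eq by simp
qed

end

section \<open>Real analysis\<close>

lemma exp_le_quadratic:
  fixes x :: real
  assumes "\<bar>x\<bar> \<le> 1"
  shows "exp x \<le> 1 + x + x\<^sup>2"
proof (cases "0 \<le> x")
  case True
  with assms show ?thesis by (intro exp_bound) auto
next
  case False
  define y where "y = - x"
  have y: "0 \<le> y" "y \<le> 1" using False assms by (auto simp: y_def)
  \<comment> \<open>For negative arguments the claim is equivalent to a lower bound on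
    \<open>exp y\<close>; the quadratic Taylor bound suffices because the cross terms in this
    product cancel up to nonnegative ones.\<close>
  have "1 \<le> (1 - y + y\<^sup>2) * (1 + y + y\<^sup>2 / 2)"
  proof -
    have "(1 - y + y\<^sup>2) * (1 + y + y\<^sup>2 / 2) = 1 + (y^2 + y^3 + y^4) / 2"
      by (simp add: field_simps power2_eq_square power3_eq_cube power4_eq_xxxx)
    then show ?thesis using y by simp
  qed
  also have "\<dots> \<le> (1 - y + y\<^sup>2) * exp y"
  proof (rule mult_left_mono)
    show "0 \<le> 1 - y + y\<^sup>2" using y by (simp add: add_nonneg_nonneg)
  qed (rule exp_lower_Taylor_quadratic[OF y(1)])
  finally have "exp (- y) \<le> 1 - y + y\<^sup>2"
    by (simp add: exp_minus field_simps)
  then show ?thesis by (simp add: y_def)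
qed

text \<open>Bernstein's argument: \<open>2 * b\<close> bounds the centred variable, so the exponent
  lies between -1 and 1 and \<open>exp\<close> is below its quadratic bound. The linear term
  integrates to 0 and the variance is at most the second moment.\<close>

lemma (in prob_space) nn_integral_exp_centered_le:
  fixes X :: "'a \<Rightarrow> real"
  assumes [measurable]: "X \<in> borel_measurable M"
    and bd: "\<And>x. \<bar>X x\<bar> \<le> b" and l: "\<bar>\<theta>\<bar> * (2 * b) \<le> 1"
  shows "(\<integral>\<^sup>+x. ennreal (exp (\<theta> * (X x - expectation X))) \<partial>M) \<le> ennreal (exp (\<theta>\<^sup>2 * expectation (\<lambda>x. (X x)\<^sup>2)))"
proof -
  define e where "e = expectation X"
  have int: "integrable M X" "integrable M (\<lambda>x. (X x)\<^sup>2)"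
  proof -
    show "integrable M X"
      using bd by (intro integrable_const_bound[where B=b]) auto
    have "(X x)\<^sup>2 \<le> b\<^sup>2" for x
      using power_mono[OF bd[of x], of 2] by simp
    then show "integrable M (\<lambda>x. (X x)\<^sup>2)"
      by (intro integrable_const_bound[where B="b\<^sup>2"]) auto
  qed
  have e: "\<bar>e\<bar> \<le> b"
  proof -
    have "\<bar>e\<bar> \<le> expectation (\<lambda>x. \<bar>X x\<bar>)" unfolding e_def by (rule integral_abs_bound)
    also have "\<dots> \<le> expectation (\<lambda>x. b)" using bd int by (intro integral_mono) auto
    finally show ?thesis by (simp add: prob_space)
  qed
  have le: "exp (\<theta> * (X x - e)) \<le> 1 + \<theta> * (X x - e) + (\<theta> * (X x - e))\<^sup>2" for x
  proof (rule exp_le_quadratic)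
    have "\<bar>X x - e\<bar> \<le> 2 * b" using bd[of x] e by linarith
    then have "\<bar>\<theta>\<bar> * \<bar>X x - e\<bar> \<le> \<bar>\<theta>\<bar> * (2 * b)" by (intro mult_left_mono) auto
    then show "\<bar>\<theta> * (X x - e)\<bar> \<le> 1" using l by (simp add: abs_mult)
  qed
  have expand: "1 + \<theta> * (X x - e) + (\<theta> * (X x - e))\<^sup>2
     = (1 - \<theta> * e + \<theta>\<^sup>2 * e\<^sup>2) + (\<theta> - 2 * \<theta>\<^sup>2 * e) * X x + \<theta>\<^sup>2 * (X x)\<^sup>2" for x
    by (simp add: power2_eq_square algebra_simps)
  have nn: "0 \<le> 1 + \<theta> * (X x - e) + (\<theta> * (X x - e))\<^sup>2" for x
    using le[of x] exp_ge_zero[of "\<theta> * (X x - e)"] by linarith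
  have "(\<integral>\<^sup>+x. ennreal (exp (\<theta> * (X x - e))) \<partial>M)
      \<le> (\<integral>\<^sup>+x. ennreal (1 + \<theta> * (X x - e) + (\<theta> * (X x - e))\<^sup>2) \<partial>M)"
    using le by (intro nn_integral_mono ennreal_leI) auto
  also have "\<dots> = ennreal (expectation (\<lambda>x. 1 + \<theta> * (X x - e) + (\<theta> * (X x - e))\<^sup>2))"
    using int nn unfolding expand by (intro nn_integral_eq_integral) auto
  also have "expectation (\<lambda>x. 1 + \<theta> * (X x - e) + (\<theta> * (X x - e))\<^sup>2)
     = (1 - \<theta> * e + \<theta>\<^sup>2 * e\<^sup>2) + (\<theta> - 2 * \<theta>\<^sup>2 * e) * e + \<theta>\<^sup>2 * expectation (\<lambda>x. (X x)\<^sup>2)"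
    unfolding expand using int by (simp add: prob_space e_def)
  also have "\<dots> = 1 + \<theta>\<^sup>2 * expectation (\<lambda>x. (X x)\<^sup>2) - \<theta>\<^sup>2 * e\<^sup>2"
    by (simp add: power2_eq_square algebra_simps)
  also have "\<dots> \<le> exp (\<theta>\<^sup>2 * expectation (\<lambda>x. (X x)\<^sup>2))"
    using exp_ge_add_one_self[of "\<theta>\<^sup>2 * expectation (\<lambda>x. (X x)\<^sup>2)"]
      mult_nonneg_nonneg[OF zero_le_power2[of \<theta>] zero_le_power2[of e]] by linarith
  finally show ?thesis by (simp add: e_def ennreal_leI)
qed

section \<open>Suprema controlled by finitely many points\<close>

lemma interval_grid:
  fixes lo hi x :: real
  assumes "lo < hi" "x \<in> {lo..hi}" "0 < N"
  obtains i where "i \<le> N" "\<bar>x - (lo + real i * (hi - lo) / real N)\<bar> \<le> (hi - lo) / real N"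
proof
  define y where "y = (x - lo) * real N / (hi - lo)"
  have y: "0 \<le> y" "y \<le> real N" and x: "x = lo + y * (hi - lo) / real N"
    using assms by (auto simp: y_def field_simps mult_left_mono)
  show "nat \<lfloor>y\<rfloor> \<le> N" using y by linarith
  have "\<bar>y - real (nat \<lfloor>y\<rfloor>)\<bar> \<le> 1" using y by linarith
  then have "\<bar>y - real (nat \<lfloor>y\<rfloor>)\<bar> * ((hi - lo) / real N) \<le> 1 * ((hi - lo) / real N)"
    using assms by (intro mult_right_mono) auto
  also have "\<bar>y - real (nat \<lfloor>y\<rfloor>)\<bar> * ((hi - lo) / real N) = \<bar>x - (lo + real (nat \<lfloor>y\<rfloor>) * (hi - lo) / real N)\<bar>"
  proof -
    have "x - (lo + real (nat \<lfloor>y\<rfloor>) * (hi - lo) / real N) = (y - real (nat \<lfloor>y\<rfloor>)) * ((hi - lo) / real N)"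
      using assms unfolding x by (simp add: field_simps)
    then show ?thesis using assms by (simp add: abs_mult)
  qed
  finally show "\<bar>x - (lo + real (nat \<lfloor>y\<rfloor>) * (hi - lo) / real N)\<bar> \<le> (hi - lo) / real N" by simp
qed

lemma grid_mem:
  fixes lo hi :: real
  assumes "lo < hi" "i \<le> N"
  shows "lo + real i * (hi - lo) / real N \<in> {lo..hi}"
proof (cases "N = 0")
  case False
  then have "real i / real N \<le> 1" "0 \<le> real i / real N" using assms by auto
  then have "real i / real N * (hi - lo) \<le> 1 * (hi - lo)"
    using assms by (intro mult_right_mono) auto
  moreover have "0 \<le> real i / real N * (hi - lo)" using assms by auto
  moreover have "real i / real N * (hi - lo) = real i * (hi - lo) / real N" by simp
  ultimately show ?thesis by auto
qed (use assms in auto)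

text \<open>Telescoping along the grid, then a Lipschitz step from the nearest grid point. The
  right-hand side does not involve \<open>x\<close>, so it bounds the supremum and its expectation
  can be taken term by term.\<close>

lemma abs_le_sum_increments:
  fixes F :: "real \<Rightarrow> real" and N :: nat and lo hi :: real
  defines "t \<equiv> \<lambda>i. lo + real i * (hi - lo) / real N"
  assumes "lo < hi" "0 < N" "x \<in> {lo..hi}"
    and lip: "\<And>s t. s \<in> {lo..hi} \<Longrightarrow> t \<in> {lo..hi} \<Longrightarrow> \<bar>F s - F t\<bar> \<le> L * \<bar>s - t\<bar>"
    and L: "0 \<le> L"
  shows "\<bar>F x\<bar> \<le> \<bar>F lo\<bar> + (\<Sum>i<N. \<bar>F (t (Suc i)) - F (t i)\<bar>) + L * ((hi - lo) / real N)"
proof -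
  obtain i where i: "i \<le> N" "\<bar>x - t i\<bar> \<le> (hi - lo) / real N"
    using interval_grid[OF assms(2,4,3)] unfolding t_def by blast
  have "\<bar>F x - F (t i)\<bar> \<le> L * \<bar>x - t i\<bar>"
    using grid_mem[OF assms(2) i(1)] assms by (intro lip) (auto simp: t_def)
  also have "\<dots> \<le> L * ((hi - lo) / real N)" using i L by (intro mult_left_mono)
  finally have 1: "\<bar>F x - F (t i)\<bar> \<le> L * ((hi - lo) / real N)" .
  have "F (t k) = F (t 0) + (\<Sum>j<k. F (t (Suc j)) - F (t j))" for k
    by (induction k) auto
  from this[of i]
  have "\<bar>F (t i) - F (t 0)\<bar> \<le> (\<Sum>j<i. \<bar>F (t (Suc j)) - F (t j)\<bar>)"
    by simp
  also have "\<dots> \<le> (\<Sum>j<N. \<bar>F (t (Suc j)) - F (t j)\<bar>)"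
    using i by (intro sum_mono2) auto
  finally have "\<bar>F (t i) - F lo\<bar> \<le> (\<Sum>j<N. \<bar>F (t (Suc j)) - F (t j)\<bar>)" by (simp add: t_def)
  with 1 show ?thesis by linarith
qed

text \<open>Pathwise form of the exponential maximal inequality: \<open>u \<le> exp u\<close> at
  \<open>u = \<theta> * (\<bar>S w\<bar> - T)\<close>, and one exponential is at most the sum over
  \<open>G\<close>. The level \<open>T\<close> stays free until the expectation of that sum has been
  bounded.\<close>

lemma abs_le_sum_exp:
  fixes S :: "'i \<Rightarrow> real"
  assumes "finite G" "w \<in> G" "0 < \<theta>"
  shows "\<bar>S w\<bar> \<le> T + exp (- (\<theta> * T)) / \<theta> * (\<Sum>v\<in>G. exp (\<theta> * S v) + exp (- \<theta> * S v))"
proof -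
  have "\<theta> * (\<bar>S w\<bar> - T) \<le> exp (\<theta> * (\<bar>S w\<bar> - T))"
    using exp_ge_add_one_self[of "\<theta> * (\<bar>S w\<bar> - T)"] by linarith
  then have "\<bar>S w\<bar> - T \<le> exp (\<theta> * (\<bar>S w\<bar> - T)) / \<theta>"
    using assms by (simp add: field_simps)
  also have "exp (\<theta> * (\<bar>S w\<bar> - T)) / \<theta> = exp (- (\<theta> * T)) / \<theta> * exp (\<theta> * \<bar>S w\<bar>)"
    by (simp add: right_diff_distrib exp_diff exp_minus field_simps)
  finally have *: "\<bar>S w\<bar> - T \<le> exp (- (\<theta> * T)) / \<theta> * exp (\<theta> * \<bar>S w\<bar>)" .
  have "exp (\<theta> * \<bar>S w\<bar>) \<le> exp (\<theta> * S w) + exp (- \<theta> * S w)"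
    by (cases "0 \<le> S w") auto
  also have "\<dots> \<le> (\<Sum>v\<in>G. exp (\<theta> * S v) + exp (- \<theta> * S v))"
    using assms by (intro member_le_sum) auto
  finally have "exp (- (\<theta> * T)) / \<theta> * exp (\<theta> * \<bar>S w\<bar>)
      \<le> exp (- (\<theta> * T)) / \<theta> * (\<Sum>v\<in>G. exp (\<theta> * S v) + exp (- \<theta> * S v))"
    using assms by (intro mult_left_mono) auto
  with * show ?thesis by linarith
qed

section \<open>Taylor expansion in a Hoelder class\<close>

lemma has_derivative_power_div_fact:
  "((\<lambda>x. (x - w) ^ Suc k / fact (Suc k)) has_real_derivative (x - w) ^ k / fact k) (at x within S)"
proof -
  have "((\<lambda>x. (x - w) ^ Suc k / fact (Suc k)) has_real_derivative (real (Suc k) * (x - w) ^ k) / fact (Suc k)) (at x within S)"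
    by (rule derivative_eq_intros refl | simp del: fact_Suc of_nat_Suc)+
  also have "(real (Suc k) * (x - w) ^ k) / fact (Suc k) = (x - w) ^ k / fact k"
    by (simp del: of_nat_Suc)
  finally show ?thesis .
qed

text \<open>The Taylor polynomial is truncated at degree \<open>p - 1\<close>, the degree up to which a kernel of
  order \<open>p\<close> annihilates monomials; coefficients beyond the smoothness of \<open>g\<close> are taken to be 0.\<close>

lemma holder_class_taylor:
  assumes g: "g \<in> holder_class \<beta> C {lo..hi}" and C: "0 < C" and \<beta>: "1 \<le> \<beta>" and p: "1 \<le> p"
    and w: "w \<in> {lo..hi}"
  obtains c :: "nat \<Rightarrow> real" where "\<And>s. s \<in> {lo..hi} \<Longrightarrow>
    \<bar>g s - g w - (\<Sum>r\<in>{1..<p}. c r * (s - w) ^ r)\<bar> \<le> C * \<bar>s - w\<bar> powr min (real p) \<beta>"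
proof -
  define m where "m = nat (\<lceil>\<beta>\<rceil> - 1)"
  have m: "real m < \<beta>" "\<beta> \<le> real m + 1"
    using \<beta> unfolding m_def by linarith+
  obtain D where D0: "\<And>x. x \<in> {lo..hi} \<Longrightarrow> D 0 x = g x"
    and D: "\<And>r x. r < m \<Longrightarrow> x \<in> {lo..hi} \<Longrightarrow> (D r has_real_derivative D (Suc r) x) (at x within {lo..hi})"
    and DC: "\<And>r x. r \<in> {1..m} \<Longrightarrow> x \<in> {lo..hi} \<Longrightarrow> \<bar>D r x\<bar> \<le> C"
    and Dm: "\<And>x x'. x \<in> {lo..hi} \<Longrightarrow> x' \<in> {lo..hi} \<Longrightarrow> \<bar>D m x - D m x'\<bar> \<le> C * \<bar>x - x'\<bar> powr (\<beta> - real m)"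
    using g unfolding holder_class_def Let_def m_def[symmetric] by blast
  define T where "T = (\<lambda>k s. \<Sum>i<k. D i w * (s - w) ^ i / fact i)"
  have T: "T (Suc k) s = g w + (\<Sum>r\<in>{1..<Suc k}. D r w / fact r * (s - w) ^ r)" for k s
    unfolding T_def sum.lessThan_Suc_shift using D0[OF w]
    by (simp add: sum.atLeast_Suc_lessThan_Suc_shift atLeast0LessThan del: sum.op_ivl_Suc fact_Suc)
  have le_C: "x / fact k \<le> x" if "0 \<le> x" for x :: real and k
    using that fact_ge_1[of k, where 'a=real] mult_left_mono[of 1 "fact k" x]
    by (simp add: divide_le_eq)
  \<comment> \<open>If \<open>p \<le> m\<close>, the bounded derivative \<open>D p\<close> leaves a
    remainder of order \<open>p\<close>. Otherwise \<open>p\<close> is at least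
    \<open>m + 1\<close>, hence at least \<beta>, the minimum is \<beta>, and the Hoelder bound on
    \<open>D m\<close> has to be used.\<close>
  show ?thesis
  proof (cases "p \<le> m")
    case True
    show ?thesis
    proof (rule that[of "\<lambda>r. D r w / fact r"])
      fix s assume s: "s \<in> {lo..hi}"
      have "norm (D 0 s - (\<Sum>i\<le>p - 1. D i w * (s - w) ^ i / fact i)) \<le> C * norm (s - w) ^ Suc (p - 1) / fact (p - 1)"
        using True p by (intro field_Taylor[where S="{lo..hi}"] D w s) (auto intro: DC)
      also have "\<dots> \<le> C * norm (s - w) ^ Suc (p - 1)"
        using C by (intro le_C) auto
      also have "(\<Sum>i\<le>p - 1. D i w * (s - w) ^ i / fact i) = T (Suc (p - 1)) s"
        by (simp add: T_def lessThan_Suc_atMost)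
      finally have "\<bar>g s - T (Suc (p - 1)) s\<bar> \<le> C * \<bar>s - w\<bar> ^ p"
        using p D0[OF s] by simp
      moreover have "\<bar>s - w\<bar> powr min (real p) \<beta> = \<bar>s - w\<bar> ^ p"
        using m True p by (cases "s = w") (auto simp: powr_realpow min_def)
      ultimately show "\<bar>g s - g w - (\<Sum>r = 1..<p. D r w / fact r * (s - w) ^ r)\<bar> \<le> C * \<bar>s - w\<bar> powr min (real p) \<beta>"
        unfolding T using p by (simp add: diff_diff_eq)
    qed
  next
    case False
    define c where "c = (\<lambda>r. if r \<le> m then D r w / fact r else 0)"
    have Tm: "\<bar>g s - T (Suc m) s\<bar> \<le> C * \<bar>s - w\<bar> powr \<beta>" if s: "s \<in> {lo..hi}" for s
    proof (cases m)
      case 0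
      then show ?thesis using Dm[OF s w] D0[OF s] D0[OF w] by (simp add: T_def)
    next
      case (Suc m')
      \<comment> \<open>\<open>E i\<close> is the \<open>i\<close>-th derivative of \<open>g\<close>
        minus its top Taylor monomial, so \<open>E m\<close> is \<open>D m x - D m w\<close>, which
        the Hoelder condition makes small near \<open>w\<close>. Taylor's formula of degree
        \<open>m - 1\<close> for \<open>E\<close> then gives degree \<open>m\<close> for
        \<open>g\<close>.\<close>
      define E where "E = (\<lambda>i x. D i x - D m w * ((x - w) ^ (m - i) / fact (m - i)))"
      have "norm (E 0 s - (\<Sum>i\<le>m'. E i w * (s - w) ^ i / fact i))
          \<le> (C * \<bar>s - w\<bar> powr (\<beta> - real m)) * norm (s - w) ^ Suc m' / fact m'"
      \<comment> \<open>On the segment, unlike on the whole interval,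
        \<open>\<bar>x - w\<bar> \<le> \<bar>s - w\<bar>\<close>, so the top derivative is bounded
        by the distance to the point of interest.\<close>
      proof (rule field_Taylor[where S="closed_segment w s"])
        fix i x assume x: "x \<in> closed_segment w s" and i: "i \<le> m'"
        have sub: "closed_segment w s \<subseteq> {lo..hi}"
          using w s by (intro closed_segment_subset) auto
        have mi: "m - i = Suc (m - Suc i)" using i Suc by simp
        have d: "((\<lambda>x. (x - w) ^ (m - i) / fact (m - i)) has_real_derivative (x - w) ^ (m - Suc i) / fact (m - Suc i))
            (at x within closed_segment w s)"
          unfolding mi by (rule has_derivative_power_div_fact)
        have "(D i has_real_derivative D (Suc i) x) (at x within closed_segment w s)"
          using x i Suc sub by (intro DERIV_subset[OF D _]) auto
        then show "(E i has_real_derivative E (Suc i) x) (at x within closed_segment w s)"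
          unfolding E_def by (intro DERIV_diff DERIV_cmult d)
      next
        fix x assume x: "x \<in> closed_segment w s"
        have sub: "closed_segment w s \<subseteq> {lo..hi}"
          using w s by (intro closed_segment_subset) auto
        have "\<bar>D m x - D m w\<bar> \<le> C * \<bar>x - w\<bar> powr (\<beta> - real m)"
          using x sub w by (intro Dm) auto
        also have "\<dots> \<le> C * \<bar>s - w\<bar> powr (\<beta> - real m)"
          using x C m by (intro mult_left_mono powr_mono2) (auto simp: closed_segment_eq_real_ivl split: if_splits)
        finally show "norm (E (Suc m') x) \<le> C * \<bar>s - w\<bar> powr (\<beta> - real m)"
          by (simp add: E_def Suc)
      qed auto
      also have "\<dots> \<le> (C * \<bar>s - w\<bar> powr (\<beta> - real m)) * norm (s - w) ^ Suc m'"
        using C by (intro le_C) auto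
      also have "\<dots> = C * \<bar>s - w\<bar> powr \<beta>"
      proof (cases "s = w")
        case False
        then have "\<bar>s - w\<bar> powr (\<beta> - real m) * \<bar>s - w\<bar> ^ Suc m' = \<bar>s - w\<bar> powr (\<beta> - real m) * \<bar>s - w\<bar> powr real m"
          by (simp add: powr_realpow Suc del: power_Suc of_nat_Suc)
        also have "\<dots> = \<bar>s - w\<bar> powr \<beta>" by (simp add: powr_add[symmetric])
        finally show ?thesis by simp
      qed simp
      also have "(\<Sum>i\<le>m'. E i w * (s - w) ^ i / fact i) = T m s"
        unfolding T_def Suc lessThan_Suc_atMost[symmetric]
        by (intro sum.cong) (auto simp: E_def Suc)
      also have "E 0 s - T m s = g s - T (Suc m) s"
        by (simp add: E_def T_def D0[OF s])
      finally show ?thesis by simp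
    qed
    show ?thesis
    proof (rule that[of c])
      fix s assume s: "s \<in> {lo..hi}"
      have "(\<Sum>r\<in>{1..<p}. c r * (s - w) ^ r) = (\<Sum>r\<in>{1..<Suc m}. D r w / fact r * (s - w) ^ r)"
        using False by (intro sum.mono_neutral_cong_right) (auto simp: c_def)
      moreover have "min (real p) \<beta> = \<beta>" using False m by auto
      ultimately show "\<bar>g s - g w - (\<Sum>r = 1..<p. c r * (s - w) ^ r)\<bar> \<le> C * \<bar>s - w\<bar> powr min (real p) \<beta>"
        using Tm[OF s] by (simp add: T diff_diff_eq del: sum.op_ivl_Suc)
    qed
  qed
qed

section \<open>Laws of the latent variables\<close>

text \<open>A countable family of half-lines determines a finite measure. This allows almost sure
  identities, one for each set, to be collected on a single null set.\<close>

lemma measure_eqI_atMost_rat: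
  fixes M N :: "real measure"
  assumes sets: "sets M = sets borel" "sets N = sets borel" and "finite_measure M"
    and eq: "\<And>q. emeasure M {..real_of_rat q} = emeasure N {..real_of_rat q}"
  shows "M = N"
proof -
  interpret finite_measure M by fact
  let ?E = "range (\<lambda>q. {..real_of_rat q})"
  have "sets borel = sigma_sets UNIV ?E"
  proof (rule antisym)
    have "{..x} \<in> sigma_sets UNIV ?E" for x :: real
    proof -
      have "{..x} = (\<Inter>q\<in>{q. x < real_of_rat q}. {..real_of_rat q})"
      proof (intro set_eqI iffI)
        fix y assume y: "y \<in> (\<Inter>q\<in>{q. x < real_of_rat q}. {..real_of_rat q})"
        show "y \<in> {..x}"
        proof (rule ccontr)
          assume "y \<notin> {..x}"
          then obtain q where "x < of_rat q" "of_rat q < y" using of_rat_dense[of x y] by auto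
          with y show False by auto
        qed
      qed auto
      moreover obtain q where "x < of_rat q" using of_rat_dense[of x "x + 1"] by auto
      then have "{q. x < real_of_rat q} \<noteq> {}" by auto
      ultimately show ?thesis
        using sigma_algebra.countable_INT'[of UNIV "sigma_sets UNIV ?E" "{q. x < real_of_rat q}" "\<lambda>q. {..real_of_rat q}"]
        by (auto simp: sigma_algebra_sigma_sets)
    qed
    then show "sets borel \<subseteq> sigma_sets UNIV ?E"
      unfolding borel_eq_atMost by (auto simp: sets_measure_of intro!: sigma_sets_mono)
    show "sigma_sets UNIV ?E \<subseteq> sets borel"
      by (rule sets.sigma_sets_subset'[of _ "borel :: real measure", simplified]) auto
  qed
  then show ?thesis
    using sets eq
  proof (intro measure_eqI_generator_eq[where E="?E" and \<Omega>=UNIV and A="\<lambda>i. {..real i}"])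
    show "Int_stable ?E"
    proof (rule Int_stableI_image)
      fix q r :: rat
      have "{..real_of_rat q} \<inter> {..real_of_rat r} = {..real_of_rat (min q r)}"
        by (auto simp: min_def of_rat_less_eq)
      then show "\<exists>c\<in>UNIV. {..real_of_rat q} \<inter> {..real_of_rat r} = {..real_of_rat c}" by blast
    qed
    show "range (\<lambda>i. {..real i}) \<subseteq> ?E"
      by (auto intro!: image_eqI[where x="of_nat _"])
    show "(\<Union>i. {..real i}) = UNIV" using real_arch_simple by auto
  qed auto
qed

text \<open>Turns independence of the generated sigma-algebras, the form of the data assumption,
  into a product law to which Fubini applies.\<close>

lemma (in prob_space) distr_pair_indep_set:
  assumes [measurable]: "X \<in> measurable M S" "Y \<in> measurable M T"
    and ind: "indep_set (sets (vimage_algebra (space M) X S)) (sets (vimage_algebra (space M) Y T))"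
  shows "distr M (S \<Otimes>\<^sub>M T) (\<lambda>\<omega>. (X \<omega>, Y \<omega>)) = distr M S X \<Otimes>\<^sub>M distr M T Y"
proof (rule sym, rule pair_measure_eqI)
  show "sigma_finite_measure (distr M S X)" "sigma_finite_measure (distr M T Y)"
    by (auto intro!: prob_space_imp_sigma_finite prob_space_distr)
  fix C D assume "C \<in> sets (distr M S X)" "D \<in> sets (distr M T Y)"
  then have [measurable]: "C \<in> sets S" "D \<in> sets T" by auto
  have "prob ((X -` C \<inter> space M) \<inter> (Y -` D \<inter> space M)) = prob (X -` C \<inter> space M) * prob (Y -` D \<inter> space M)"
    by (intro indep_setD[OF ind] in_vimage_algebra) auto
  moreover have "(\<lambda>\<omega>. (X \<omega>, Y \<omega>)) -` (C \<times> D) \<inter> space M = (X -` C \<inter> space M) \<inter> (Y -` D \<inter> space M)" by auto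
  ultimately show "emeasure (distr M S X) C * emeasure (distr M T Y) D
      = emeasure (distr M (S \<Otimes>\<^sub>M T) (\<lambda>\<omega>. (X \<omega>, Y \<omega>))) (C \<times> D)"
    by (simp add: emeasure_distr emeasure_eq_measure ennreal_mult)
qed auto

locale dyadic_interval = dyadic_data +
  fixes lo hi :: real
  assumes W_eq: "\<W> = {lo..hi}" and lo_less_hi: "lo < hi"
begin

definition "law_A = distr M borel (A 1)"
definition "law_V = distr M borel (V 1 2)"

lemma W_in_borel [measurable]: "\<W> \<in> sets borel"
  by (simp add: W_eq)

lemma A_measurable [measurable]: "1 \<le> i \<Longrightarrow> A i \<in> borel_measurable M"
  using A_indep[of "max 2 i"] by (auto simp: indep_vars_def2)

lemma V_measurable [measurable]: "1 \<le> i \<Longrightarrow> i < j \<Longrightarrow> V i j \<in> borel_measurable M"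
  using V_indep[of j] by (force simp: indep_vars_def2)

lemma W_measurable_raw [measurable (raw)]:
  assumes "a \<in> borel_measurable N" "b \<in> borel_measurable N" "c \<in> borel_measurable N"
  shows "(\<lambda>x. W (a x) (b x) (c x)) \<in> borel_measurable N"
  using measurable_compose[OF _ W_measurable, of "\<lambda>x. (a x, b x, c x)" N] assms by simp

lemma f_WAA_measurable_raw [measurable (raw)]:
  assumes "a \<in> borel_measurable N" "b \<in> borel_measurable N" "c \<in> borel_measurable N"
  shows "(\<lambda>x. f_WAA (a x) (b x) (c x)) \<in> borel_measurable N"
  using measurable_compose[OF _ f_WAA_measurable, of "\<lambda>x. (a x, b x, c x)" N] assms by simp

lemma sets_law_A [simp, measurable_cong]: "sets law_A = sets borel"
  and sets_law_V [simp, measurable_cong]: "sets law_V = sets borel"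
  and space_law_A [simp]: "space law_A = UNIV"
  and space_law_V [simp]: "space law_V = UNIV"
  by (simp_all add: law_A_def law_V_def)

lemma prob_space_law_A: "prob_space law_A" and prob_space_law_V: "prob_space law_V"
  by (auto simp: law_A_def law_V_def intro!: prob_space_distr)

sublocale A: prob_space law_A by (rule prob_space_law_A)
sublocale V: prob_space law_V by (rule prob_space_law_V)
sublocale AA: pair_prob_space law_A law_A ..

lemma distr_A: "1 \<le> i \<Longrightarrow> distr M borel (A i) = law_A"
  unfolding law_A_def by (rule A_ident)

lemma distr_V: "1 \<le> i \<Longrightarrow> i < j \<Longrightarrow> distr M borel (V i j) = law_V"
proof -
  have *: "distr M borel (V i j) = density lborel f_V" if "1 \<le> i" "i < j" for i j
    using distributed_distr_eq_density[OF V_density[OF that]] by (metis distr_cong sets_lborel)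
  assume "1 \<le> i" "i < j"
  with *[of i j] *[of 1 2] show ?thesis by (simp add: law_V_def)
qed

definition "A_vec n \<omega> = (\<lambda>i\<in>{1..n}. A i \<omega>)"
definition "V_vec n \<omega> = (\<lambda>(i, j)\<in>pairs n. V i j \<omega>)"

lemma A_vec_measurable [measurable]: "A_vec n \<in> measurable M (PiM {1..n} (\<lambda>_. borel))"
  unfolding A_vec_def by (rule measurable_restrict) auto

lemma V_vec_measurable [measurable]: "V_vec n \<in> measurable M (PiM (pairs n) (\<lambda>_. borel))"
  unfolding V_vec_def by (rule measurable_restrict) (auto simp: pairs_def)

lemma distr_A_vec:
  assumes "2 \<le> n"
  shows "distr M (PiM {1..n} (\<lambda>_. borel)) (A_vec n) = PiM {1..n} (\<lambda>_. law_A)"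
proof -
  have "distr M (PiM {1..n} (\<lambda>_. borel)) (A_vec n) = PiM {1..n} (\<lambda>i. distr M borel (A i))"
    using A_indep[OF assms] assms unfolding A_vec_def
    by (subst (asm) indep_vars_iff_distr_eq_PiM') auto
  also have "\<dots> = PiM {1..n} (\<lambda>_. law_A)"
    by (intro PiM_cong) (simp_all add: distr_A)
  finally show ?thesis .
qed

lemma distr_V_vec:
  assumes "2 \<le> n"
  shows "distr M (PiM (pairs n) (\<lambda>_. borel)) (V_vec n) = PiM (pairs n) (\<lambda>_. law_V)"
proof -
  have "(1, 2) \<in> pairs n" using assms by (simp add: pairs_def)
  then have ne: "pairs n \<noteq> {}" by blast
  have "distr M (PiM (pairs n) (\<lambda>_. borel)) (V_vec n) = PiM (pairs n) (\<lambda>p. distr M borel (case p of (i, j) \<Rightarrow> V i j))"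
  proof -
    have "V_vec n = (\<lambda>\<omega>. \<lambda>p\<in>pairs n. (case p of (i, j) \<Rightarrow> V i j) \<omega>)"
      by (auto simp: V_vec_def fun_eq_iff restrict_def)
    then show ?thesis
      using V_indep[OF assms] ne unfolding pairs_def[symmetric]
      by (subst (asm) indep_vars_iff_distr_eq_PiM') (auto simp: pairs_def)
  qed
  also have "\<dots> = PiM (pairs n) (\<lambda>_. law_V)"
    by (intro PiM_cong) (auto simp: pairs_def distr_V)
  finally show ?thesis .
qed

lemma joint_law:
  assumes n: "2 \<le> n"
  shows "distr M (PiM {1..n} (\<lambda>_. borel) \<Otimes>\<^sub>M PiM (pairs n) (\<lambda>_. borel)) (\<lambda>\<omega>. (A_vec n \<omega>, V_vec n \<omega>))
    = PiM {1..n} (\<lambda>_. law_A) \<Otimes>\<^sub>M PiM (pairs n) (\<lambda>_. law_V)"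
proof -
  have "indep_set (sets (vimage_algebra (space M) (A_vec n) (PiM {1..n} (\<lambda>_. borel))))
      (sets (vimage_algebra (space M) (V_vec n) (PiM (pairs n) (\<lambda>_. borel))))"
    using A_V_indep[OF n] unfolding pairs_def[symmetric] A_vec_def[abs_def] V_vec_def[abs_def] .
  from distr_pair_indep_set[OF A_vec_measurable V_vec_measurable this] show ?thesis
    unfolding distr_A_vec[OF n] distr_V_vec[OF n] .
qed

text \<open>The order of \<open>i\<close> and \<open>j\<close> is left open because the symmetry of
  the conditional density compares the pairs \<open>(1, 2)\<close> and
  \<open>(2, 1)\<close>.\<close>

lemma law_pair:
  assumes "1 \<le> i" "1 \<le> j" "i \<noteq> j"
  shows "distr M (borel \<Otimes>\<^sub>M borel) (\<lambda>\<omega>. (A i \<omega>, A j \<omega>)) = law_A \<Otimes>\<^sub>M law_A"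
proof -
  define n where "n = max i j"
  have n: "2 \<le> n" "i \<in> {1..n}" "j \<in> {1..n}" using assms by (auto simp: n_def)
  have [measurable]: "(\<lambda>x. x i) \<in> measurable (PiM {1..n} (\<lambda>_. borel)) borel" "(\<lambda>x. x j) \<in> measurable (PiM {1..n} (\<lambda>_. borel)) borel"
    using n by auto
  have "distr M (borel \<Otimes>\<^sub>M borel) (\<lambda>\<omega>. (A i \<omega>, A j \<omega>))
     = distr (distr M (PiM {1..n} (\<lambda>_. borel)) (A_vec n)) (borel \<Otimes>\<^sub>M borel) (\<lambda>x. (x i, x j))"
    using n by (subst distr_distr[OF _ A_vec_measurable]) (auto simp: A_vec_def comp_def intro!: distr_cong)
  also have "\<dots> = distr (PiM {1..n} (\<lambda>_. law_A)) (law_A \<Otimes>\<^sub>M law_A) (\<lambda>x. (x i, x j))"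
    unfolding distr_A_vec[OF n(1)] by (intro distr_cong) (auto intro!: sets_pair_measure_cong)
  also have "\<dots> = law_A \<Otimes>\<^sub>M law_A"
    using n assms by (intro A.distr_PiM_pair) auto
  finally show ?thesis .
qed

lemma law_triple:
  assumes "1 \<le> i" "i < j"
  shows "distr M ((borel \<Otimes>\<^sub>M borel) \<Otimes>\<^sub>M borel) (\<lambda>\<omega>. ((A i \<omega>, A j \<omega>), V i j \<omega>)) = (law_A \<Otimes>\<^sub>M law_A) \<Otimes>\<^sub>M law_V"
proof -
  have n: "2 \<le> j" "i \<in> {1..j}" "j \<in> {1..j}" "(i, j) \<in> pairs j" using assms by (auto simp: pairs_def)
  let ?P = "PiM {1..j} (\<lambda>_. borel :: real measure)" and ?Q = "PiM (pairs j) (\<lambda>_. borel :: real measure)"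
  have [measurable]: "(\<lambda>x. x i) \<in> measurable ?P borel" "(\<lambda>x. x j) \<in> measurable ?P borel"
      "(\<lambda>x. x (i, j)) \<in> measurable ?Q borel"
    using n by auto
  interpret PA: prob_space "PiM {1..j} (\<lambda>_. law_A)" by (intro prob_space_PiM prob_space_law_A)
  interpret PV: prob_space "PiM (pairs j) (\<lambda>_. law_V)" by (intro prob_space_PiM prob_space_law_V)
  have "distr M ((borel \<Otimes>\<^sub>M borel) \<Otimes>\<^sub>M borel) (\<lambda>\<omega>. ((A i \<omega>, A j \<omega>), V i j \<omega>))
     = distr (distr M (?P \<Otimes>\<^sub>M ?Q) (\<lambda>\<omega>. (A_vec j \<omega>, V_vec j \<omega>))) ((borel \<Otimes>\<^sub>M borel) \<Otimes>\<^sub>M borel)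
        (\<lambda>(x, y). ((x i, x j), y (i, j)))"
    using n by (subst distr_distr[OF _ measurable_Pair[OF A_vec_measurable V_vec_measurable]])
      (auto simp: A_vec_def V_vec_def comp_def intro!: distr_cong)
  also have "\<dots> = distr (PiM {1..j} (\<lambda>_. law_A) \<Otimes>\<^sub>M PiM (pairs j) (\<lambda>_. law_V)) ((law_A \<Otimes>\<^sub>M law_A) \<Otimes>\<^sub>M law_V)
        (\<lambda>(x, y). ((x i, x j), y (i, j)))"
    unfolding joint_law[OF n(1)] by (intro distr_cong) (auto intro!: sets_pair_measure_cong)
  also have "\<dots> = distr (PiM {1..j} (\<lambda>_. law_A)) (law_A \<Otimes>\<^sub>M law_A) (\<lambda>x. (x i, x j))
      \<Otimes>\<^sub>M distr (PiM (pairs j) (\<lambda>_. law_V)) law_V (\<lambda>y. y (i, j))"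
    using n by (intro pair_measure_distr[symmetric] prob_space_imp_sigma_finite PV.prob_space_distr) auto
  also have "distr (PiM (pairs j) (\<lambda>_. law_V)) law_V (\<lambda>y. y (i, j)) = law_V"
    using n by (intro distr_PiM_component prob_space_law_V) auto
  also have "distr (PiM {1..j} (\<lambda>_. law_A)) (law_A \<Otimes>\<^sub>M law_A) (\<lambda>x. (x i, x j)) = law_A \<Otimes>\<^sub>M law_A"
    using n assms by (intro A.distr_PiM_pair) auto
  finally show ?thesis .
qed

text \<open>The set \<open>\<A>\<close> need not be measurable, so membership in \<open>\<A>\<close> does not transfer from \<open>M\<close> to the law of
  \<open>(A\<^sub>i, A\<^sub>j)\<close>; its consequences do, in the form of measurable predicates.\<close>

lemma AE_law_pairI:
  assumes "Measurable.pred (law_A \<Otimes>\<^sub>M law_A) P" "1 \<le> i" "1 \<le> j" "i \<noteq> j" "AE \<omega> in M. P (A i \<omega>, A j \<omega>)"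
  shows "AE z in law_A \<Otimes>\<^sub>M law_A. P z"
proof -
  have [measurable]: "A i \<in> borel_measurable M" "A j \<in> borel_measurable M" using assms by auto
  have [measurable]: "Measurable.pred (borel \<Otimes>\<^sub>M borel) P"
    using assms(1) by (simp cong: measurable_cong_sets)
  have "AE z in distr M (borel \<Otimes>\<^sub>M borel) (\<lambda>\<omega>. (A i \<omega>, A j \<omega>)). P z"
    using assms(5) by (subst AE_distr_iff) auto
  then show ?thesis unfolding law_pair[OF assms(2-4)] .
qed

lemma AE_law_pairD:
  assumes "1 \<le> i" "1 \<le> j" "i \<noteq> j" "AE z in law_A \<Otimes>\<^sub>M law_A. P z"
  shows "AE \<omega> in M. P (A i \<omega>, A j \<omega>)"
proof -
  have [measurable]: "A i \<in> borel_measurable M" "A j \<in> borel_measurable M" using assms by auto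
  from assms(4) have "AE z in distr M (borel \<Otimes>\<^sub>M borel) (\<lambda>\<omega>. (A i \<omega>, A j \<omega>)). P z"
    unfolding law_pair[OF assms(1-3)] .
  from AE_distrD[OF _ this] show ?thesis by simp
qed

text \<open>The assumed density concerns a conditional expectation on \<open>M\<close>. Since
  \<open>V 1 2\<close> is independent of the pair \<open>(A 1, A 2)\<close>, conditioning amounts to
  freezing the first two arguments of \<open>W\<close>. Both sides, \<open>u\<close> and
  \<open>g\<close>, have the same integral over every measurable set of pairs, so they agree almost
  everywhere.\<close>

lemma conditional_law_W_on:
  assumes [measurable]: "B \<in> sets borel"
  shows "AE z in law_A \<Otimes>\<^sub>M law_A. emeasure (distr law_V borel (W (fst z) (snd z))) B
     = emeasure (density lborel (\<lambda>y. ennreal (f_WAA y (fst z) (snd z)))) B"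
proof -
  let ?X = "\<lambda>\<omega>. (A 1 \<omega>, A 2 \<omega>)" and ?Y = "\<lambda>\<omega>. W (A 1 \<omega>) (A 2 \<omega>) (V 1 2 \<omega>)"
  let ?\<mu> = "law_A \<Otimes>\<^sub>M law_A"
  define F where "F = vimage_algebra (space M) ?X (borel :: (real \<times> real) measure)"
  define u where "u = (\<lambda>z. \<integral>\<^sup>+v. indicator B (W (fst z) (snd z) v) \<partial>law_V)"
  define g where "g = (\<lambda>z. \<integral>\<^sup>+y\<in>B. ennreal (f_WAA y (fst z) (snd z)) \<partial>lborel)"
  have X[measurable]: "?X \<in> borel_measurable M" by (simp add: borel_measurable_Pair)
  have X'[measurable]: "?X \<in> measurable M (borel \<Otimes>\<^sub>M borel)" by simp
  have Y[measurable]: "?Y \<in> borel_measurable M" by simp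
  have [measurable]: "u \<in> borel_measurable ?\<mu>" "g \<in> borel_measurable ?\<mu>"
    unfolding u_def g_def by measurable
  have [measurable]: "u \<in> borel_measurable (borel \<Otimes>\<^sub>M borel)" "g \<in> borel_measurable (borel \<Otimes>\<^sub>M borel)"
    unfolding u_def g_def by measurable
  interpret finite_measure_subalgebra M F
  proof
    show "subalgebra M F"
      unfolding subalgebra_def F_def using measurable_sets[OF X]
      by (auto simp: sets_vimage_algebra2)
  qed
  \<comment> \<open>Both integrals equal the probability that the pair lies in \<open>D\<close> and
    the observation in \<open>B\<close>: for \<open>g\<close> by the defining property of
    conditional expectation, for \<open>u\<close> by the product law of the triple.\<close>
  have set_eq: "(\<integral>\<^sup>+z. indicator D z * u z \<partial>?\<mu>) = (\<integral>\<^sup>+z. indicator D z * g z \<partial>?\<mu>)"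
    if "D \<in> sets ?\<mu>" for D
  proof -
    have D: "D \<in> sets (borel \<Otimes>\<^sub>M borel)" using that by (simp cong: sets_pair_measure_cong)
    note [measurable] = this
    have "(\<lambda>\<omega>. indicator D (?X \<omega>) :: ennreal) \<in> borel_measurable F"
      using D[unfolded borel_prod] unfolding F_def
      by (intro measurable_compose[OF measurable_vimage_algebra1 borel_measurable_indicator])
         auto
    from nn_cond_exp_intg[OF this, of "indicator (?Y -` B \<inter> space M)"]
    have 1: "(\<integral>\<^sup>+\<omega>. indicator D (?X \<omega>) * nn_cond_exp M F (indicator (?Y -` B \<inter> space M)) \<omega> \<partial>M)
       = (\<integral>\<^sup>+\<omega>. indicator D (?X \<omega>) * indicator (?Y -` B \<inter> space M) \<omega> \<partial>M)"
      by simp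
    have "AE \<omega> in M. nn_cond_exp M F (indicator (?Y -` B \<inter> space M)) \<omega> = g (?X \<omega>)"
      using f_WAA_density[of 1 2] assms unfolding conditional_density_def F_def g_def by simp
    then have "(\<integral>\<^sup>+\<omega>. indicator D (?X \<omega>) * nn_cond_exp M F (indicator (?Y -` B \<inter> space M)) \<omega> \<partial>M)
       = (\<integral>\<^sup>+\<omega>. indicator D (?X \<omega>) * g (?X \<omega>) \<partial>M)"
      by (intro nn_integral_cong_AE) auto
    also have "\<dots> = (\<integral>\<^sup>+z. indicator D z * g z \<partial>distr M (borel \<Otimes>\<^sub>M borel) ?X)"
      by (subst nn_integral_distr) auto
    also have "\<dots> = (\<integral>\<^sup>+z. indicator D z * g z \<partial>?\<mu>)"
      by (simp add: law_pair)
    finally have 2: "(\<integral>\<^sup>+z. indicator D z * g z \<partial>?\<mu>)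
        = (\<integral>\<^sup>+\<omega>. indicator D (?X \<omega>) * indicator (?Y -` B \<inter> space M) \<omega> \<partial>M)"
      using 1 by simp
    have "(\<integral>\<^sup>+\<omega>. indicator D (?X \<omega>) * indicator (?Y -` B \<inter> space M) \<omega> \<partial>M)
       = (\<integral>\<^sup>+\<omega>. (\<lambda>(z, v). indicator D z * indicator B (W (fst z) (snd z) v)) (?X \<omega>, V 1 2 \<omega>) \<partial>M)"
      by (intro nn_integral_cong) (auto split: split_indicator)
    also have "\<dots> = (\<integral>\<^sup>+x. (\<lambda>(z, v). indicator D z * indicator B (W (fst z) (snd z) v)) x
        \<partial>distr M ((borel \<Otimes>\<^sub>M borel) \<Otimes>\<^sub>M borel) (\<lambda>\<omega>. (?X \<omega>, V 1 2 \<omega>)))"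
      by (subst nn_integral_distr) auto
    also have "\<dots> = (\<integral>\<^sup>+x. (\<lambda>(z, v). indicator D z * indicator B (W (fst z) (snd z) v)) x \<partial>(?\<mu> \<Otimes>\<^sub>M law_V))"
      by (simp add: law_triple)
    also have "\<dots> = (\<integral>\<^sup>+z. \<integral>\<^sup>+v. indicator D z * indicator B (W (fst z) (snd z) v) \<partial>law_V \<partial>?\<mu>)"
      using that by (subst V.nn_integral_fst[symmetric]) auto
    also have "\<dots> = (\<integral>\<^sup>+z. indicator D z * u z \<partial>?\<mu>)"
      unfolding u_def by (intro nn_integral_cong nn_integral_cmult) auto
    finally show ?thesis using 2 by simp
  qed
  have "density ?\<mu> u = density ?\<mu> g"
  proof (rule measure_eqI)
    fix D assume "D \<in> sets (density ?\<mu> u)"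
    then have D: "D \<in> sets ?\<mu>" by simp
    then show "emeasure (density ?\<mu> u) D = emeasure (density ?\<mu> g) D"
      using set_eq[OF D] by (simp add: emeasure_density mult.commute)
  qed simp
  then have "AE z in ?\<mu>. u z = g z"
    by (subst (asm) AA.density_unique_iff) auto
  then show ?thesis
  proof eventually_elim
    case (elim z)
    have "emeasure (distr law_V borel (W (fst z) (snd z))) B = u z"
    proof -
      have "u z = (\<integral>\<^sup>+y. indicator B y \<partial>distr law_V borel (W (fst z) (snd z)))"
        unfolding u_def by (subst nn_integral_distr) auto
      then show ?thesis by simp
    qed
    moreover have "emeasure (density lborel (\<lambda>y. ennreal (f_WAA y (fst z) (snd z)))) B = g z"
      unfolding g_def by (subst emeasure_density) auto
    ultimately show ?case using elim by simp
  qed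
qed

text \<open>Interchanges "for every set, almost surely" with "almost surely, for every set", by way
  of rational half-lines. Only in this form can a conditional integral of an arbitrary function be
  rewritten.\<close>

lemma conditional_law_W:
  "AE z in law_A \<Otimes>\<^sub>M law_A. distr law_V borel (W (fst z) (snd z))
     = density lborel (\<lambda>y. ennreal (f_WAA y (fst z) (snd z)))"
proof -
  have "AE z in law_A \<Otimes>\<^sub>M law_A. \<forall>q. emeasure (distr law_V borel (W (fst z) (snd z))) {..real_of_rat q}
     = emeasure (density lborel (\<lambda>y. ennreal (f_WAA y (fst z) (snd z)))) {..real_of_rat q}"
    unfolding AE_all_countable by (intro allI conditional_law_W_on) auto
  then show ?thesis
  proof eventually_elim
    case (elim z)
    have "finite_measure (distr law_V borel (W (fst z) (snd z)))"
      by (intro V.finite_measure_distr) auto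
    then show ?case
      using elim by (intro measure_eqI_atMost_rat) auto
  qed
qed

end

section \<open>The conditional densities\<close>

text \<open>The second moment controls the first because the variance of
  \<open>\<bar>Y\<bar>\<close> is nonnegative.\<close>

lemma (in prob_space) nn_integral_abs_le_of_square:
  fixes Y :: "'a \<Rightarrow> real"
  assumes [measurable]: "Y \<in> borel_measurable M" and int: "integrable M (\<lambda>x. (Y x)\<^sup>2)"
    and le: "expectation (\<lambda>x. (Y x)\<^sup>2) \<le> c\<^sup>2" and c: "0 \<le> c"
  shows "(\<integral>\<^sup>+x. ennreal \<bar>Y x\<bar> \<partial>M) \<le> ennreal c"
proof -
  have int': "integrable M (\<lambda>x. \<bar>Y x\<bar>)"
    using square_integrable_imp_integrable[OF _ int] by simp
  have "0 \<le> variance (\<lambda>x. \<bar>Y x\<bar>)" by (rule variance_positive)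
  also have "\<dots> = expectation (\<lambda>x. \<bar>Y x\<bar>\<^sup>2) - (expectation (\<lambda>x. \<bar>Y x\<bar>))\<^sup>2"
    using int int' by (intro variance_eq) simp_all
  finally have "(expectation (\<lambda>x. \<bar>Y x\<bar>))\<^sup>2 \<le> c\<^sup>2" using le by simp
  then have "expectation (\<lambda>x. \<bar>Y x\<bar>) \<le> c" by (rule power2_le_imp_le[OF _ c])
  then show ?thesis
    using int' by (subst nn_integral_eq_integral) (auto intro: ennreal_leI)
qed

text \<open>A nonzero value at \<open>s\<close> persists within distance
  \<open>\<bar>\<phi> s\<bar> / L\<close>, and this neighbourhood meets the interval in a set of
  positive length even if \<open>s\<close> is an endpoint. It upgrades almost everywhere equality of
  densities to equality at each point.\<close>

lemma lipschitz_AE_zero_imp_zero: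
  fixes \<phi> :: "real \<Rightarrow> real"
  assumes lip: "\<And>s t. s \<in> {lo..hi} \<Longrightarrow> t \<in> {lo..hi} \<Longrightarrow> \<bar>\<phi> s - \<phi> t\<bar> \<le> L * \<bar>s - t\<bar>"
    and "0 < L" "lo < hi" and ae: "AE y in lborel. \<phi> y = 0" and s: "s \<in> {lo..hi}"
  shows "\<phi> s = 0"
proof (rule ccontr)
  assume nz: "\<phi> s \<noteq> 0"
  define \<delta> where "\<delta> = \<bar>\<phi> s\<bar> / L"
  have \<delta>: "0 < \<delta>" using nz \<open>0 < L\<close> by (simp add: \<delta>_def)
  define a b where "a = max lo (s - \<delta>)" and "b = min hi (s + \<delta>)"
  have ab: "a < b" using \<delta> s \<open>lo < hi\<close> by (auto simp: a_def b_def)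
  have "\<phi> y \<noteq> 0" if y: "y \<in> {a<..<b}" for y
  proof
    assume "\<phi> y = 0"
    then have "\<bar>\<phi> s\<bar> \<le> L * \<bar>s - y\<bar>"
      using lip[OF s, of y] y by (auto simp: a_def b_def)
    also have "\<dots> < L * \<delta>"
      using y \<open>0 < L\<close> by (intro mult_strict_left_mono) (auto simp: a_def b_def)
    finally show False using \<open>0 < L\<close> by (simp add: \<delta>_def)
  qed
  then have "AE y in lborel. y \<notin> {a<..<b}"
    using ae by (auto elim!: eventually_mono)
  then have "emeasure lborel {a<..<b} = 0"
    by (subst (asm) AE_iff_measurable[of "{a<..<b}"]) auto
  then show False using ab by simp
qed

context dyadic_interval
begin

abbreviation "f_W \<equiv> dens_W M A f_WAA"

text \<open>A nonnegative \<open>C_H\<close>-Lipschitz function on an interval of length \<open>hi - lo\<close> with integral at most 1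
  is bounded by this constant.\<close>

definition "dens_bound = 1 / (hi - lo) + C_H * (hi - lo)"

lemma dens_bound_pos: "0 < dens_bound"
  using lo_less_hi C_H_pos by (simp add: dens_bound_def add_pos_pos)

lemma f_WAA_lipschitz:
  assumes "a \<in> \<A>" "a' \<in> \<A>" "s \<in> \<W>" "t \<in> \<W>"
  shows "\<bar>f_WAA s a a' - f_WAA t a a'\<bar> \<le> C_H * \<bar>s - t\<bar>"
proof -
  from f_WAA_holder[OF assms(1,2)] obtain D where
    "\<forall>x\<in>\<W>. D (0::nat) x = f_WAA x a a'" "\<forall>x\<in>\<W>. \<forall>x'\<in>\<W>. \<bar>D 0 x - D 0 x'\<bar> \<le> C_H * \<bar>x - x'\<bar> powr 1"
    unfolding holder_class_def Let_def by auto
  with assms(3,4) show ?thesis by simp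
qed

lemma AE_nn_integral_f_WAA: "AE z in law_A \<Otimes>\<^sub>M law_A. (\<integral>\<^sup>+y. ennreal (f_WAA y (fst z) (snd z)) \<partial>lborel) = 1"
  using conditional_law_W
proof eventually_elim
  case (elim z)
  have "(\<integral>\<^sup>+y. ennreal (f_WAA y (fst z) (snd z)) \<partial>lborel)
     = emeasure (density lborel (\<lambda>y. ennreal (f_WAA y (fst z) (snd z)))) UNIV"
    by (subst emeasure_density) auto
  also have "\<dots> = emeasure (distr law_V borel (W (fst z) (snd z))) UNIV" by (simp add: elim)
  also have "\<dots> = 1" using V.emeasure_space_1 by (subst emeasure_distr) auto
  finally show ?case .
qed

text \<open>One null set serves all \<open>s\<close>, since on \<open>M\<close> the values can be
  placed in \<A>, where the density is Lipschitz. Under the law of the pair, the transfer needs a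
  measurable predicate, and \<open>s\<close> is fixed there.\<close>

lemma AE_f_WAA_bounds:
  assumes "1 \<le> i" "1 \<le> j" "i \<noteq> j"
  shows "AE \<omega> in M. \<forall>s\<in>\<W>. 0 \<le> f_WAA s (A i \<omega>) (A j \<omega>) \<and> f_WAA s (A i \<omega>) (A j \<omega>) \<le> dens_bound"
  using A_supp[OF assms(1)] A_supp[OF assms(2)] AE_law_pairD[OF assms AE_nn_integral_f_WAA]
proof eventually_elim
  case (elim \<omega>)
  let ?f = "\<lambda>s. f_WAA s (A i \<omega>) (A j \<omega>)"
  show ?case
  proof (intro ballI conjI)
    fix s assume s: "s \<in> \<W>"
    show "0 \<le> ?f s" using elim by (intro f_WAA_nonneg)
    \<comment> \<open>By the Lipschitz property \<open>d\<close> is a lower bound of the density on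
      all of \<W>, so \<open>d * (hi - lo)\<close> cannot exceed the total mass 1.\<close>
    define d where "d = ?f s - C_H * (hi - lo)"
    have "d * (hi - lo) \<le> 1"
    proof (cases "0 \<le> d")
      case True
      have "ennreal (d * (hi - lo)) = (\<integral>\<^sup>+y. ennreal d * indicator \<W> y \<partial>lborel)"
        using True lo_less_hi by (simp add: W_eq nn_integral_cmult_indicator ennreal_mult)
      also have "\<dots> \<le> (\<integral>\<^sup>+y. ennreal (?f y) \<partial>lborel)"
      proof (intro nn_integral_mono)
        fix y
        have "d \<le> ?f y" if "y \<in> \<W>"
        proof -
          have "\<bar>?f s - ?f y\<bar> \<le> C_H * \<bar>s - y\<bar>" using elim s that by (intro f_WAA_lipschitz)
          also have "\<dots> \<le> C_H * (hi - lo)"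
            using s that C_H_pos by (intro mult_left_mono) (auto simp: W_eq)
          finally show ?thesis by (simp add: d_def)
        qed
        then show "ennreal d * indicator \<W> y \<le> ennreal (?f y)"
          by (auto split: split_indicator intro: ennreal_leI)
      qed
      also have "\<dots> = 1" using elim by simp
      finally show ?thesis by simp
    next
      case False
      then have "d * (hi - lo) \<le> 0" using lo_less_hi by (intro mult_nonpos_nonneg) auto
      then show ?thesis by simp
    qed
    then have "d \<le> 1 / (hi - lo)" using lo_less_hi by (simp add: field_simps)
    then show "?f s \<le> dens_bound" by (simp add: d_def dens_bound_def)
  qed
qed

lemma AE_law_f_WAA_bounds:
  assumes "s \<in> \<W>"
  shows "AE z in law_A \<Otimes>\<^sub>M law_A. 0 \<le> f_WAA s (fst z) (snd z) \<and> f_WAA s (fst z) (snd z) \<le> dens_bound"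
  by (rule AE_law_pairI[of _ 1 2]) (use AE_f_WAA_bounds[of 1 2] assms in \<open>auto elim!: eventually_mono\<close>)

lemma AE_law_f_WAA_lipschitz:
  assumes "s \<in> \<W>" "t \<in> \<W>"
  shows "AE z in law_A \<Otimes>\<^sub>M law_A. \<bar>f_WAA s (fst z) (snd z) - f_WAA t (fst z) (snd z)\<bar> \<le> C_H * \<bar>s - t\<bar>"
proof (rule AE_law_pairI[of _ 1 2])
  have "AE \<omega> in M. A 1 \<omega> \<in> \<A>" "AE \<omega> in M. A 2 \<omega> \<in> \<A>" by (intro A_supp; simp)+
  then show "AE \<omega> in M. \<bar>f_WAA s (fst (A 1 \<omega>, A 2 \<omega>)) (snd (A 1 \<omega>, A 2 \<omega>))
      - f_WAA t (fst (A 1 \<omega>, A 2 \<omega>)) (snd (A 1 \<omega>, A 2 \<omega>))\<bar> \<le> C_H * \<bar>s - t\<bar>"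
    by eventually_elim (use assms in \<open>auto intro: f_WAA_lipschitz\<close>)
qed auto

lemma integrable_f_WAA:
  assumes "s \<in> \<W>"
  shows "integrable (law_A \<Otimes>\<^sub>M law_A) (\<lambda>z. f_WAA s (fst z) (snd z))"
proof (rule AA.integrable_const_bound[where B=dens_bound])
  show "AE z in law_A \<Otimes>\<^sub>M law_A. norm (f_WAA s (fst z) (snd z)) \<le> dens_bound"
    using AE_law_f_WAA_bounds[OF assms] by eventually_elim auto
qed auto

lemma f_W_eq: "f_W s = (\<integral>z. f_WAA s (fst z) (snd z) \<partial>(law_A \<Otimes>\<^sub>M law_A))"
proof -
  have [measurable]: "A 1 \<in> borel_measurable M" "A 2 \<in> borel_measurable M" by auto
  have "f_W s = (\<integral>z. f_WAA s (fst z) (snd z) \<partial>distr M (borel \<Otimes>\<^sub>M borel) (\<lambda>\<omega>. (A 1 \<omega>, A 2 \<omega>)))"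
    unfolding dens_W_def by (subst integral_distr) auto
  then show ?thesis by (simp add: law_pair)
qed

lemma f_W_measurable [measurable]: "f_W \<in> borel_measurable borel"
  unfolding f_W_eq[abs_def] by measurable

lemma f_W_bounds:
  assumes "s \<in> \<W>"
  shows "0 \<le> f_W s" "f_W s \<le> dens_bound"
proof -
  note ae = AE_law_f_WAA_bounds[OF assms]
  show "0 \<le> f_W s" unfolding f_W_eq
    using ae by (intro integral_nonneg_AE) (auto elim!: eventually_mono)
  have "f_W s \<le> (\<integral>z. dens_bound \<partial>(law_A \<Otimes>\<^sub>M law_A))"
    unfolding f_W_eq using ae integrable_f_WAA[OF assms]
    by (intro integral_mono_AE) (auto elim!: eventually_mono)
  then show "f_W s \<le> dens_bound" by (simp add: AA.prob_space)
qed

lemma f_W_lipschitz: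
  assumes "s \<in> \<W>" "t \<in> \<W>"
  shows "\<bar>f_W s - f_W t\<bar> \<le> C_H * \<bar>s - t\<bar>"
proof -
  note int = integrable_f_WAA[OF assms(1)] integrable_f_WAA[OF assms(2)]
  have "\<bar>f_W s - f_W t\<bar> = \<bar>\<integral>z. f_WAA s (fst z) (snd z) - f_WAA t (fst z) (snd z) \<partial>(law_A \<Otimes>\<^sub>M law_A)\<bar>"
    unfolding f_W_eq using int by simp
  also have "\<dots> \<le> (\<integral>z. \<bar>f_WAA s (fst z) (snd z) - f_WAA t (fst z) (snd z)\<bar> \<partial>(law_A \<Otimes>\<^sub>M law_A))"
    by (rule integral_abs_bound)
  also have "\<dots> \<le> (\<integral>z. C_H * \<bar>s - t\<bar> \<partial>(law_A \<Otimes>\<^sub>M law_A))"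
    using AE_law_f_WAA_lipschitz[OF assms] int by (intro integral_mono_AE) auto
  finally show ?thesis by (simp add: AA.prob_space)
qed

text \<open>By the symmetry of \<open>W\<close>, the laws of \<open>W a a' V\<close> and
  \<open>W a' a V\<close> coincide, so their densities agree almost everywhere and, being Lipschitz,
  at every point of \<W>. In the degenerate case this carries degeneracy over to the other
  argument.\<close>

lemma f_WAA_symmetric:
  assumes "s \<in> \<W>"
  shows "AE z in law_A \<Otimes>\<^sub>M law_A. f_WAA s (fst z) (snd z) = f_WAA s (snd z) (fst z)"
proof (rule AE_law_pairI[of _ 1 2])
  have "AE \<omega> in M. A 1 \<omega> \<in> \<A>" "AE \<omega> in M. A 2 \<omega> \<in> \<A>" by (intro A_supp; simp)+
  moreover have "AE \<omega> in M. distr law_V borel (W (A i \<omega>) (A j \<omega>)) = density lborel (\<lambda>y. ennreal (f_WAA y (A i \<omega>) (A j \<omega>)))"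
    if "1 \<le> i" "1 \<le> j" "i \<noteq> j" for i j
    using AE_law_pairD[OF that conditional_law_W] by simp
  from this[of 1 2] this[of 2 1]
  have "AE \<omega> in M. distr law_V borel (W (A 1 \<omega>) (A 2 \<omega>)) = density lborel (\<lambda>y. ennreal (f_WAA y (A 1 \<omega>) (A 2 \<omega>)))"
    "AE \<omega> in M. distr law_V borel (W (A 2 \<omega>) (A 1 \<omega>)) = density lborel (\<lambda>y. ennreal (f_WAA y (A 2 \<omega>) (A 1 \<omega>)))"
    by simp_all
  ultimately have "AE \<omega> in M. f_WAA s (A 1 \<omega>) (A 2 \<omega>) = f_WAA s (A 2 \<omega>) (A 1 \<omega>)"
  proof eventually_elim
    case (elim \<omega>)
    let ?f = "\<lambda>y. f_WAA y (A 1 \<omega>) (A 2 \<omega>)" and ?g = "\<lambda>y. f_WAA y (A 2 \<omega>) (A 1 \<omega>)"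
    have "W (A 1 \<omega>) (A 2 \<omega>) = W (A 2 \<omega>) (A 1 \<omega>)"
      using elim by (intro ext W_sym) auto
    then have "density lborel (\<lambda>y. ennreal (?f y)) = density lborel (\<lambda>y. ennreal (?g y))"
      using elim by simp
    then have "AE y in lborel. ennreal (?f y) = ennreal (?g y)"
      by (subst (asm) sigma_finite_measure.density_unique_iff[OF sigma_finite_lborel]) auto
    then have ae: "AE y in lborel. ?f y - ?g y = 0"
      using elim by (auto simp: f_WAA_nonneg elim!: eventually_mono)
    have "?f s - ?g s = 0"
    proof (rule lipschitz_AE_zero_imp_zero[OF _ _ lo_less_hi ae])
      fix s t assume "s \<in> {lo..hi}" "t \<in> {lo..hi}"
      then have "\<bar>?f s - ?f t\<bar> \<le> C_H * \<bar>s - t\<bar>" "\<bar>?g s - ?g t\<bar> \<le> C_H * \<bar>s - t\<bar>"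
        using elim by (auto intro!: f_WAA_lipschitz simp: W_eq)
      then show "\<bar>(?f s - ?g s) - (?f t - ?g t)\<bar> \<le> (2 * C_H) * \<bar>s - t\<bar>" by linarith
    qed (use C_H_pos assms in \<open>auto simp: W_eq\<close>)
    then show ?case by simp
  qed
  then show "AE \<omega> in M. f_WAA s (fst (A 1 \<omega>, A 2 \<omega>)) (snd (A 1 \<omega>, A 2 \<omega>))
      = f_WAA s (snd (A 1 \<omega>, A 2 \<omega>)) (fst (A 1 \<omega>, A 2 \<omega>))" by simp
qed auto

section \<open>The projection and the role of \<open>D_up\<close>\<close>

lemma dens_W_given_A_eq: "dens_W_given_A M A f_WAA s a = (\<integral>y. f_WAA s y a \<partial>law_A)"
  unfolding dens_W_given_A_def law_A_def by (subst integral_distr) auto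

lemma dens_W_given_A_measurable [measurable]: "dens_W_given_A M A f_WAA s \<in> borel_measurable borel"
  unfolding dens_W_given_A_eq[abs_def] by measurable

lemma AE_dens_W_given_A_bounds:
  assumes "s \<in> \<W>"
  shows "AE a in law_A. 0 \<le> dens_W_given_A M A f_WAA s a \<and> dens_W_given_A M A f_WAA s a \<le> dens_bound"
proof -
  have "AE z in law_A \<Otimes>\<^sub>M law_A. 0 \<le> f_WAA s (snd z) (fst z) \<and> f_WAA s (snd z) (fst z) \<le> dens_bound"
    by (rule A.AE_pair_swap[OF AE_law_f_WAA_bounds[OF assms]])
  from AA.AE_pair[OF this]
  have "AE a in law_A. AE y in law_A. 0 \<le> f_WAA s y a \<and> f_WAA s y a \<le> dens_bound"
    by simp
  then show ?thesis
  proof eventually_elim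
    case (elim a)
    have "AE y in law_A. norm (f_WAA s y a) \<le> dens_bound"
      using elim by eventually_elim auto
    then have int: "integrable law_A (\<lambda>y. f_WAA s y a)"
      by (intro A.integrable_const_bound[where B=dens_bound]) auto
    have "0 \<le> (\<integral>y. f_WAA s y a \<partial>law_A)"
      using elim by (intro integral_nonneg_AE) (auto elim!: eventually_mono)
    moreover have "(\<integral>y. f_WAA s y a \<partial>law_A) \<le> (\<integral>y. dens_bound \<partial>law_A)"
      using elim int by (intro integral_mono_AE) (auto elim!: eventually_mono)
    ultimately show ?case using A.prob_space by (simp add: dens_W_given_A_eq)
  qed
qed

lemma expectation_A_1:
  fixes g :: "real \<Rightarrow> real"
  assumes "g \<in> borel_measurable borel"
  shows "expectation (\<lambda>\<omega>. g (A 1 \<omega>)) = A.expectation g"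
  unfolding law_A_def using assms by (subst integral_distr) auto

lemma expectation_dens_W_given_A:
  assumes "s \<in> \<W>"
  shows "expectation (\<lambda>\<omega>. dens_W_given_A M A f_WAA s (A 1 \<omega>)) = f_W s"
proof -
  have "expectation (\<lambda>\<omega>. dens_W_given_A M A f_WAA s (A 1 \<omega>)) = (\<integral>a. (\<integral>y. f_WAA s y a \<partial>law_A) \<partial>law_A)"
    unfolding expectation_A_1[OF dens_W_given_A_measurable] unfolding dens_W_given_A_eq ..
  also have "\<dots> = f_W s"
    unfolding f_W_eq using AA.integral_snd[of "\<lambda>y a. f_WAA s y a"] integrable_f_WAA[OF assms]
    by (simp add: case_prod_unfold)
  finally show ?thesis .
qed

lemma variance_dens_W_given_A:
  assumes "s \<in> \<W>"
  shows "integrable M (\<lambda>\<omega>. (dens_W_given_A M A f_WAA s (A 1 \<omega>) - f_W s)\<^sup>2)"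
    and "variance (\<lambda>\<omega>. dens_W_given_A M A f_WAA s (A 1 \<omega>)) \<le> dens_bound\<^sup>2"
proof -
  have [measurable]: "A 1 \<in> borel_measurable M" by auto
  have "AE \<omega> in M. 0 \<le> dens_W_given_A M A f_WAA s (A 1 \<omega>) \<and> dens_W_given_A M A f_WAA s (A 1 \<omega>) \<le> dens_bound"
    using AE_dens_W_given_A_bounds[OF assms] unfolding law_A_def by (intro AE_distrD[of "A 1" M borel]) auto
  then have ae: "AE \<omega> in M. (dens_W_given_A M A f_WAA s (A 1 \<omega>) - f_W s)\<^sup>2 \<le> dens_bound\<^sup>2"
  proof eventually_elim
    case (elim \<omega>)
    then have "\<bar>dens_W_given_A M A f_WAA s (A 1 \<omega>) - f_W s\<bar> \<le> dens_bound"
      using f_W_bounds[OF assms] by auto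
    from power_mono[OF this, of 2] show ?case by simp
  qed
  then show int: "integrable M (\<lambda>\<omega>. (dens_W_given_A M A f_WAA s (A 1 \<omega>) - f_W s)\<^sup>2)"
    by (intro integrable_const_bound[where B="dens_bound\<^sup>2"]) auto
  have "expectation (\<lambda>\<omega>. (dens_W_given_A M A f_WAA s (A 1 \<omega>) - f_W s)\<^sup>2) \<le> expectation (\<lambda>\<omega>. dens_bound\<^sup>2)"
    using ae int by (intro integral_mono_AE) auto
  then show "variance (\<lambda>\<omega>. dens_W_given_A M A f_WAA s (A 1 \<omega>)) \<le> dens_bound\<^sup>2"
    unfolding expectation_dens_W_given_A[OF assms] by (simp add: prob_space)
qed

text \<open>The uniform variance bound matters here: a real supremum dominates its members only when
  the family is bounded above.\<close>

lemma variance_le_D_up: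
  assumes "s \<in> \<W>"
  shows "variance (\<lambda>\<omega>. dens_W_given_A M A f_WAA s (A 1 \<omega>)) \<le> (SUP w\<in>\<W>. variance (\<lambda>\<omega>. dens_W_given_A M A f_WAA w (A 1 \<omega>)))"
  using assms variance_dens_W_given_A(2) by (intro cSUP_upper) (auto intro!: bdd_aboveI)

lemma D_up_nonneg: "0 \<le> D_up M A f_WAA \<W>"
proof -
  have "lo \<in> \<W>" using lo_less_hi by (simp add: W_eq)
  from variance_le_D_up[OF this] variance_positive show ?thesis
    unfolding D_up_def by (meson order_trans real_sqrt_ge_zero)
qed

text \<open>With zero supremum each variance is 0, so the conditional mean given one argument is
  almost surely its expectation \<open>f_W s\<close>. Symmetry of the density gives the second claim
  from the first.\<close>

lemma D_up_zero_degenerate: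
  assumes D0: "D_up M A f_WAA \<W> = 0" and s: "s \<in> \<W>"
  shows "AE a in law_A. (\<integral>y. f_WAA s y a \<partial>law_A) = f_W s"
    and "AE a in law_A. (\<integral>y. f_WAA s a y \<partial>law_A) = f_W s"
proof -
  let ?u = "\<lambda>\<omega>. dens_W_given_A M A f_WAA s (A 1 \<omega>)"
  have [measurable]: "A 1 \<in> borel_measurable M" by auto
  have "variance ?u \<le> 0"
    using variance_le_D_up[OF s] D0 by (simp add: D_up_def)
  then have "expectation (\<lambda>\<omega>. (?u \<omega> - f_W s)\<^sup>2) = 0"
    using variance_positive[of ?u] unfolding expectation_dens_W_given_A[OF s] by (rule antisym)
  then have "AE \<omega> in M. (?u \<omega> - f_W s)\<^sup>2 = 0"
    using variance_dens_W_given_A(1)[OF s] by (subst (asm) integral_nonneg_eq_0_iff_AE) auto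
  then have "AE \<omega> in M. ?u \<omega> = f_W s" by simp
  then have "AE a in distr M borel (A 1). dens_W_given_A M A f_WAA s a = f_W s"
    by (subst AE_distr_iff) auto
  then show 1: "AE a in law_A. (\<integral>y. f_WAA s y a \<partial>law_A) = f_W s"
    unfolding dens_W_given_A_eq law_A_def[symmetric] .
  have "AE a in law_A. AE y in law_A. f_WAA s a y = f_WAA s y a"
    using AA.AE_pair[OF f_WAA_symmetric[OF s]] by simp
  with 1 show "AE a in law_A. (\<integral>y. f_WAA s a y \<partial>law_A) = f_W s"
  proof eventually_elim
    case (elim a)
    have "(\<integral>y. f_WAA s a y \<partial>law_A) = (\<integral>y. f_WAA s y a \<partial>law_A)"
      using elim(2) by (intro integral_cong_AE) auto
    with elim show ?case by simp
  qed
qed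

section \<open>The U-process of conditional densities and its supremum\<close>

definition U :: "nat \<Rightarrow> (real \<Rightarrow> real \<Rightarrow> real) \<Rightarrow> (nat \<Rightarrow> real) \<Rightarrow> real" where
  "U n q x = 2 / (real n * (real n - 1)) * (\<Sum>(i, j)\<in>pairs n. q (x i) (x j))"

text \<open>Square roots of the factors \<open>1 / m\<close> and \<open>4 * n / m\<close> of the
  second moment bounds, where \<open>m = n * (n - 1) / 2\<close> counts the pairs and
  \<open>n * (n - 1)\<close> is at least half of \<open>n\<^sup>2\<close>.\<close>

definition "rate n = (if D_up M A f_WAA \<W> = 0 then 2 / real n else 4 / sqrt (real n))"

lemma rate_pos: "2 \<le> n \<Longrightarrow> 0 < rate n"
  by (simp add: rate_def)

lemma U_diff: "U n (\<lambda>a b. q a b - r a b) x = U n q x - U n r x"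
  by (simp add: U_def case_prod_unfold sum_subtractf right_diff_distrib)

lemma U_const: "2 \<le> n \<Longrightarrow> U n (\<lambda>_ _. c) x = c"
  by (simp add: U_def case_prod_unfold card_pairs)

lemma U_abs_le:
  assumes n: "2 \<le> n" and le: "\<And>i j. (i, j) \<in> pairs n \<Longrightarrow> \<bar>q (x i) (x j)\<bar> \<le> B"
  shows "\<bar>U n q x\<bar> \<le> B"
proof -
  let ?c = "2 / (real n * (real n - 1))"
  have "\<bar>\<Sum>(i, j)\<in>pairs n. q (x i) (x j)\<bar> \<le> (\<Sum>(i, j)\<in>pairs n. \<bar>q (x i) (x j)\<bar>)"
    by (rule order.trans[OF sum_abs]) (simp add: case_prod_unfold)
  also have "\<dots> \<le> real (card (pairs n)) * B"
    using le by (intro sum_bounded_above) auto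
  finally have "?c * \<bar>\<Sum>(i, j)\<in>pairs n. q (x i) (x j)\<bar> \<le> ?c * (real (card (pairs n)) * B)"
    using n by (intro mult_left_mono) auto
  also have "\<dots> = B" using n by (simp add: card_pairs)
  finally show ?thesis using n by (simp add: U_def abs_mult)
qed

text \<open>Carries the second moment bounds from the product law over to \<open>M\<close>.
  Degeneracy of \<open>q\<close> is asked for only when \<open>D_up\<close> vanishes, which is when
  the faster rate is claimed.\<close>

lemma nn_integral_U_le:
  assumes n: "2 \<le> n" and [measurable]: "case_prod q \<in> borel_measurable (borel \<Otimes>\<^sub>M borel)"
    and B: "AE z in law_A \<Otimes>\<^sub>M law_A. \<bar>q (fst z) (snd z)\<bar> \<le> B" "0 \<le> B"
    and zero: "(\<integral>z. q (fst z) (snd z) \<partial>(law_A \<Otimes>\<^sub>M law_A)) = 0"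
    and deg: "D_up M A f_WAA \<W> = 0 \<Longrightarrow> (AE a in law_A. (\<integral>y. q a y \<partial>law_A) = 0) \<and> (AE a in law_A. (\<integral>y. q y a \<partial>law_A) = 0)"
  shows "(\<integral>\<^sup>+\<omega>. ennreal \<bar>U n q (A_vec n \<omega>)\<bar> \<partial>M) \<le> ennreal (B * rate n)"
proof -
  interpret P: prob_space "PiM {1..n} (\<lambda>_. law_A)" by (intro prob_space_PiM prob_space_law_A)
  have comp[measurable]: "(\<lambda>x. x i) \<in> measurable (PiM {1..n} (\<lambda>_. borel)) borel" if "i \<in> {1..n}" for i
    using that by measurable
  have meas[measurable]: "U n q \<in> borel_measurable (PiM {1..n} (\<lambda>_. borel))"
    unfolding U_def case_prod_unfold
  proof (intro borel_measurable_times borel_measurable_const borel_measurable_sum)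
    fix p assume "p \<in> pairs n"
    then have [measurable]: "(\<lambda>x. x (fst p)) \<in> measurable (PiM {1..n} (\<lambda>_. borel)) borel" "(\<lambda>x. x (snd p)) \<in> measurable (PiM {1..n} (\<lambda>_. borel)) borel"
      by (auto simp: pairs_def intro!: comp)
    show "(\<lambda>x. q (x (fst p)) (x (snd p))) \<in> borel_measurable (PiM {1..n} (\<lambda>_. borel))" by measurable
  qed
  have [measurable]: "case_prod q \<in> borel_measurable (law_A \<Otimes>\<^sub>M law_A)" by measurable
  have meas'[measurable]: "U n q \<in> borel_measurable (PiM {1..n} (\<lambda>_. law_A))"
    using meas by (simp cong: measurable_cong_sets sets_PiM_cong)
  let ?m = "real (card (pairs n))"
  have m: "?m = real n * (real n - 1) / 2" by (rule card_pairs)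
  have m_pos: "0 < ?m" using n by (simp add: m)
  have U: "U n q x = (\<Sum>(i, j)\<in>pairs n. q (x i) (x j)) / ?m" for x
    using n by (simp add: U_def m)
  note mom = A.integral_sum_pairs_square_le[OF \<open>case_prod q \<in> borel_measurable (law_A \<Otimes>\<^sub>M law_A)\<close> B(1) zero, of n]
  have "(\<integral>x. (U n q x)\<^sup>2 \<partial>PiM {1..n} (\<lambda>_. law_A)) \<le> (B * rate n)\<^sup>2"
  proof (cases "D_up M A f_WAA \<W> = 0")
    case True
    have "(\<integral>x. (U n q x)\<^sup>2 \<partial>PiM {1..n} (\<lambda>_. law_A)) \<le> B\<^sup>2 * ?m / ?m\<^sup>2"
      using mom(3) deg[OF True] by (simp add: U power_divide divide_right_mono)
    also have "\<dots> = B\<^sup>2 * (1 / ?m)" using m_pos by (simp add: power2_eq_square)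
    also have "\<dots> \<le> B\<^sup>2 * (rate n)\<^sup>2"
      using n True unfolding m rate_def by (intro mult_left_mono) (auto simp: field_simps power2_eq_square)
    finally show ?thesis by (simp add: power_mult_distrib)
  next
    case False
    have "(\<integral>x. (U n q x)\<^sup>2 \<partial>PiM {1..n} (\<lambda>_. law_A)) \<le> B\<^sup>2 * (4 * real n * ?m) / ?m\<^sup>2"
      using mom(2) by (simp add: U power_divide divide_right_mono)
    also have "\<dots> = B\<^sup>2 * (4 * real n / ?m)" using m_pos by (simp add: power2_eq_square)
    also have "\<dots> \<le> B\<^sup>2 * (rate n)\<^sup>2"
      using n False unfolding m rate_def by (intro mult_left_mono) (auto simp: field_simps)
    finally show ?thesis by (simp add: power_mult_distrib)
  qed
  moreover have "integrable (PiM {1..n} (\<lambda>_. law_A)) (\<lambda>x. (U n q x)\<^sup>2)"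
    unfolding U power_divide using mom(1) by simp
  ultimately have "(\<integral>\<^sup>+x. ennreal \<bar>U n q x\<bar> \<partial>PiM {1..n} (\<lambda>_. law_A)) \<le> ennreal (B * rate n)"
    using B rate_pos[OF n] by (intro P.nn_integral_abs_le_of_square meas') auto
  moreover have "(\<integral>\<^sup>+\<omega>. ennreal \<bar>U n q (A_vec n \<omega>)\<bar> \<partial>M) = (\<integral>\<^sup>+x. ennreal \<bar>U n q x\<bar> \<partial>PiM {1..n} (\<lambda>_. law_A))"
    unfolding distr_A_vec[OF n, symmetric]
    by (rule nn_integral_distr[OF A_vec_measurable, of "\<lambda>x. ennreal \<bar>U n q x\<bar>" n, symmetric]) measurable
  ultimately show ?thesis by simp
qed

definition "F n s x = U n (\<lambda>a b. f_WAA s a b - f_W s) x"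

lemma F_measurable [measurable]: "(\<lambda>\<omega>. F n s (A_vec n \<omega>)) \<in> borel_measurable M"
proof -
  have "(\<lambda>\<omega>. f_WAA s (A_vec n \<omega> (fst p)) (A_vec n \<omega> (snd p))) \<in> borel_measurable M" if "p \<in> pairs n" for p
  proof -
    have "1 \<le> fst p" "1 \<le> snd p" "fst p \<in> {1..n}" "snd p \<in> {1..n}" using that by (auto simp: pairs_def)
    then show ?thesis unfolding A_vec_def by simp
  qed
  then show ?thesis unfolding F_def U_def case_prod_unfold
    by (intro borel_measurable_times borel_measurable_const borel_measurable_sum borel_measurable_diff) auto
qed

lemma nn_integral_F_le:
  assumes n: "2 \<le> n" and s: "s \<in> \<W>"
  shows "(\<integral>\<^sup>+\<omega>. ennreal \<bar>F n s (A_vec n \<omega>)\<bar> \<partial>M) \<le> ennreal (dens_bound * rate n)"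
  unfolding F_def
proof (rule nn_integral_U_le[OF n])
  show "AE z in law_A \<Otimes>\<^sub>M law_A. \<bar>f_WAA s (fst z) (snd z) - f_W s\<bar> \<le> dens_bound"
    using AE_law_f_WAA_bounds[OF s] by eventually_elim (use f_W_bounds[OF s] in auto)
  show "(\<integral>z. f_WAA s (fst z) (snd z) - f_W s \<partial>(law_A \<Otimes>\<^sub>M law_A)) = 0"
    using integrable_f_WAA[OF s] by (simp add: f_W_eq AA.prob_space)
  assume "D_up M A f_WAA \<W> = 0"
  note deg = D_up_zero_degenerate[OF this s]
  \<comment> \<open>Integrability has to be established so that the Bochner integral splits over the
    difference.\<close>
  have *: "(\<integral>y. g y - f_W s \<partial>law_A) = 0" if "(\<integral>y. g y \<partial>law_A) = f_W s" "AE y in law_A. 0 \<le> g y \<and> g y \<le> dens_bound" "g \<in> borel_measurable borel" for g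
  proof -
    have "AE y in law_A. norm (g y) \<le> dens_bound" using that(2) by eventually_elim auto
    then have "integrable law_A g" using that(3) by (intro A.integrable_const_bound) auto
    then show ?thesis using that A.prob_space by simp
  qed
  show "(AE a in law_A. (\<integral>y. f_WAA s a y - f_W s \<partial>law_A) = 0) \<and> (AE a in law_A. (\<integral>y. f_WAA s y a - f_W s \<partial>law_A) = 0)"
  proof
    have "AE a in law_A. AE y in law_A. 0 \<le> f_WAA s a y \<and> f_WAA s a y \<le> dens_bound"
      using AA.AE_pair[OF AE_law_f_WAA_bounds[OF s]] by simp
    then show "AE a in law_A. (\<integral>y. f_WAA s a y - f_W s \<partial>law_A) = 0"
      using deg(2) by eventually_elim (rule *, auto)
    have "AE a in law_A. AE y in law_A. 0 \<le> f_WAA s y a \<and> f_WAA s y a \<le> dens_bound"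
      using AA.AE_pair[OF A.AE_pair_swap[OF AE_law_f_WAA_bounds[OF s]]] by simp
    then show "AE a in law_A. (\<integral>y. f_WAA s y a - f_W s \<partial>law_A) = 0"
      using deg(1) by eventually_elim (rule *, auto)
  qed
qed (use dens_bound_pos in auto)

text \<open>The kernel of the increment is itself bounded by
  \<open>2 * C_H * \<bar>s - t\<bar>\<close>. This factor, linear in the distance, keeps the
  expected total variation along a grid independent of its mesh.\<close>

lemma nn_integral_F_increment_le:
  assumes n: "2 \<le> n" and s: "s \<in> \<W>" and t: "t \<in> \<W>"
  shows "(\<integral>\<^sup>+\<omega>. ennreal \<bar>F n s (A_vec n \<omega>) - F n t (A_vec n \<omega>)\<bar> \<partial>M) \<le> ennreal ((2 * C_H * \<bar>s - t\<bar>) * rate n)"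
  unfolding F_def U_diff[symmetric]
proof (rule nn_integral_U_le[OF n])
  note int = integrable_f_WAA[OF s] integrable_f_WAA[OF t]
  show "AE z in law_A \<Otimes>\<^sub>M law_A. \<bar>(f_WAA s (fst z) (snd z) - f_W s) - (f_WAA t (fst z) (snd z) - f_W t)\<bar> \<le> 2 * C_H * \<bar>s - t\<bar>"
    using AE_law_f_WAA_lipschitz[OF s t] by eventually_elim (use f_W_lipschitz[OF s t] in linarith)
  show "(\<integral>z. f_WAA s (fst z) (snd z) - f_W s - (f_WAA t (fst z) (snd z) - f_W t) \<partial>(law_A \<Otimes>\<^sub>M law_A)) = 0"
    using int by (simp add: f_W_eq AA.prob_space)
  assume "D_up M A f_WAA \<W> = 0"
  note deg = D_up_zero_degenerate[OF this s] D_up_zero_degenerate[OF this t]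
  have bd: "AE y in law_A. norm (g y) \<le> dens_bound" if "AE y in law_A. 0 \<le> g y \<and> g y \<le> dens_bound" for g :: "real \<Rightarrow> real"
    using that by eventually_elim auto
  have *: "(\<integral>y. g y - f_W s - (h y - f_W t) \<partial>law_A) = 0"
    if "(\<integral>y. g y \<partial>law_A) = f_W s" "AE y in law_A. 0 \<le> g y \<and> g y \<le> dens_bound" "g \<in> borel_measurable borel"
      "(\<integral>y. h y \<partial>law_A) = f_W t" "AE y in law_A. 0 \<le> h y \<and> h y \<le> dens_bound" "h \<in> borel_measurable borel" for g h
  proof -
    have "integrable law_A g" "integrable law_A h"
      using that(3,6) bd[OF that(2)] bd[OF that(5)] by (auto intro!: A.integrable_const_bound[where B=dens_bound])
    then show ?thesis using that A.prob_space by simp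
  qed
  have b1: "AE a in law_A. AE y in law_A. 0 \<le> f_WAA r a y \<and> f_WAA r a y \<le> dens_bound" if "r \<in> \<W>" for r
    using AA.AE_pair[OF AE_law_f_WAA_bounds[OF that]] by simp
  have b2: "AE a in law_A. AE y in law_A. 0 \<le> f_WAA r y a \<and> f_WAA r y a \<le> dens_bound" if "r \<in> \<W>" for r
    using AA.AE_pair[OF A.AE_pair_swap[OF AE_law_f_WAA_bounds[OF that]]] by simp
  show "(AE a in law_A. (\<integral>y. f_WAA s a y - f_W s - (f_WAA t a y - f_W t) \<partial>law_A) = 0) \<and>
    (AE a in law_A. (\<integral>y. f_WAA s y a - f_W s - (f_WAA t y a - f_W t) \<partial>law_A) = 0)"
  proof
    show "AE a in law_A. (\<integral>y. f_WAA s a y - f_W s - (f_WAA t a y - f_W t) \<partial>law_A) = 0"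
      using deg(2,4) b1[OF s] b1[OF t] by eventually_elim (rule *, auto)
    show "AE a in law_A. (\<integral>y. f_WAA s y a - f_W s - (f_WAA t y a - f_W t) \<partial>law_A) = 0"
      using deg(1,3) b2[OF s] b2[OF t] by eventually_elim (rule *, auto)
  qed
qed (use C_H_pos in auto)

definition "grid N i = lo + real i * (hi - lo) / real N"

lemma grid_in_W: "i \<le> N \<Longrightarrow> grid N i \<in> \<W>"
  using grid_mem[OF lo_less_hi] by (simp add: grid_def W_eq)

text \<open>A measurable majorant of the supremum of \<open>\<bar>F\<bar>\<close>: starting value,
  variation along the grid, and the Lipschitz error within a cell. With \<open>n\<close> cells that
  error is of order \<open>1 / n\<close>, below the target rate.\<close>

definition "F_sup n \<omega> = \<bar>F n lo (A_vec n \<omega>)\<bar>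
  + (\<Sum>i<n. \<bar>F n (grid n (Suc i)) (A_vec n \<omega>) - F n (grid n i) (A_vec n \<omega>)\<bar>) + 2 * C_H * ((hi - lo) / real n)"

lemma F_sup_measurable [measurable]: "F_sup n \<in> borel_measurable M"
  unfolding F_sup_def[abs_def] by measurable

lemma AE_F_le_F_sup:
  assumes n: "2 \<le> n"
  shows "AE \<omega> in M. \<forall>s\<in>\<W>. \<bar>F n s (A_vec n \<omega>)\<bar> \<le> F_sup n \<omega>"
proof -
  have "AE \<omega> in M. \<forall>i\<in>{1..n}. A i \<omega> \<in> \<A>"
    by (intro AE_finite_allI A_supp) auto
  then show ?thesis
  proof eventually_elim
    case (elim \<omega>)
    have lip: "\<bar>F n s (A_vec n \<omega>) - F n t (A_vec n \<omega>)\<bar> \<le> 2 * C_H * \<bar>s - t\<bar>" if "s \<in> {lo..hi}" "t \<in> {lo..hi}" for s t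
      unfolding F_def U_diff[symmetric]
    proof (rule U_abs_le[OF n])
      fix i j assume "(i, j) \<in> pairs n"
      then have ij: "i \<in> {1..n}" "j \<in> {1..n}" by (auto simp: pairs_def)
      have st: "s \<in> \<W>" "t \<in> \<W>" using that by (simp_all add: W_eq)
      have "\<bar>f_WAA s (A i \<omega>) (A j \<omega>) - f_WAA t (A i \<omega>) (A j \<omega>)\<bar> \<le> C_H * \<bar>s - t\<bar>"
        using elim ij st by (intro f_WAA_lipschitz) auto
      with f_W_lipschitz[OF st]
      show "\<bar>f_WAA s (A_vec n \<omega> i) (A_vec n \<omega> j) - f_W s - (f_WAA t (A_vec n \<omega> i) (A_vec n \<omega> j) - f_W t)\<bar> \<le> 2 * C_H * \<bar>s - t\<bar>"
        using ij by (simp add: A_vec_def)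
    qed
    show ?case
    proof
      fix s assume "s \<in> \<W>"
      then show "\<bar>F n s (A_vec n \<omega>)\<bar> \<le> F_sup n \<omega>"
        unfolding F_sup_def grid_def using n C_H_pos lip
        by (intro abs_le_sum_increments[OF lo_less_hi]) (auto simp: W_eq)
    qed
  qed
qed

text \<open>Each of the \<open>n\<close> increments spans a distance \<open>(hi - lo) / n\<close>,
  so the number of cells cancels and the sum is of the order of a single
  \<open>rate n\<close>.\<close>

lemma nn_integral_F_sup_le:
  assumes n: "2 \<le> n"
  shows "(\<integral>\<^sup>+\<omega>. ennreal (F_sup n \<omega>) \<partial>M)
    \<le> ennreal ((dens_bound + 2 * C_H * (hi - lo)) * rate n + 2 * C_H * (hi - lo) / real n)"
proof -
  have lo: "lo \<in> \<W>" using lo_less_hi by (simp add: W_eq)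
  have inc: "(\<integral>\<^sup>+\<omega>. ennreal \<bar>F n (grid n (Suc i)) (A_vec n \<omega>) - F n (grid n i) (A_vec n \<omega>)\<bar> \<partial>M)
     \<le> ennreal (2 * C_H * ((hi - lo) / real n) * rate n)" if "i < n" for i
  proof -
    have "grid n (Suc i) - grid n i = (hi - lo) / real n" by (simp add: grid_def algebra_simps add_divide_distrib diff_divide_distrib)
    then have "\<bar>grid n (Suc i) - grid n i\<bar> = (hi - lo) / real n" using lo_less_hi by simp
    then show ?thesis
      using nn_integral_F_increment_le[OF n grid_in_W[of "Suc i" n] grid_in_W[of i n]] that by simp
  qed
  have nn: "0 \<le> 2 * C_H * ((hi - lo) / real n)" using C_H_pos lo_less_hi by simp
  have "(\<integral>\<^sup>+\<omega>. ennreal (F_sup n \<omega>) \<partial>M) = (\<integral>\<^sup>+\<omega>. ennreal \<bar>F n lo (A_vec n \<omega>)\<bar>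
      + (\<Sum>i<n. ennreal \<bar>F n (grid n (Suc i)) (A_vec n \<omega>) - F n (grid n i) (A_vec n \<omega>)\<bar>)
      + ennreal (2 * C_H * ((hi - lo) / real n)) \<partial>M)"
    unfolding F_sup_def using nn
    by (intro nn_integral_cong) (simp add: ennreal_plus sum_nonneg add_nonneg_nonneg)
  also have "\<dots> = (\<integral>\<^sup>+\<omega>. ennreal \<bar>F n lo (A_vec n \<omega>)\<bar> \<partial>M)
      + (\<Sum>i<n. \<integral>\<^sup>+\<omega>. ennreal \<bar>F n (grid n (Suc i)) (A_vec n \<omega>) - F n (grid n i) (A_vec n \<omega>)\<bar> \<partial>M)
      + ennreal (2 * C_H * ((hi - lo) / real n))"
    by (simp add: nn_integral_add nn_integral_sum emeasure_space_1 del: sum_ennreal)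
  also have "\<dots> \<le> ennreal (dens_bound * rate n) + (\<Sum>i<n. ennreal (2 * C_H * ((hi - lo) / real n) * rate n))
      + ennreal (2 * C_H * ((hi - lo) / real n))"
    using nn_integral_F_le[OF n lo] inc by (intro add_mono sum_mono) auto
  also have "(\<Sum>i<n. ennreal (2 * C_H * ((hi - lo) / real n) * rate n)) = ennreal (\<Sum>i<n. 2 * C_H * ((hi - lo) / real n) * rate n)"
    by (rule sum_ennreal) (rule mult_nonneg_nonneg[OF nn less_imp_le[OF rate_pos[OF n]]])
  also have "(\<Sum>i<n. 2 * C_H * ((hi - lo) / real n) * rate n) = 2 * C_H * (hi - lo) * rate n"
    using n by simp
  also have "ennreal (dens_bound * rate n) + ennreal (2 * C_H * (hi - lo) * rate n) + ennreal (2 * C_H * ((hi - lo) / real n))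
      = ennreal (dens_bound * rate n + 2 * C_H * (hi - lo) * rate n + 2 * C_H * ((hi - lo) / real n))"
    using rate_pos[OF n] dens_bound_pos C_H_pos lo_less_hi by (simp add: ennreal_plus)
  also have "dens_bound * rate n + 2 * C_H * (hi - lo) * rate n + 2 * C_H * ((hi - lo) / real n)
      = (dens_bound + 2 * C_H * (hi - lo)) * rate n + 2 * C_H * (hi - lo) / real n"
    by (simp add: algebra_simps)
  finally show ?thesis .
qed

end

section \<open>The kernel\<close>

lemma prod_mono_ennreal:
  fixes f g :: "'i \<Rightarrow> ennreal"
  shows "(\<And>i. i \<in> I \<Longrightarrow> f i \<le> g i) \<Longrightarrow> prod f I \<le> prod g I"
  by (induction I rule: infinite_finite_induct) (auto intro!: mult_mono)

locale dyadic_kernel =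
  dyadic_interval M A V W f_V f_WAA \<A> \<W> \<beta> C_H lo hi + kernel_bandwidth \<W> h k p C_L
  for M :: "'w measure" and A V W f_V f_WAA \<A> \<W> \<beta> C_H lo hi h k p C_L
begin

lemma k_outside: "2 \<le> n \<Longrightarrow> w \<in> \<W> \<Longrightarrow> s \<notin> \<W> \<Longrightarrow> k n s w = 0"
  using k_supp by blast

lemma set_lebesgue_integral_k:
  assumes "2 \<le> n" "w \<in> \<W>"
  shows "(LINT s:\<W>|lborel. (s - w) ^ r * k n s w) = (\<integral>s. (s - w) ^ r * k n s w \<partial>lborel)"
  unfolding set_lebesgue_integral_def using k_outside[OF assms]
  by (intro Bochner_Integration.integral_cong) (auto split: split_indicator)

lemma k_integral: "2 \<le> n \<Longrightarrow> w \<in> \<W> \<Longrightarrow> (\<integral>s. k n s w \<partial>lborel) = 1"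
  using k_order_0[of n w] set_lebesgue_integral_k[of n w 0] by simp

lemma k_moment: "2 \<le> n \<Longrightarrow> w \<in> \<W> \<Longrightarrow> 1 \<le> r \<Longrightarrow> r < p \<Longrightarrow> (\<integral>s. (s - w) ^ r * k n s w \<partial>lborel) = 0"
  using k_order_less[of n r w] set_lebesgue_integral_k[of n w r] by simp

lemma k_integrable: "2 \<le> n \<Longrightarrow> w \<in> \<W> \<Longrightarrow> integrable lborel (\<lambda>s. k n s w)"
  using k_integral[of n w] not_integrable_integral_eq[of lborel "\<lambda>s. k n s w"] by fastforce

lemma k_measurable: "2 \<le> n \<Longrightarrow> w \<in> \<W> \<Longrightarrow> (\<lambda>s. k n s w) \<in> borel_measurable borel"
  using borel_measurable_integrable[OF k_integrable[of n w]] by simp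

lemma k_lipschitz:
  assumes n: "2 \<le> n" and w: "w \<in> \<W>" "w' \<in> \<W>"
  shows "\<bar>k n s w - k n s w'\<bar> \<le> C_L / (h n)\<^sup>2 * \<bar>w - w'\<bar>"
proof (cases "s \<in> \<W>")
  case True
  from k_holder[OF n True] obtain D where
    "\<forall>x\<in>\<W>. D (0::nat) x = k n s x" "\<forall>x\<in>\<W>. \<forall>x'\<in>\<W>. \<bar>D 0 x - D 0 x'\<bar> \<le> C_L / (h n)\<^sup>2 * \<bar>x - x'\<bar> powr 1"
    unfolding holder_class_def Let_def by auto
  with w show ?thesis by simp
next
  case False
  then show ?thesis using k_outside[OF n] w C_L_pos by simp
qed

lemma integrable_k_mult:
  assumes n: "2 \<le> n" and w: "w \<in> \<W>" and [measurable]: "g \<in> borel_measurable borel"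
    and le: "\<And>s. s \<in> \<W> \<Longrightarrow> \<bar>g s\<bar> \<le> B"
  shows "integrable lborel (\<lambda>s. k n s w * g s)"
proof (rule Bochner_Integration.integrable_bound)
  note [measurable] = k_measurable[OF n w]
  show "integrable lborel (\<lambda>s. B * k n s w)" using k_integrable[OF n w] by simp
  show "(\<lambda>s. k n s w * g s) \<in> borel_measurable lborel" by measurable
  show "AE s in lborel. norm (k n s w * g s) \<le> norm (B * k n s w)"
  proof (intro AE_I2)
    fix s
    show "norm (k n s w * g s) \<le> norm (B * k n s w)"
    proof (cases "s \<in> \<W>")
      case True
      have "\<bar>k n s w\<bar> * \<bar>g s\<bar> \<le> \<bar>k n s w\<bar> * \<bar>B\<bar>"
        using le[OF True] by (intro mult_left_mono) auto
      then show ?thesis by (simp add: abs_mult mult.commute)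
    qed (simp add: k_outside[OF n w])
  qed
qed

lemma abs_integral_k_mult_le:
  assumes n: "2 \<le> n" and w: "w \<in> \<W>" and [measurable]: "g \<in> borel_measurable borel"
    and le: "\<And>s. s \<in> \<W> \<Longrightarrow> s \<in> {w - h n..w + h n} \<Longrightarrow> \<bar>g s\<bar> \<le> B"
  shows "\<bar>\<integral>s. k n s w * g s \<partial>lborel\<bar> \<le> (\<integral>s. \<bar>k n s w\<bar> \<partial>lborel) * B"
proof -
  \<comment> \<open>The bound on \<open>g\<close> holds only on the support of the kernel; cutting
    \<open>g\<close> off outside makes it global without changing the product.\<close>
  define g' where "g' = (\<lambda>s. g s * indicator ({w - h n..w + h n} \<inter> \<W>) s)"
  have [measurable]: "g' \<in> borel_measurable borel" unfolding g'_def by measurable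
  have "w \<in> {w - h n..w + h n}" using h_pos[OF n] by simp
  from le[OF w this] have B: "0 \<le> B" by linarith
  have g': "\<bar>g' s\<bar> \<le> B" for s using le[of s] B by (auto simp: g'_def split: split_indicator)
  have eq: "k n s w * g s = k n s w * g' s" for s
    using k_supp[OF n w, of s] by (auto simp: g'_def split: split_indicator)
  have int: "integrable lborel (\<lambda>s. k n s w * g' s)" using integrable_k_mult[OF n w _ g'] by simp
  have "\<bar>\<integral>s. k n s w * g s \<partial>lborel\<bar> \<le> (\<integral>s. \<bar>k n s w * g' s\<bar> \<partial>lborel)"
    unfolding eq by (rule integral_abs_bound)
  also have "\<dots> \<le> (\<integral>s. \<bar>k n s w\<bar> * B \<partial>lborel)"
    using integrable_abs[OF int] integrable_abs[OF k_integrable[OF n w]] g'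
    by (intro integral_mono) (auto simp: abs_mult intro: mult_left_mono)
  finally show ?thesis by simp
qed

text \<open>The positive part guards against negative values of \<open>f_WAA\<close> outside \<open>\<A>\<close>.\<close>

definition "gk n w a b = (\<integral>s. k n s w * max 0 (f_WAA s a b) \<partial>lborel)"

lemma gk_measurable:
  assumes n: "2 \<le> n" and w: "w \<in> \<W>" and [measurable]: "a \<in> borel_measurable N" "b \<in> borel_measurable N"
  shows "(\<lambda>x. gk n w (a x) (b x)) \<in> borel_measurable N"
proof -
  note [measurable] = k_measurable[OF n w]
  show ?thesis unfolding gk_def by measurable
qed

lemma k_W_measurable:
  assumes n: "2 \<le> n" and w: "w \<in> \<W>" and "a \<in> borel_measurable N" "b \<in> borel_measurable N" "v \<in> borel_measurable N"
  shows "(\<lambda>x. k n (W (a x) (b x) (v x)) w) \<in> borel_measurable N"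
  using measurable_compose[OF W_measurable_raw[OF assms(3-5)] k_measurable[OF n w]] .

text \<open>\<open>ennreal\<close> truncates negative values, so taking the positive part leaves the
  law unchanged and supplies the nonnegative real density over which to integrate.\<close>

lemma integral_conditional_law:
  assumes law: "distr law_V borel (W a b) = density lborel (\<lambda>y. ennreal (f_WAA y a b))"
    and [measurable]: "\<phi> \<in> borel_measurable borel"
  shows "(\<integral>v. \<phi> (W a b v) \<partial>law_V) = (\<integral>y. (\<phi> y :: real) * max 0 (f_WAA y a b) \<partial>lborel)"
proof -
  have "(\<integral>v. \<phi> (W a b v) \<partial>law_V) = (\<integral>y. \<phi> y \<partial>distr law_V borel (W a b))"
    by (subst integral_distr) auto
  also have "distr law_V borel (W a b) = density lborel (\<lambda>y. ennreal (max 0 (f_WAA y a b)))"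
    unfolding law by (intro density_cong) (auto simp: max_def ennreal_neg)
  also have "(\<integral>y. \<phi> y \<partial>density lborel (\<lambda>y. ennreal (max 0 (f_WAA y a b)))) = (\<integral>y. max 0 (f_WAA y a b) *\<^sub>R \<phi> y \<partial>lborel)"
    by (intro integral_density) auto
  finally show ?thesis by (simp add: mult.commute)
qed

text \<open>For small bandwidth, every \<open>s\<close> admits a nearby point outside the support of \<open>k n s\<close>,
  so that the Lipschitz condition bounds the kernel.\<close>

definition "small n \<longleftrightarrow> 2 \<le> n \<and> 4 * h n \<le> hi - lo"

lemma small_ge_2: "small n \<Longrightarrow> 2 \<le> n"
  by (simp add: small_def)

lemma k_bound:
  assumes small: "small n" and w: "w \<in> \<W>"
  shows "\<bar>k n s w\<bar> \<le> 3 * C_L / h n"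
proof (cases "s \<in> {w - h n..w + h n} \<inter> \<W>")
  case True
  have n: "2 \<le> n" and h4: "4 * h n \<le> hi - lo" using small by (auto simp: small_def)
  have h: "0 < h n" by (rule h_pos[OF n])
  \<comment> \<open>A point at distance \<open>3 / 2 * h n\<close> from \<open>s\<close>, just
    beyond the support radius, on a side where \<W> has room; \<open>4 * h n \<le> hi - lo\<close>
    ensures that there is one. From \<open>w\<close> it is at most \<open>5 / 2 * h n\<close> away,
    rounded up to 3.\<close>
  define w' where "w' = (if s + 3 / 2 * h n \<le> hi then s + 3 / 2 * h n else s - 3 / 2 * h n)"
  have w': "w' \<in> \<W>" "\<bar>w - w'\<bar> \<le> 3 * h n" "s \<notin> {w' - h n..w' + h n}"
    using True h h4 w by (auto simp: w'_def W_eq)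
  have "k n s w' = 0" using k_supp[OF n w'(1), of s] w'(3) by auto
  then have "\<bar>k n s w\<bar> \<le> C_L / (h n)\<^sup>2 * \<bar>w - w'\<bar>" using k_lipschitz[OF n w w'(1), of s] by simp
  also have "\<dots> \<le> C_L / (h n)\<^sup>2 * (3 * h n)" using w'(2) C_L_pos by (intro mult_left_mono) auto
  also have "\<dots> = 3 * C_L / h n" using h by (simp add: power2_eq_square field_simps)
  finally show ?thesis .
next
  case False
  have n: "2 \<le> n" by (rule small_ge_2[OF small])
  show ?thesis using False k_supp[OF n w, of s] h_pos[OF n] C_L_pos by simp
qed

lemma integral_kernel_type_le:
  assumes small: "small n" and w: "w \<in> \<W>" and [measurable]: "g \<in> borel_measurable borel"
    and g: "\<And>s. \<bar>g s\<bar> \<le> B * indicator {w - h n..w + h n} s"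
  shows "(\<integral>s. g s \<partial>lborel) \<le> B * (2 * h n)"
proof -
  have n: "2 \<le> n" by (rule small_ge_2[OF small])
  have h: "0 < h n" by (rule h_pos[OF n])
  have int: "integrable lborel (\<lambda>s. B * indicator {w - h n..w + h n} s :: real)"
    using h by (intro integrable_mult_right integrable_real_indicator) auto
  then have "(\<integral>s. g s \<partial>lborel) \<le> (\<integral>s. B * indicator {w - h n..w + h n} s \<partial>lborel)"
    using g abs_le_D1[OF g]
    by (intro integral_mono Bochner_Integration.integrable_bound[OF int]) (auto intro!: AE_I2 order.trans[OF g])
  also have "\<dots> = B * (2 * h n)" using h by simp
  finally show ?thesis .
qed

text \<open>Height \<open>3 * C_L / h\<close> times window length \<open>2 * h\<close>: the
  bandwidth cancels. This bound enters both the bias and the \<open>F\<close> term.\<close>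

lemma k_abs_integral:
  assumes small: "small n" and w: "w \<in> \<W>"
  shows "(\<integral>s. \<bar>k n s w\<bar> \<partial>lborel) \<le> 6 * C_L"
proof -
  have n: "2 \<le> n" by (rule small_ge_2[OF small])
  note [measurable] = k_measurable[OF n w]
  have "(\<integral>s. \<bar>k n s w\<bar> \<partial>lborel) \<le> 3 * C_L / h n * (2 * h n)"
    using k_bound[OF small w] k_supp[OF n w]
    by (intro integral_kernel_type_le[OF small w]) (auto split: split_indicator)
  also have "\<dots> = 6 * C_L" using h_pos[OF n] by simp
  finally show ?thesis .
qed

text \<open>From \<open>(3 * C_L / h)\<^sup>2 * dens_bound * (2 * h)\<close>, the squared kernel
  bound times density bound times window length: \<open>v0 / h n\<close> bounds the conditional
  second moment of one summand.\<close>

definition "v0 = 18 * C_L\<^sup>2 * dens_bound"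

lemma v0_pos: "0 < v0"
  using C_L_pos dens_bound_pos by (simp add: v0_def)

lemma AE_second_moment_le:
  assumes small: "small n" and w: "w \<in> \<W>"
  shows "AE z in law_A \<Otimes>\<^sub>M law_A. (\<integral>s. (k n s w)\<^sup>2 * max 0 (f_WAA s (fst z) (snd z)) \<partial>lborel) \<le> v0 / h n"
proof (rule AE_law_pairI[of _ 1 2])
  have n: "2 \<le> n" by (rule small_ge_2[OF small])
  have h: "0 < h n" by (rule h_pos[OF n])
  note [measurable] = k_measurable[OF n w]
  show "Measurable.pred (law_A \<Otimes>\<^sub>M law_A) (\<lambda>z. (\<integral>s. (k n s w)\<^sup>2 * max 0 (f_WAA s (fst z) (snd z)) \<partial>lborel) \<le> v0 / h n)"
    by measurable
  have "AE \<omega> in M. \<forall>s\<in>\<W>. 0 \<le> f_WAA s (A 1 \<omega>) (A 2 \<omega>) \<and> f_WAA s (A 1 \<omega>) (A 2 \<omega>) \<le> dens_bound"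
    by (rule AE_f_WAA_bounds) auto
  then show "AE \<omega> in M. (\<integral>s. (k n s w)\<^sup>2 * max 0 (f_WAA s (fst (A 1 \<omega>, A 2 \<omega>)) (snd (A 1 \<omega>, A 2 \<omega>))) \<partial>lborel) \<le> v0 / h n"
  proof eventually_elim
    case (elim \<omega>)
    have "(\<integral>s. (k n s w)\<^sup>2 * max 0 (f_WAA s (A 1 \<omega>) (A 2 \<omega>)) \<partial>lborel) \<le> ((3 * C_L / h n)\<^sup>2 * dens_bound) * (2 * h n)"
    proof (rule integral_kernel_type_le[OF small w])
      fix s
      show "\<bar>(k n s w)\<^sup>2 * max 0 (f_WAA s (A 1 \<omega>) (A 2 \<omega>))\<bar> \<le> (3 * C_L / h n)\<^sup>2 * dens_bound * indicator {w - h n..w + h n} s"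
      proof (cases "s \<in> {w - h n..w + h n} \<inter> \<W>")
        case True
        have "(k n s w)\<^sup>2 \<le> (3 * C_L / h n)\<^sup>2"
          using power_mono[OF k_bound[OF small w, of s], of 2] by simp
        then have "(k n s w)\<^sup>2 * max 0 (f_WAA s (A 1 \<omega>) (A 2 \<omega>)) \<le> (3 * C_L / h n)\<^sup>2 * dens_bound"
          using elim True dens_bound_pos by (intro mult_mono) auto
        then show ?thesis using True by (simp add: abs_mult)
      next
        case False
        then have "k n s w = 0" by (rule k_supp[OF n w])
        then show ?thesis using dens_bound_pos by (auto split: split_indicator)
      qed
    qed measurable
    also have "\<dots> = v0 / h n" using h by (simp add: v0_def power2_eq_square field_simps)
    finally show ?case by simp
  qed
qed auto

text \<open>For almost every frozen pair only \<open>V\<close> is random, the kernel value has mean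
  \<open>gk\<close>, and Bernstein's bound applies with \<open>b = 3 * C_L / h n\<close>; twice
  \<open>b\<close> is the constant in the condition on \<theta>.\<close>

lemma AE_conditional_mgf:
  assumes small: "small n" and w: "w \<in> \<W>" and \<theta>: "\<bar>\<theta>\<bar> * (6 * C_L / h n) \<le> 1"
  shows "AE z in law_A \<Otimes>\<^sub>M law_A.
    (\<integral>\<^sup>+v. ennreal (exp (\<theta> * (k n (W (fst z) (snd z) v) w - gk n w (fst z) (snd z)))) \<partial>law_V) \<le> ennreal (exp (\<theta>\<^sup>2 * (v0 / h n)))"
  using conditional_law_W AE_second_moment_le[OF small w]
proof eventually_elim
  case (elim z)
  have n: "2 \<le> n" by (rule small_ge_2[OF small])
  note [measurable] = k_measurable[OF n w] k_W_measurable[OF n w]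
  let ?X = "\<lambda>v. k n (W (fst z) (snd z) v) w"
  have [measurable]: "?X \<in> borel_measurable law_V" by measurable
  have mean: "V.expectation ?X = gk n w (fst z) (snd z)"
    unfolding gk_def by (rule integral_conditional_law[OF elim(1)]) measurable
  have sq: "V.expectation (\<lambda>v. (?X v)\<^sup>2) \<le> v0 / h n"
    using elim(2) by (subst integral_conditional_law[OF elim(1), of "\<lambda>y. (k n y w)\<^sup>2"]) auto
  have "(\<integral>\<^sup>+v. ennreal (exp (\<theta> * (?X v - V.expectation ?X))) \<partial>law_V) \<le> ennreal (exp (\<theta>\<^sup>2 * V.expectation (\<lambda>v. (?X v)\<^sup>2)))"
    using \<theta> by (intro V.nn_integral_exp_centered_le[where b="3 * C_L / h n"] k_bound[OF small w]) auto
  also have "\<dots> \<le> ennreal (exp (\<theta>\<^sup>2 * (v0 / h n)))"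
    using mult_left_mono[OF sq zero_le_power2[of \<theta>]] by (intro ennreal_leI) simp
  finally show ?case by (simp add: mean)
qed

section \<open>The sum of conditionally centred kernel values\<close>

definition S :: "nat \<Rightarrow> real \<Rightarrow> (nat \<Rightarrow> real) \<times> (nat \<times> nat \<Rightarrow> real) \<Rightarrow> real" where
  "S n w xy = (\<Sum>(i, j)\<in>pairs n. k n (W (fst xy i) (fst xy j) (snd xy (i, j))) w - gk n w (fst xy i) (fst xy j))"

lemma S_measurable:
  assumes n: "2 \<le> n" and w: "w \<in> \<W>"
  shows "S n w \<in> borel_measurable (PiM {1..n} (\<lambda>_. borel) \<Otimes>\<^sub>M PiM (pairs n) (\<lambda>_. borel))"
  unfolding S_def case_prod_unfold
proof (intro borel_measurable_sum borel_measurable_diff)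
  fix q assume q: "q \<in> pairs n"
  then have "fst q \<in> {1..n}" "snd q \<in> {1..n}" by (auto simp: pairs_def)
  with q have m[measurable]: "(\<lambda>x. x (fst q)) \<in> measurable (PiM {1..n} (\<lambda>_. borel)) borel" "(\<lambda>x. x (snd q)) \<in> measurable (PiM {1..n} (\<lambda>_. borel)) borel"
    "(\<lambda>x. x (fst q, snd q)) \<in> measurable (PiM (pairs n) (\<lambda>_. borel)) borel"
    by (auto intro!: measurable_component_singleton)
  show "(\<lambda>xy. k n (W (fst xy (fst q)) (fst xy (snd q)) (snd xy (fst q, snd q))) w) \<in> borel_measurable (PiM {1..n} (\<lambda>_. borel) \<Otimes>\<^sub>M PiM (pairs n) (\<lambda>_. borel))"
    by (intro k_W_measurable[OF n w]) measurable
  show "(\<lambda>xy. gk n w (fst xy (fst q)) (fst xy (snd q))) \<in> borel_measurable (PiM {1..n} (\<lambda>_. borel) \<Otimes>\<^sub>M PiM (pairs n) (\<lambda>_. borel))"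
    by (intro gk_measurable[OF n w]) measurable
qed

text \<open>With the \<open>A i\<close> frozen by Fubini, the summands depend on distinct
  coordinates of a product measure, so the exponential of the sum integrates to a product of one
  factor per pair.\<close>

lemma nn_integral_exp_S_le:
  assumes small: "small n" and w: "w \<in> \<W>" and \<theta>: "\<bar>\<theta>\<bar> * (6 * C_L / h n) \<le> 1"
  shows "(\<integral>\<^sup>+\<omega>. ennreal (exp (\<theta> * S n w (A_vec n \<omega>, V_vec n \<omega>))) \<partial>M)
    \<le> ennreal (exp (real (card (pairs n)) * (\<theta>\<^sup>2 * (v0 / h n))))"
proof -
  have n: "2 \<le> n" by (rule small_ge_2[OF small])
  let ?PA = "PiM {1..n} (\<lambda>_. law_A)" and ?PV = "PiM (pairs n) (\<lambda>_. law_V)"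
  interpret PA: prob_space ?PA by (intro prob_space_PiM prob_space_law_A)
  interpret PV: prob_space ?PV by (intro prob_space_PiM prob_space_law_V)
  interpret PS: product_prob_space "\<lambda>_. law_V" "pairs n" ..
  note S_meas[measurable] = S_measurable[OF n w]
  have S_meas'[measurable]: "S n w \<in> borel_measurable (?PA \<Otimes>\<^sub>M ?PV)"
    using S_meas by (simp cong: measurable_cong_sets sets_PiM_cong sets_pair_measure_cong)
  have "(\<integral>\<^sup>+\<omega>. ennreal (exp (\<theta> * S n w (A_vec n \<omega>, V_vec n \<omega>))) \<partial>M)
     = (\<integral>\<^sup>+xy. ennreal (exp (\<theta> * S n w xy)) \<partial>distr M (PiM {1..n} (\<lambda>_. borel) \<Otimes>\<^sub>M PiM (pairs n) (\<lambda>_. borel)) (\<lambda>\<omega>. (A_vec n \<omega>, V_vec n \<omega>)))"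
    by (rule nn_integral_distr[of _ _ _ "\<lambda>xy. ennreal (exp (\<theta> * S n w xy))", symmetric])
       measurable
  also have "\<dots> = (\<integral>\<^sup>+xy. ennreal (exp (\<theta> * S n w xy)) \<partial>(?PA \<Otimes>\<^sub>M ?PV))"
    unfolding joint_law[OF n] ..
  also have "\<dots> = (\<integral>\<^sup>+x. \<integral>\<^sup>+y. ennreal (exp (\<theta> * S n w (x, y))) \<partial>?PV \<partial>?PA)"
    by (rule PV.nn_integral_fst[symmetric]) measurable
  also have "\<dots> \<le> (\<integral>\<^sup>+x. ennreal (exp (real (card (pairs n)) * (\<theta>\<^sup>2 * (v0 / h n)))) \<partial>?PA)"
  proof (intro nn_integral_mono_AE)
    have "AE x in ?PA. \<forall>q\<in>pairs n. (\<integral>\<^sup>+v. ennreal (exp (\<theta> * (k n (W (x (fst q)) (x (snd q)) v) w - gk n w (x (fst q)) (x (snd q))))) \<partial>law_V)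
        \<le> ennreal (exp (\<theta>\<^sup>2 * (v0 / h n)))"
    proof (intro AE_finite_allI)
      fix q assume "q \<in> pairs n"
      then show "AE x in ?PA. (\<integral>\<^sup>+v. ennreal (exp (\<theta> * (k n (W (x (fst q)) (x (snd q)) v) w - gk n w (x (fst q)) (x (snd q))))) \<partial>law_V)
        \<le> ennreal (exp (\<theta>\<^sup>2 * (v0 / h n)))"
        by (intro A.AE_PiM_pair[OF _ _ _ AE_conditional_mgf[OF small w \<theta>]]) (auto simp: pairs_def)
    qed auto
    then show "AE x in ?PA. (\<integral>\<^sup>+y. ennreal (exp (\<theta> * S n w (x, y))) \<partial>?PV)
        \<le> ennreal (exp (real (card (pairs n)) * (\<theta>\<^sup>2 * (v0 / h n))))"
    proof eventually_elim
      case (elim x)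
      let ?e = "\<lambda>q v. ennreal (exp (\<theta> * (k n (W (x (fst q)) (x (snd q)) v) w - gk n w (x (fst q)) (x (snd q)))))"
      have [measurable]: "(\<lambda>v. k n (W (x (fst q)) (x (snd q)) v) w) \<in> borel_measurable law_V" for q
        by (intro k_W_measurable[OF n w]) auto
      have "(\<integral>\<^sup>+y. ennreal (exp (\<theta> * S n w (x, y))) \<partial>?PV) = (\<integral>\<^sup>+y. (\<Prod>q\<in>pairs n. ?e q (y q)) \<partial>?PV)"
        by (intro nn_integral_cong) (simp add: S_def case_prod_unfold sum_distrib_left exp_sum prod_ennreal)
      also have "\<dots> = (\<Prod>q\<in>pairs n. \<integral>\<^sup>+v. ?e q v \<partial>law_V)"
        by (intro PS.product_nn_integral_prod) auto
      also have "\<dots> \<le> (\<Prod>q\<in>pairs n. ennreal (exp (\<theta>\<^sup>2 * (v0 / h n))))"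
        using elim by (intro prod_mono_ennreal) auto
      also have "\<dots> = ennreal (exp (real (card (pairs n)) * (\<theta>\<^sup>2 * (v0 / h n))))"
        by (simp add: ennreal_power exp_of_nat_mult[symmetric])
      finally show ?case .
    qed
  qed
  also have "\<dots> = ennreal (exp (real (card (pairs n)) * (\<theta>\<^sup>2 * (v0 / h n))))"
    using PA.emeasure_space_1 by simp
  finally show ?thesis .
qed

section \<open>The error bound\<close>

text \<open>The kernel has mass 1 and its moments of orders 1 to \<open>p - 1\<close> vanish, so
  against \<open>f_W\<close> only the Taylor remainder survives. On the support
  \<open>\<bar>s - w\<bar> \<le> h n\<close>, and the L1 norm of the kernel is bounded.\<close>

lemma bias_le:
  assumes small: "small n" and w: "w \<in> \<W>"
  shows "\<bar>(\<integral>s. k n s w * f_W s \<partial>lborel) - f_W w\<bar> \<le> 6 * C_L * (C_H * h n powr min (real p) \<beta>)"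
proof -
  have n: "2 \<le> n" by (rule small_ge_2[OF small])
  obtain c where c: "\<And>s. s \<in> {lo..hi} \<Longrightarrow>
      \<bar>f_W s - f_W w - (\<Sum>r\<in>{1..<p}. c r * (s - w) ^ r)\<bar> \<le> C_H * \<bar>s - w\<bar> powr min (real p) \<beta>"
    using holder_class_taylor[OF f_W_holder[unfolded W_eq] C_H_pos beta_ge_1 p_ge_1 w[unfolded W_eq]] by blast
  define g where "g = (\<lambda>s. f_W s - f_W w - (\<Sum>r\<in>{1..<p}. c r * (s - w) ^ r))"
  have [measurable]: "g \<in> borel_measurable borel" unfolding g_def by measurable
  have int_f: "integrable lborel (\<lambda>s. k n s w * f_W s)"
    using f_W_bounds by (intro integrable_k_mult[OF n w, where B=dens_bound]) auto
  have int_r: "integrable lborel (\<lambda>s. k n s w * (s - w) ^ r)" for r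
  proof (rule integrable_k_mult[OF n w])
    fix s assume "s \<in> \<W>"
    then have "\<bar>s - w\<bar> \<le> hi - lo" using w by (auto simp: W_eq)
    then show "\<bar>(s - w) ^ r\<bar> \<le> (hi - lo) ^ r" unfolding power_abs by (intro power_mono) auto
  qed measurable
  have eq: "k n s w * g s = k n s w * f_W s - f_W w * k n s w - (\<Sum>r\<in>{1..<p}. c r * (k n s w * (s - w) ^ r))" for s
    by (simp add: g_def right_diff_distrib sum_distrib_left mult_ac)
  have "(\<integral>s. k n s w * g s \<partial>lborel)
      = (\<integral>s. k n s w * f_W s \<partial>lborel) - f_W w - (\<Sum>r\<in>{1..<p}. c r * (\<integral>s. k n s w * (s - w) ^ r \<partial>lborel))"
    unfolding eq using int_f int_r k_integrable[OF n w]
    by (simp add: Bochner_Integration.integral_sum k_integral[OF n w])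
  also have "(\<Sum>r\<in>{1..<p}. c r * (\<integral>s. k n s w * (s - w) ^ r \<partial>lborel)) = 0"
    using k_moment[OF n w] by (intro sum.neutral) (auto simp: mult.commute)
  finally have "(\<integral>s. k n s w * f_W s \<partial>lborel) - f_W w = (\<integral>s. k n s w * g s \<partial>lborel)" by simp
  also have "\<bar>\<dots>\<bar> \<le> (\<integral>s. \<bar>k n s w\<bar> \<partial>lborel) * (C_H * h n powr min (real p) \<beta>)"
  proof (rule abs_integral_k_mult_le[OF n w])
    fix s assume s: "s \<in> \<W>" "s \<in> {w - h n..w + h n}"
    have "\<bar>g s\<bar> \<le> C_H * \<bar>s - w\<bar> powr min (real p) \<beta>" using c s by (simp add: g_def W_eq)
    also have "\<dots> \<le> C_H * h n powr min (real p) \<beta>"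
      using s C_H_pos beta_ge_1 by (intro mult_left_mono powr_mono2) (auto simp: min_def)
    finally show "\<bar>g s\<bar> \<le> C_H * h n powr min (real p) \<beta>" .
  qed measurable
  also have "\<dots> \<le> 6 * C_L * (C_H * h n powr min (real p) \<beta>)"
    using C_H_pos by (intro mult_right_mono k_abs_integral[OF small w]) auto
  finally show ?thesis .
qed

lemma AE_good:
  "AE \<omega> in M. (\<forall>i\<in>{1..n}. A i \<omega> \<in> \<A>) \<and>
     (\<forall>q\<in>pairs n. \<forall>s\<in>\<W>. f_WAA s (A (fst q) \<omega>) (A (snd q) \<omega>) \<le> dens_bound)"
proof -
  have "AE \<omega> in M. \<forall>i\<in>{1..n}. A i \<omega> \<in> \<A>"
    by (intro AE_finite_allI A_supp) auto
  moreover have "AE \<omega> in M. \<forall>q\<in>pairs n. \<forall>s\<in>\<W>. 0 \<le> f_WAA s (A (fst q) \<omega>) (A (snd q) \<omega>) \<and> f_WAA s (A (fst q) \<omega>) (A (snd q) \<omega>) \<le> dens_bound"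
    by (rule AE_finite_allI[OF finite_pairs], rule AE_f_WAA_bounds) (auto simp: pairs_def)
  ultimately show ?thesis by eventually_elim auto
qed

lemma A_vec_nth: "(i, j) \<in> pairs n \<Longrightarrow> A_vec n \<omega> i = A i \<omega> \<and> A_vec n \<omega> j = A j \<omega>"
  by (auto simp: A_vec_def pairs_def)

text \<open>Adds and subtracts the conditional mean of each summand: \<open>S\<close> carries the
  randomness of the \<open>V i j\<close>, while the U-statistic is a function of the
  \<open>A i\<close> alone.\<close>

lemma kde_eq: "kde A V W k n w \<omega>
    = 2 / (real n * (real n - 1)) * S n w (A_vec n \<omega>, V_vec n \<omega>) + U n (gk n w) (A_vec n \<omega>)"
proof -
  have "(\<Sum>(i, j)\<in>pairs n. k n (W (A i \<omega>) (A j \<omega>) (V i j \<omega>)) w)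
     = S n w (A_vec n \<omega>, V_vec n \<omega>) + (\<Sum>(i, j)\<in>pairs n. gk n w (A_vec n \<omega> i) (A_vec n \<omega> j))"
    unfolding S_def case_prod_unfold sum.distrib[symmetric]
    by (intro sum.cong) (auto simp: A_vec_nth V_vec_def)
  then show ?thesis unfolding kde_def sum_pairs U_def by (simp add: distrib_left)
qed

text \<open>Integral and finite average commute, so the U-statistic minus the smoothed
  \<open>f_W\<close> is the integral of the kernel against \<open>F\<close>. As \<open>F\<close>
  does not involve \<open>w\<close>, the bound by L1 norm times \<open>F_sup\<close> is uniform in
  \<open>w\<close>, with one null set for all \<open>w\<close>.\<close>

lemma AE_decomposition:
  assumes small: "small n"
  shows "AE \<omega> in M. \<forall>w\<in>\<W>. \<bar>kde A V W k n w \<omega> - f_W w\<bar>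
    \<le> 2 / (real n * (real n - 1)) * \<bar>S n w (A_vec n \<omega>, V_vec n \<omega>)\<bar>
      + 6 * C_L * F_sup n \<omega> + 6 * C_L * (C_H * h n powr min (real p) \<beta>)"
  using AE_good[of n] AE_F_le_F_sup[OF small_ge_2[OF small]]
proof eventually_elim
  have n: "2 \<le> n" by (rule small_ge_2[OF small])
  case (elim \<omega>)
  let ?x = "A_vec n \<omega>" and ?c = "2 / (real n * (real n - 1))"
  show ?case
  proof
    fix w assume w: "w \<in> \<W>"
    have [measurable]: "(\<lambda>s. F n s ?x) \<in> borel_measurable borel"
      unfolding F_def U_def case_prod_unfold by measurable
    have int_ij: "integrable lborel (\<lambda>s. k n s w * f_WAA s (?x i) (?x j))" if "(i, j) \<in> pairs n" for i j
    proof (rule integrable_k_mult[OF n w, where B=dens_bound])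
      fix s assume s: "s \<in> \<W>"
      have "0 \<le> f_WAA s (?x i) (?x j)"
        using elim(1) that by (auto simp: A_vec_nth pairs_def intro: f_WAA_nonneg)
      moreover have "f_WAA s (?x i) (?x j) \<le> dens_bound" using elim(1) that s by (force simp: A_vec_nth)
      ultimately show "\<bar>f_WAA s (?x i) (?x j)\<bar> \<le> dens_bound" by simp
    qed measurable
    have int_f: "integrable lborel (\<lambda>s. k n s w * f_W s)"
      using f_W_bounds by (intro integrable_k_mult[OF n w, where B=dens_bound]) auto
    have gk_eq: "gk n w (?x i) (?x j) = (\<integral>s. k n s w * f_WAA s (?x i) (?x j) \<partial>lborel)" if "(i, j) \<in> pairs n" for i j
    proof -
      have "0 \<le> f_WAA s (?x i) (?x j)" for s
        using elim(1) that by (auto simp: A_vec_nth pairs_def intro: f_WAA_nonneg)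
      then show ?thesis by (simp add: gk_def)
    qed
    have kF: "k n s w * F n s ?x = ?c * (\<Sum>q\<in>pairs n. k n s w * f_WAA s (?x (fst q)) (?x (snd q))) - k n s w * f_W s" for s
      unfolding F_def U_diff U_const[OF n]
      by (simp add: U_def case_prod_unfold right_diff_distrib sum_distrib_left mult_ac)
    have "(\<integral>s. k n s w * F n s ?x \<partial>lborel)
       = ?c * (\<Sum>q\<in>pairs n. \<integral>s. k n s w * f_WAA s (?x (fst q)) (?x (snd q)) \<partial>lborel) - (\<integral>s. k n s w * f_W s \<partial>lborel)"
      unfolding kF using int_ij int_f
      by (subst Bochner_Integration.integral_diff) (auto simp: Bochner_Integration.integral_sum)
    also have "?c * (\<Sum>q\<in>pairs n. \<integral>s. k n s w * f_WAA s (?x (fst q)) (?x (snd q)) \<partial>lborel) = U n (gk n w) ?x"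
      unfolding U_def case_prod_unfold by (intro arg_cong2[where f="(*)"] sum.cong) (auto simp: gk_eq)
    finally have U_eq: "U n (gk n w) ?x - (\<integral>s. k n s w * f_W s \<partial>lborel) = (\<integral>s. k n s w * F n s ?x \<partial>lborel)" ..
    have "\<bar>\<integral>s. k n s w * F n s ?x \<partial>lborel\<bar> \<le> (\<integral>s. \<bar>k n s w\<bar> \<partial>lborel) * F_sup n \<omega>"
      using elim(2) n by (intro abs_integral_k_mult_le[OF n w]) auto
    also have "\<dots> \<le> 6 * C_L * F_sup n \<omega>"
      using C_H_pos lo_less_hi
      by (intro mult_right_mono k_abs_integral[OF small w]) (auto simp: F_sup_def sum_nonneg)
    finally have 1: "\<bar>U n (gk n w) ?x - (\<integral>s. k n s w * f_W s \<partial>lborel)\<bar> \<le> 6 * C_L * F_sup n \<omega>"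
      unfolding U_eq .
    have "\<bar>?c * S n w (?x, V_vec n \<omega>)\<bar> = ?c * \<bar>S n w (?x, V_vec n \<omega>)\<bar>"
      using n by (simp add: abs_mult)
    with 1 bias_le[OF small w] show "\<bar>kde A V W k n w \<omega> - f_W w\<bar>
      \<le> ?c * \<bar>S n w (?x, V_vec n \<omega>)\<bar> + 6 * C_L * F_sup n \<omega> + 6 * C_L * (C_H * h n powr min (real p) \<beta>)"
      unfolding kde_eq by linarith
  qed
qed

section \<open>From a finite grid to the whole interval, and optimisation of the level\<close>

definition "lip = C_L * (1 + dens_bound * (hi - lo))"

lemma lip_pos: "0 < lip"
  using C_L_pos dens_bound_pos lo_less_hi by (simp add: lip_def add_pos_pos)

text \<open>Of the two parts of \<open>lip\<close>, the 1 stems from the kernel value and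
  \<open>dens_bound * (hi - lo)\<close> from its conditional mean, an integral over \<W>. The crude
  factor \<open>1 / h\<^sup>2\<close> is harmless because the grid can be made polynomially
  fine.\<close>

lemma AE_S_lipschitz:
  assumes n: "2 \<le> n"
  shows "AE \<omega> in M. \<forall>w\<in>\<W>. \<forall>w'\<in>\<W>. \<bar>S n w (A_vec n \<omega>, V_vec n \<omega>) - S n w' (A_vec n \<omega>, V_vec n \<omega>)\<bar>
    \<le> real (card (pairs n)) * (lip / (h n)\<^sup>2 * \<bar>w - w'\<bar>)"
  using AE_good[of n]
proof eventually_elim
  case (elim \<omega>)
  show ?case
  proof (intro ballI)
    fix w w' assume w: "w \<in> \<W>" "w' \<in> \<W>"
    note [measurable] = k_measurable[OF n w(1)] k_measurable[OF n w(2)]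
    let ?L = "C_L / (h n)\<^sup>2 * \<bar>w - w'\<bar>"
    have L: "0 \<le> ?L" using C_L_pos by simp
    have gk: "\<bar>gk n w (A i \<omega>) (A j \<omega>) - gk n w' (A i \<omega>) (A j \<omega>)\<bar> \<le> ?L * (dens_bound * (hi - lo))"
      if ij: "(i, j) \<in> pairs n" for i j
    proof -
      let ?f = "\<lambda>s. max 0 (f_WAA s (A i \<omega>) (A j \<omega>))"
      have f: "0 \<le> ?f s" "s \<in> \<W> \<Longrightarrow> ?f s \<le> dens_bound" for s
        using elim ij dens_bound_pos by force+
      have int: "integrable lborel (\<lambda>s. k n s v * ?f s)" if "v \<in> \<W>" for v
        using f that by (intro integrable_k_mult[OF n that, where B=dens_bound]) auto
      have "\<bar>gk n w (A i \<omega>) (A j \<omega>) - gk n w' (A i \<omega>) (A j \<omega>)\<bar> = \<bar>\<integral>s. (k n s w - k n s w') * ?f s \<partial>lborel\<bar>"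
        unfolding gk_def left_diff_distrib using int w by simp
      also have "\<dots> \<le> (\<integral>s. \<bar>(k n s w - k n s w') * ?f s\<bar> \<partial>lborel)" by (rule integral_abs_bound)
      also have "\<dots> \<le> (\<integral>s. (?L * dens_bound) * indicator \<W> s \<partial>lborel)"
      proof (rule integral_mono)
        show "integrable lborel (\<lambda>s. \<bar>(k n s w - k n s w') * ?f s\<bar>)"
          unfolding left_diff_distrib using int w by simp
        show "integrable lborel (\<lambda>s. (?L * dens_bound) * indicator \<W> s)"
          by (intro integrable_mult_right integrable_real_indicator) (use lo_less_hi in \<open>auto simp: W_eq\<close>)
        fix s
        show "\<bar>(k n s w - k n s w') * ?f s\<bar> \<le> (?L * dens_bound) * indicator \<W> s"
        proof (cases "s \<in> \<W>")
          case True
          have "\<bar>k n s w - k n s w'\<bar> * ?f s \<le> ?L * dens_bound"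
            using k_lipschitz[OF n w, of s] f[of s] True L by (intro mult_mono) auto
          then show ?thesis using True f(1)[of s] by (simp add: abs_mult)
        qed (simp add: k_outside[OF n w(1)] k_outside[OF n w(2)])
      qed
      also have "\<dots> = ?L * (dens_bound * (hi - lo))" using lo_less_hi by (simp add: W_eq)
      finally show ?thesis .
    qed
    have "\<bar>S n w (A_vec n \<omega>, V_vec n \<omega>) - S n w' (A_vec n \<omega>, V_vec n \<omega>)\<bar>
      \<le> (\<Sum>q\<in>pairs n. \<bar>(k n (W (A (fst q) \<omega>) (A (snd q) \<omega>) (V (fst q) (snd q) \<omega>)) w - gk n w (A (fst q) \<omega>) (A (snd q) \<omega>))
          - (k n (W (A (fst q) \<omega>) (A (snd q) \<omega>) (V (fst q) (snd q) \<omega>)) w' - gk n w' (A (fst q) \<omega>) (A (snd q) \<omega>))\<bar>)"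
      unfolding S_def case_prod_unfold sum_subtractf[symmetric]
      by (rule order.trans[OF sum_abs], rule eq_refl, rule sum.cong) (auto simp: A_vec_nth V_vec_def)
    also have "\<dots> \<le> real (card (pairs n)) * (?L + ?L * (dens_bound * (hi - lo)))"
    proof (rule sum_bounded_above)
      fix q assume "q \<in> pairs n"
      then show "\<bar>(k n (W (A (fst q) \<omega>) (A (snd q) \<omega>) (V (fst q) (snd q) \<omega>)) w - gk n w (A (fst q) \<omega>) (A (snd q) \<omega>))
          - (k n (W (A (fst q) \<omega>) (A (snd q) \<omega>) (V (fst q) (snd q) \<omega>)) w' - gk n w' (A (fst q) \<omega>) (A (snd q) \<omega>))\<bar>
        \<le> ?L + ?L * (dens_bound * (hi - lo))"
        using k_lipschitz[OF n w, of "W (A (fst q) \<omega>) (A (snd q) \<omega>) (V (fst q) (snd q) \<omega>)"] gk[of "fst q" "snd q"] by simp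
    qed
    also have "?L + ?L * (dens_bound * (hi - lo)) = lip / (h n)\<^sup>2 * \<bar>w - w'\<bar>"
      by (simp add: lip_def algebra_simps add_divide_distrib diff_divide_distrib)
    finally show "\<bar>S n w (A_vec n \<omega>, V_vec n \<omega>) - S n w' (A_vec n \<omega>, V_vec n \<omega>)\<bar>
      \<le> real (card (pairs n)) * (lip / (h n)\<^sup>2 * \<bar>w - w'\<bar>)" .
  qed
qed

definition "sum_exp n N \<theta> \<omega> = (\<Sum>i\<le>N. exp (\<theta> * S n (grid N i) (A_vec n \<omega>, V_vec n \<omega>)) + exp (- \<theta> * S n (grid N i) (A_vec n \<omega>, V_vec n \<omega>)))"

text \<open>The normalisation times the number of pairs is 1, so the discretisation error enters
  unscaled. \<open>T\<close>, \<theta> and \<open>N\<close> are still free; the deterministic terms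
  are grouped first.\<close>

lemma AE_error_le:
  assumes small: "small n" and N: "0 < N" and \<theta>: "0 < \<theta>"
  shows "AE \<omega> in M. \<forall>w\<in>\<W>. \<bar>kde A V W k n w \<omega> - f_W w\<bar>
    \<le> (2 / (real n * (real n - 1)) * T + lip / (h n)\<^sup>2 * ((hi - lo) / real N) + 6 * C_L * (C_H * h n powr min (real p) \<beta>))
      + 2 / (real n * (real n - 1)) * (exp (- (\<theta> * T)) / \<theta>) * sum_exp n N \<theta> \<omega> + 6 * C_L * F_sup n \<omega>"
  using AE_decomposition[OF small] AE_S_lipschitz[OF small_ge_2[OF small]]
proof eventually_elim
  have n: "2 \<le> n" by (rule small_ge_2[OF small])
  case (elim \<omega>)
  let ?c = "2 / (real n * (real n - 1))" and ?S = "\<lambda>w. S n w (A_vec n \<omega>, V_vec n \<omega>)"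
  have c: "0 \<le> ?c" "?c * real (card (pairs n)) = 1" using n by (auto simp: card_pairs)
  show ?case
  proof
    fix w assume w: "w \<in> \<W>"
    obtain i where i: "i \<le> N" "\<bar>w - grid N i\<bar> \<le> (hi - lo) / real N"
      using interval_grid[OF lo_less_hi _ N, of w] w unfolding grid_def W_eq by blast
    have "\<bar>?S w - ?S (grid N i)\<bar> \<le> real (card (pairs n)) * (lip / (h n)\<^sup>2 * \<bar>w - grid N i\<bar>)"
      using elim(2) w grid_in_W[OF i(1)] by blast
    also have "\<dots> \<le> real (card (pairs n)) * (lip / (h n)\<^sup>2 * ((hi - lo) / real N))"
      using i(2) lip_pos by (intro mult_left_mono) auto
    finally have "\<bar>?S w\<bar> \<le> \<bar>?S (grid N i)\<bar> + real (card (pairs n)) * (lip / (h n)\<^sup>2 * ((hi - lo) / real N))"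
      by linarith
    moreover have "\<bar>?S (grid N i)\<bar> \<le> T + exp (- (\<theta> * T)) / \<theta> * sum_exp n N \<theta> \<omega>"
      unfolding sum_exp_def
      using abs_le_sum_exp[of "{..N}" i \<theta> "\<lambda>i. ?S (grid N i)" T] i(1) \<theta> by simp
    ultimately have "?c * \<bar>?S w\<bar> \<le> ?c * (T + exp (- (\<theta> * T)) / \<theta> * sum_exp n N \<theta> \<omega>
        + real (card (pairs n)) * (lip / (h n)\<^sup>2 * ((hi - lo) / real N)))"
      using c(1) by (intro mult_left_mono) auto
    also have "\<dots> = ?c * T + ?c * (exp (- (\<theta> * T)) / \<theta>) * sum_exp n N \<theta> \<omega>
        + (?c * real (card (pairs n))) * (lip / (h n)\<^sup>2 * ((hi - lo) / real N))"
      by (simp only: distrib_left mult.assoc)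
    also have "\<dots> = ?c * T + ?c * (exp (- (\<theta> * T)) / \<theta>) * sum_exp n N \<theta> \<omega> + lip / (h n)\<^sup>2 * ((hi - lo) / real N)"
      unfolding c(2) by simp
    finally show "\<bar>kde A V W k n w \<omega> - f_W w\<bar>
      \<le> (?c * T + lip / (h n)\<^sup>2 * ((hi - lo) / real N) + 6 * C_L * (C_H * h n powr min (real p) \<beta>))
        + ?c * (exp (- (\<theta> * T)) / \<theta>) * sum_exp n N \<theta> \<omega> + 6 * C_L * F_sup n \<omega>"
      using bspec[OF elim(1) w] by linarith
  qed
qed

text \<open>Taking expectations with \<open>T\<close> chosen optimally leaves a logarithm of the
  grid size over \<theta>, which decreases in \<theta>, against the variance term
  \<open>\<theta> * v0 / h n\<close>, which increases.\<close>

lemma expected_sup_error_le: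
  assumes small: "small n" and N: "0 < N" and \<theta>: "0 < \<theta>" "\<theta> * (6 * C_L / h n) \<le> 1"
  shows "expected_sup_error M A V W f_WAA \<W> k n
    \<le> ennreal (2 / (real n * (real n - 1)) * ((ln (2 * (real N + 1)) + 1) / \<theta>) + \<theta> * v0 / h n
      + lip / (h n)\<^sup>2 * ((hi - lo) / real N) + 6 * C_L * (C_H * h n powr min (real p) \<beta>)
      + 6 * C_L * ((dens_bound + 2 * C_H * (hi - lo)) * rate n + 2 * C_H * (hi - lo) / real n))"
proof -
  have n: "2 \<le> n" by (rule small_ge_2[OF small])
  have h: "0 < h n" by (rule h_pos[OF n])
  define c where "c = 2 / (real n * (real n - 1))"
  define m where "m = real (card (pairs n))"
  define E where "E = m * (\<theta>\<^sup>2 * (v0 / h n))"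
  \<comment> \<open>Chosen so that \<open>exp (- (\<theta> * T))\<close> cancels
    \<open>2 * (N + 1) * exp E\<close>, the bound on the expected sum of the
    \<open>2 * (N + 1)\<close> exponentials; what is left of that term is
    \<open>c / \<theta>\<close>.\<close>
  define T where "T = (ln (2 * (real N + 1)) + E) / \<theta>"
  have c: "0 < c" "c * m = 1" using n by (auto simp: card_pairs c_def m_def)
  have E: "0 \<le> E" using v0_pos h by (simp add: E_def m_def)
  have T: "0 \<le> T" using \<theta> E by (simp add: T_def)
  define K0 where "K0 = c * T + lip / (h n)\<^sup>2 * ((hi - lo) / real N) + 6 * C_L * (C_H * h n powr min (real p) \<beta>)"
  define K1 where "K1 = c * (exp (- (\<theta> * T)) / \<theta>)"
  define FF where "FF = (dens_bound + 2 * C_H * (hi - lo)) * rate n + 2 * C_H * (hi - lo) / real n"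
  have K0: "0 \<le> K0"
    using c T lip_pos lo_less_hi C_L_pos C_H_pos by (simp add: K0_def)
  have K1: "0 \<le> K1" using c \<theta> by (simp add: K1_def)
  have FF: "0 \<le> FF" using dens_bound_pos C_H_pos lo_less_hi rate_pos[OF n] by (simp add: FF_def)
  have F_nn: "0 \<le> F_sup n \<omega>" for \<omega>
    using C_H_pos lo_less_hi by (simp add: F_sup_def sum_nonneg)
  have sum_nn: "0 \<le> sum_exp n N \<theta> \<omega>" for \<omega>
    by (auto simp: sum_exp_def intro!: sum_nonneg add_nonneg_nonneg)
  have S_meas[measurable]: "(\<lambda>\<omega>. S n w (A_vec n \<omega>, V_vec n \<omega>)) \<in> borel_measurable M" if "w \<in> \<W>" for w
    using measurable_compose[OF measurable_Pair[OF A_vec_measurable V_vec_measurable] S_measurable[OF n that]] .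
  have exp_meas[measurable]: "(\<lambda>\<omega>. ennreal (exp (\<gamma> * S n (grid N i) (A_vec n \<omega>, V_vec n \<omega>)))) \<in> borel_measurable M" if "i \<in> {..N}" for i \<gamma>
  proof -
    from that have "i \<le> N" by simp
    note [measurable] = S_meas[OF grid_in_W[OF this]]
    show ?thesis by measurable
  qed
  have ennreal_sum: "ennreal (sum_exp n N \<theta> \<omega>) = (\<Sum>i\<le>N. ennreal (exp (\<theta> * S n (grid N i) (A_vec n \<omega>, V_vec n \<omega>)))
      + ennreal (exp (- \<theta> * S n (grid N i) (A_vec n \<omega>, V_vec n \<omega>))))" for \<omega>
    unfolding sum_exp_def by (subst sum_ennreal[symmetric]) (auto intro!: sum.cong ennreal_plus add_nonneg_nonneg)
  have sum_meas[measurable]: "(\<lambda>\<omega>. ennreal (sum_exp n N \<theta> \<omega>)) \<in> borel_measurable M"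
    unfolding ennreal_sum by (intro borel_measurable_sum borel_measurable_add exp_meas)
  have int_sum: "(\<integral>\<^sup>+\<omega>. ennreal (sum_exp n N \<theta> \<omega>) \<partial>M) \<le> ennreal (2 * (real N + 1) * exp E)"
  proof -
    have "(\<integral>\<^sup>+\<omega>. ennreal (sum_exp n N \<theta> \<omega>) \<partial>M)
      = (\<Sum>i\<le>N. (\<integral>\<^sup>+\<omega>. ennreal (exp (\<theta> * S n (grid N i) (A_vec n \<omega>, V_vec n \<omega>))) \<partial>M)
        + (\<integral>\<^sup>+\<omega>. ennreal (exp (- \<theta> * S n (grid N i) (A_vec n \<omega>, V_vec n \<omega>))) \<partial>M))"
      unfolding ennreal_sum
      by (subst nn_integral_sum) (intro borel_measurable_add exp_meas sum.cong refl nn_integral_add; assumption)+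
    also have "\<dots> \<le> (\<Sum>i\<le>N. ennreal (exp E) + ennreal (exp E))"
    proof (intro sum_mono add_mono)
      fix i assume "i \<in> {..N}"
      then have g: "grid N i \<in> \<W>" by (intro grid_in_W) simp
      show "(\<integral>\<^sup>+\<omega>. ennreal (exp (\<theta> * S n (grid N i) (A_vec n \<omega>, V_vec n \<omega>))) \<partial>M) \<le> ennreal (exp E)"
        using nn_integral_exp_S_le[OF small g, of \<theta>] \<theta> by (simp add: E_def m_def)
      show "(\<integral>\<^sup>+\<omega>. ennreal (exp (- \<theta> * S n (grid N i) (A_vec n \<omega>, V_vec n \<omega>))) \<partial>M) \<le> ennreal (exp E)"
        using nn_integral_exp_S_le[OF small g, of "- \<theta>"] \<theta> by (simp add: E_def m_def)
    qed
    also have "\<dots> = (\<Sum>i\<le>N. ennreal (2 * exp E))"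
      by (intro sum.cong) (auto simp: ennreal_plus[symmetric] simp del: ennreal_plus)
    also have "\<dots> = ennreal (\<Sum>i\<le>N. 2 * exp E)" by (rule sum_ennreal) simp
    finally show ?thesis by (simp add: algebra_simps)
  qed
  have "expected_sup_error M A V W f_WAA \<W> k n
    \<le> (\<integral>\<^sup>+\<omega>. ennreal K0 + ennreal K1 * ennreal (sum_exp n N \<theta> \<omega>) + ennreal (6 * C_L) * ennreal (F_sup n \<omega>) \<partial>M)"
    unfolding expected_sup_error_def
  proof (intro nn_integral_mono_AE)
    show "AE \<omega> in M. (SUP w\<in>\<W>. ennreal \<bar>kde A V W k n w \<omega> - f_W w\<bar>)
        \<le> ennreal K0 + ennreal K1 * ennreal (sum_exp n N \<theta> \<omega>) + ennreal (6 * C_L) * ennreal (F_sup n \<omega>)"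
      using AE_error_le[OF small N \<theta>(1), of T]
    proof eventually_elim
      case (elim \<omega>)
      have "(SUP w\<in>\<W>. ennreal \<bar>kde A V W k n w \<omega> - f_W w\<bar>) \<le> ennreal (K0 + K1 * sum_exp n N \<theta> \<omega> + 6 * C_L * F_sup n \<omega>)"
        using elim unfolding K0_def K1_def c_def by (intro SUP_least ennreal_leI) auto
      also have "\<dots> = ennreal K0 + ennreal K1 * ennreal (sum_exp n N \<theta> \<omega>) + ennreal (6 * C_L) * ennreal (F_sup n \<omega>)"
        using K0 K1 F_nn[of \<omega>] sum_nn[of \<omega>] C_L_pos by (simp add: ennreal_plus ennreal_mult)
      finally show ?case .
    qed
  qed
  also have "\<dots> = ennreal K0 + ennreal K1 * (\<integral>\<^sup>+\<omega>. ennreal (sum_exp n N \<theta> \<omega>) \<partial>M) + ennreal (6 * C_L) * (\<integral>\<^sup>+\<omega>. ennreal (F_sup n \<omega>) \<partial>M)"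
    by (simp add: nn_integral_add nn_integral_cmult emeasure_space_1)
  also have "\<dots> \<le> ennreal K0 + ennreal K1 * ennreal (2 * (real N + 1) * exp E) + ennreal (6 * C_L) * ennreal FF"
    using int_sum nn_integral_F_sup_le[OF n] unfolding FF_def[symmetric]
    by (intro add_mono mult_left_mono) auto
  also have "\<dots> = ennreal (K0 + K1 * (2 * (real N + 1) * exp E) + 6 * C_L * FF)"
    using K0 K1 FF C_L_pos by (simp add: ennreal_plus ennreal_mult)
  also have "K1 * (2 * (real N + 1) * exp E) = c / \<theta>"
  proof -
    have "exp (- (\<theta> * T)) = exp (- E) / (2 * (real N + 1))"
    proof -
      have "\<theta> * T = ln (2 * (real N + 1)) + E" using \<theta> by (simp add: T_def)
      then have "exp (- (\<theta> * T)) = inverse (exp (ln (2 * (real N + 1))) * exp E)"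
        by (simp only: exp_minus exp_add)
      also have "exp (ln (2 * (real N + 1))) = 2 * (real N + 1)" by (rule exp_ln) simp
      finally show ?thesis by (simp add: exp_minus divide_inverse)
    qed
    then show ?thesis by (simp add: K1_def exp_minus)
  qed
  also have "K0 + c / \<theta> = c * ((ln (2 * (real N + 1)) + 1) / \<theta>) + \<theta> * v0 / h n
      + lip / (h n)\<^sup>2 * ((hi - lo) / real N) + 6 * C_L * (C_H * h n powr min (real p) \<beta>)"
  proof -
    have "c * (E / \<theta>) = (c * m) * (\<theta> * v0 / h n)" using \<theta> by (simp add: E_def power2_eq_square)
    then have "c * (E / \<theta>) = \<theta> * v0 / h n" using c by simp
    then have "c * T + c / \<theta> = c * ((ln (2 * (real N + 1)) + 1) / \<theta>) + \<theta> * v0 / h n"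
      by (simp add: T_def add_divide_distrib distrib_left)
    then show ?thesis by (simp add: K0_def)
  qed
  finally show ?thesis by (simp add: FF_def c_def)
qed

section \<open>Finiteness of the expected error for each sample size\<close>

lemma nn_integral_abs_k_W_finite:
  assumes n: "2 \<le> n" and w: "w \<in> \<W>" and ij: "1 \<le> i" "i < j"
  shows "(\<integral>\<^sup>+\<omega>. ennreal \<bar>k n (W (A i \<omega>) (A j \<omega>) (V i j \<omega>)) w\<bar> \<partial>M) < \<infinity>"
proof -
  note [measurable] = k_measurable[OF n w] k_W_measurable[OF n w]
  have [measurable]: "A i \<in> borel_measurable M" "A j \<in> borel_measurable M" "V i j \<in> borel_measurable M"
    using ij by auto
  \<comment> \<open>On \<W> the density is at most \<open>dens_bound\<close> and elsewhere the
    kernel vanishes, so integrability of the kernel suffices, without a condition on the size of the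
    bandwidth.\<close>
  define B where "B = ennreal dens_bound * (\<integral>\<^sup>+y. ennreal \<bar>k n y w\<bar> \<partial>lborel)"
  have bd: "AE z in law_A \<Otimes>\<^sub>M law_A. (\<integral>\<^sup>+y. ennreal (f_WAA y (fst z) (snd z)) * ennreal \<bar>k n y w\<bar> \<partial>lborel) \<le> B"
  proof (rule AE_law_pairI[of _ 1 2])
    have "AE \<omega> in M. \<forall>s\<in>\<W>. 0 \<le> f_WAA s (A 1 \<omega>) (A 2 \<omega>) \<and> f_WAA s (A 1 \<omega>) (A 2 \<omega>) \<le> dens_bound"
      by (rule AE_f_WAA_bounds) auto
    then show "AE \<omega> in M. (\<integral>\<^sup>+y. ennreal (f_WAA y (fst (A 1 \<omega>, A 2 \<omega>)) (snd (A 1 \<omega>, A 2 \<omega>))) * ennreal \<bar>k n y w\<bar> \<partial>lborel) \<le> B"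
    proof eventually_elim
      case (elim \<omega>)
      have "(\<integral>\<^sup>+y. ennreal (f_WAA y (A 1 \<omega>) (A 2 \<omega>)) * ennreal \<bar>k n y w\<bar> \<partial>lborel)
          \<le> (\<integral>\<^sup>+y. ennreal dens_bound * ennreal \<bar>k n y w\<bar> \<partial>lborel)"
      proof (intro nn_integral_mono)
        fix y
        show "ennreal (f_WAA y (A 1 \<omega>) (A 2 \<omega>)) * ennreal \<bar>k n y w\<bar> \<le> ennreal dens_bound * ennreal \<bar>k n y w\<bar>"
        proof (cases "y \<in> \<W>")
          case True
          with elim show ?thesis by (intro mult_right_mono ennreal_leI) auto
        qed (simp add: k_outside[OF n w])
      qed
      also have "\<dots> = B" unfolding B_def by (intro nn_integral_cmult) measurable
      finally show ?case by simp
    qed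
  qed measurable
  have "(\<integral>\<^sup>+\<omega>. ennreal \<bar>k n (W (A i \<omega>) (A j \<omega>) (V i j \<omega>)) w\<bar> \<partial>M)
     = (\<integral>\<^sup>+x. ennreal \<bar>k n (W (fst (fst x)) (snd (fst x)) (snd x)) w\<bar>
          \<partial>distr M ((borel \<Otimes>\<^sub>M borel) \<Otimes>\<^sub>M borel) (\<lambda>\<omega>. ((A i \<omega>, A j \<omega>), V i j \<omega>)))"
    by (subst nn_integral_distr) simp_all
  also have "\<dots> = (\<integral>\<^sup>+z. \<integral>\<^sup>+v. ennreal \<bar>k n (W (fst z) (snd z) v) w\<bar> \<partial>law_V \<partial>(law_A \<Otimes>\<^sub>M law_A))"
    unfolding law_triple[OF ij] by (subst V.nn_integral_fst[symmetric]) simp_all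
  also have "\<dots> \<le> (\<integral>\<^sup>+z. B \<partial>(law_A \<Otimes>\<^sub>M law_A))"
  proof (rule nn_integral_mono_AE)
    show "AE z in law_A \<Otimes>\<^sub>M law_A. (\<integral>\<^sup>+v. ennreal \<bar>k n (W (fst z) (snd z) v) w\<bar> \<partial>law_V) \<le> B"
      using bd conditional_law_W
    proof eventually_elim
      case (elim z)
      have "(\<integral>\<^sup>+v. ennreal \<bar>k n (W (fst z) (snd z) v) w\<bar> \<partial>law_V)
          = (\<integral>\<^sup>+y. ennreal \<bar>k n y w\<bar> \<partial>distr law_V borel (W (fst z) (snd z)))"
        by (subst nn_integral_distr) simp_all
      also have "\<dots> = (\<integral>\<^sup>+y. ennreal (f_WAA y (fst z) (snd z)) * ennreal \<bar>k n y w\<bar> \<partial>lborel)"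
        unfolding elim(2) by (subst nn_integral_density) simp_all
      finally show ?case using elim(1) by simp
    qed
  qed
  also have "\<dots> = B" using AA.emeasure_space_1 by simp
  also have "\<dots> < \<infinity>"
    using k_integrable[OF n w] unfolding B_def integrable_iff_bounded
    by (auto simp: ennreal_mult_less_top)
  finally show ?thesis .
qed

text \<open>Covers the sample sizes at which the bandwidth may still be large. The Lipschitz
  condition in \<open>w\<close> reduces the supremum to the value at \<open>lo\<close> plus a
  constant.\<close>

lemma expected_sup_error_finite:
  assumes n: "2 \<le> n"
  shows "expected_sup_error M A V W f_WAA \<W> k n < \<infinity>"
proof -
  have lo: "lo \<in> \<W>" using lo_less_hi by (simp add: W_eq)
  let ?X = "\<lambda>q \<omega>. k n (W (A (fst q) \<omega>) (A (snd q) \<omega>) (V (fst q) (snd q) \<omega>)) lo"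
  have [measurable]: "?X q \<in> borel_measurable M" if "q \<in> pairs n" for q
    using that by (intro k_W_measurable[OF n lo]) (auto simp: pairs_def)
  define c where "c = 2 / (real n * (real n - 1))"
  define B where "B = C_L / (h n)\<^sup>2 * (hi - lo)"
  have c: "0 \<le> c" and c1: "c * real (card (pairs n)) = 1" using n by (auto simp: c_def card_pairs)
  have B: "0 \<le> B" using C_L_pos lo_less_hi by (simp add: B_def)
  have le: "\<bar>kde A V W k n w \<omega> - f_W w\<bar> \<le> c * (\<Sum>q\<in>pairs n. \<bar>?X q \<omega>\<bar>) + (B + dens_bound)" if w: "w \<in> \<W>" for w \<omega>
  proof -
    let ?Y = "\<lambda>q. k n (W (A (fst q) \<omega>) (A (snd q) \<omega>) (V (fst q) (snd q) \<omega>)) w"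
    have Y: "\<bar>?Y q\<bar> \<le> \<bar>?X q \<omega>\<bar> + B" for q
    proof -
      have "\<bar>?Y q - ?X q \<omega>\<bar> \<le> C_L / (h n)\<^sup>2 * \<bar>w - lo\<bar>" by (rule k_lipschitz[OF n w lo])
      also have "\<dots> \<le> B" unfolding B_def using w C_L_pos by (intro mult_left_mono) (auto simp: W_eq)
      finally show ?thesis by linarith
    qed
    have "\<bar>kde A V W k n w \<omega>\<bar> = c * \<bar>\<Sum>q\<in>pairs n. ?Y q\<bar>"
      unfolding kde_def sum_pairs case_prod_unfold using c n by (simp add: c_def abs_mult)
    also have "\<dots> \<le> c * (\<Sum>q\<in>pairs n. \<bar>?X q \<omega>\<bar> + B)"
      using Y by (intro mult_left_mono[OF _ c] order.trans[OF sum_abs] sum_mono) auto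
    also have "\<dots> = c * (\<Sum>q\<in>pairs n. \<bar>?X q \<omega>\<bar>) + (c * real (card (pairs n))) * B"
      by (simp add: sum.distrib distrib_left)
    finally show ?thesis using f_W_bounds[OF w] c1 by simp
  qed
  have "expected_sup_error M A V W f_WAA \<W> k n
      \<le> (\<integral>\<^sup>+\<omega>. ennreal c * (\<Sum>q\<in>pairs n. ennreal \<bar>?X q \<omega>\<bar>) + ennreal (B + dens_bound) \<partial>M)"
    unfolding expected_sup_error_def
  proof (intro nn_integral_mono SUP_least)
    fix \<omega> w assume "w \<in> \<W>"
    from ennreal_leI[OF le[OF this, of \<omega>]]
    show "ennreal \<bar>kde A V W k n w \<omega> - f_W w\<bar> \<le> ennreal c * (\<Sum>q\<in>pairs n. ennreal \<bar>?X q \<omega>\<bar>) + ennreal (B + dens_bound)"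
      using c B dens_bound_pos by (simp add: ennreal_plus ennreal_mult sum_nonneg)
  qed
  also have "\<dots> = ennreal c * (\<Sum>q\<in>pairs n. \<integral>\<^sup>+\<omega>. ennreal \<bar>?X q \<omega>\<bar> \<partial>M) + ennreal (B + dens_bound)"
    by (simp add: nn_integral_add nn_integral_cmult nn_integral_sum emeasure_space_1 del: sum_ennreal)
  also have "\<dots> < \<infinity>"
  proof -
    have "(\<integral>\<^sup>+\<omega>. ennreal \<bar>?X q \<omega>\<bar> \<partial>M) < top" if "q \<in> pairs n" for q
      using nn_integral_abs_k_W_finite[OF n lo, of "fst q" "snd q"] that by (auto simp: pairs_def)
    then have "(\<Sum>q\<in>pairs n. \<integral>\<^sup>+\<omega>. ennreal \<bar>?X q \<omega>\<bar> \<partial>M) < top"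
      by simp
    then show ?thesis by (simp add: ennreal_mult_less_top del: sum_ennreal)
  qed
  finally show ?thesis .
qed

section \<open>Choice of the parameters and the final rate\<close>

definition "noise n = sqrt (ln (real n) / ((real n)\<^sup>2 * h n))"

lemma ln_ge_half: "2 \<le> n \<Longrightarrow> 1 / 2 \<le> ln (real n)"
proof -
  assume "2 \<le> n"
  have "ln (inverse (real n)) \<le> inverse (real n) - 1" using \<open>2 \<le> n\<close> by (intro ln_le_minus_one) auto
  then have "1 - inverse (real n) \<le> ln (real n)" using \<open>2 \<le> n\<close> by (simp add: ln_inverse)
  moreover have "inverse (real n) \<le> 1 / 2" using \<open>2 \<le> n\<close> by (simp add: field_simps)
  ultimately show ?thesis by linarith
qed

lemma noise_pos: "2 \<le> n \<Longrightarrow> 0 < noise n"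
  using h_pos[of n] by (simp add: noise_def)

lemma noise_square: "2 \<le> n \<Longrightarrow> (noise n)\<^sup>2 = ln (real n) / ((real n)\<^sup>2 * h n)"
  using h_pos[of n] unfolding noise_def by (intro real_sqrt_pow2) auto

text \<open>Holds because the bandwidth is at most a multiple of \<open>hi - lo\<close> and the
  logarithm is bounded below. It absorbs both the cell error of \<open>F_sup\<close> and the
  degenerate rate.\<close>

lemma inverse_le_noise:
  assumes small: "small n"
  shows "1 / real n \<le> sqrt (hi - lo) * noise n"
proof (rule power2_le_imp_le)
  have n: "2 \<le> n" by (rule small_ge_2[OF small])
  have h: "0 < h n" "4 * h n \<le> hi - lo" using h_pos[OF n] small by (auto simp: small_def)
  have "h n \<le> (hi - lo) / 2" using h by (simp add: field_simps)
  also have "\<dots> = (hi - lo) * (1 / 2)" by simp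
  also have "\<dots> \<le> (hi - lo) * ln (real n)" using ln_ge_half[OF n] lo_less_hi by (intro mult_left_mono) auto
  finally have "1 \<le> (hi - lo) * ln (real n) / h n" using h by simp
  from divide_right_mono[OF this, of "(real n)\<^sup>2"]
  show "(1 / real n)\<^sup>2 \<le> (sqrt (hi - lo) * noise n)\<^sup>2"
    using lo_less_hi unfolding power_mult_distrib noise_square[OF n] by (simp add: power_divide mult_ac)
  show "0 \<le> sqrt (hi - lo) * noise n" using noise_pos[OF n] lo_less_hi by simp
qed

text \<open>The choices \<open>\<theta> = sqrt (h ln n) / n\<close> and \<open>N = n ^ 4\<close> balance the Bernstein bound and make
  the discretisation error, of order \<open>1 / (h\<^sup>2 N)\<close>, negligible.\<close>

lemma expected_sup_error_le_rate:
  assumes small: "small n" and nz: "6 * C_L * noise n \<le> 1"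
  shows "expected_sup_error M A V W f_WAA \<W> k n
    \<le> ennreal ((32 + v0 + 4 * lip * (hi - lo) / (6 * C_L) ^ 3 + 12 * C_L * C_H * (hi - lo) * sqrt (hi - lo)) * noise n
      + 6 * C_L * C_H * h n powr min (real p) \<beta> + 6 * C_L * (dens_bound + 2 * C_H * (hi - lo)) * rate n)"
proof -
  have n: "2 \<le> n" by (rule small_ge_2[OF small])
  have h: "0 < h n" by (rule h_pos[OF n])
  have ln: "1 / 2 \<le> ln (real n)" by (rule ln_ge_half[OF n])
  define R where "R = noise n"
  have R: "0 < R" "R\<^sup>2 = ln (real n) / ((real n)\<^sup>2 * h n)"
    unfolding R_def using noise_pos[OF n] noise_square[OF n] by auto
  \<comment> \<open>This equals \<open>sqrt (h ln n) / n\<close>; in the form \<open>h n * R\<close>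
    the admissibility condition on \<theta> is literally the hypothesis \<open>nz\<close>.\<close>
  define \<theta> where "\<theta> = h n * R"
  have \<theta>: "0 < \<theta>" "\<theta> * (6 * C_L / h n) \<le> 1"
    using h R nz by (auto simp: \<theta>_def R_def mult_ac)
  have log: "ln (2 * (real (n ^ 4) + 1)) + 1 \<le> 8 * ln (real n)"
  proof -
    \<comment> \<open>For \<open>n \<ge> 2\<close> the grid factor is at most \<open>n ^ 6\<close>,
      giving 6 logarithms; the extra 1 costs two more since \<open>ln n\<close> is at least
      \<open>1 / 2\<close>.\<close>
    have "2 ^ 4 \<le> real n ^ 4" using n by (intro power_mono) auto
    then have "2 * (real (n ^ 4) + 1) \<le> 2 ^ 2 * real n ^ 4" by simp
    also have "\<dots> \<le> real n ^ 2 * real n ^ 4" using n by (intro mult_right_mono power_mono) auto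
    also have "\<dots> = real n ^ 6" by (simp add: power_add[symmetric])
    finally have "ln (2 * (real (n ^ 4) + 1)) \<le> ln (real n ^ 6)" using n by (subst ln_le_cancel_iff) (auto intro: add_nonneg_pos)
    also have "\<dots> = 6 * ln (real n)" using n by (simp add: ln_realpow)
    finally show ?thesis using ln by linarith
  qed
  have 1: "2 / (real n * (real n - 1)) * ((ln (2 * (real (n ^ 4) + 1)) + 1) / \<theta>) \<le> 32 * R"
  proof -
    have "2 / (real n * (real n - 1)) \<le> 4 / (real n)\<^sup>2"
      using n by (simp add: field_simps power2_eq_square)
    moreover have "(ln (2 * (real (n ^ 4) + 1)) + 1) / \<theta> \<le> 8 * ln (real n) / \<theta>"
      using log \<theta> by (intro divide_right_mono) auto
    ultimately have "2 / (real n * (real n - 1)) * ((ln (2 * (real (n ^ 4) + 1)) + 1) / \<theta>)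
        \<le> 4 / (real n)\<^sup>2 * (8 * ln (real n) / \<theta>)"
      using n \<theta> by (intro mult_mono) auto
    also have "\<dots> = 32 * (ln (real n) / ((real n)\<^sup>2 * h n)) / R"
      by (simp add: \<theta>_def)
    also have "\<dots> = 32 * R" unfolding R(2)[symmetric] using R(1) by (simp add: power2_eq_square)
    finally show ?thesis .
  qed
  have 2: "\<theta> * v0 / h n = v0 * R" using h by (simp add: \<theta>_def)
  have 3: "lip / (h n)\<^sup>2 * ((hi - lo) / real (n ^ 4)) \<le> 4 * lip * (hi - lo) / (6 * C_L) ^ 3 * R"
  proof -
    \<comment> \<open>With \<open>N = n ^ 4\<close> the discretisation error is a multiple of
      \<open>R ^ 4 / (ln n)\<^sup>2\<close>. Three powers of \<open>R\<close> are bounded through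
      \<open>nz\<close> and one is kept as the rate.\<close>
    have "1 / ((h n)\<^sup>2 * real (n ^ 4)) = (R\<^sup>2)\<^sup>2 / (ln (real n))\<^sup>2"
      unfolding R(2) using ln by (simp add: power_divide power_mult_distrib)
    also have "\<dots> \<le> (R\<^sup>2)\<^sup>2 / (1 / 2)\<^sup>2"
      using ln by (intro divide_left_mono power_mono mult_pos_pos) auto
    also have "\<dots> = 4 * R ^ 3 * R" by (simp add: power2_eq_square power3_eq_cube)
    also have "\<dots> \<le> 4 * (1 / (6 * C_L)) ^ 3 * R"
      using R(1) C_L_pos nz by (intro mult_right_mono mult_left_mono power_mono) (auto simp: R_def field_simps)
    finally have "(lip * (hi - lo)) * (1 / ((h n)\<^sup>2 * real (n ^ 4))) \<le> (lip * (hi - lo)) * (4 * (1 / (6 * C_L)) ^ 3 * R)"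
      using lip_pos lo_less_hi by (intro mult_left_mono) auto
    then show ?thesis by (simp add: power_divide mult_ac)
  qed
  have 4: "6 * C_L * (2 * C_H * (hi - lo) / real n) \<le> 12 * C_L * C_H * (hi - lo) * sqrt (hi - lo) * R"
  proof -
    have "(12 * C_L * C_H * (hi - lo)) * (1 / real n) \<le> (12 * C_L * C_H * (hi - lo)) * (sqrt (hi - lo) * R)"
      using inverse_le_noise[OF small] C_L_pos C_H_pos lo_less_hi unfolding R_def by (intro mult_left_mono) auto
    then show ?thesis by (simp add: mult_ac)
  qed
  have "expected_sup_error M A V W f_WAA \<W> k n
    \<le> ennreal (2 / (real n * (real n - 1)) * ((ln (2 * (real (n ^ 4) + 1)) + 1) / \<theta>) + \<theta> * v0 / h n
      + lip / (h n)\<^sup>2 * ((hi - lo) / real (n ^ 4)) + 6 * C_L * (C_H * h n powr min (real p) \<beta>)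
      + 6 * C_L * ((dens_bound + 2 * C_H * (hi - lo)) * rate n + 2 * C_H * (hi - lo) / real n))"
    using n by (intro expected_sup_error_le[OF small _ \<theta>]) auto
  also have "\<dots> \<le> ennreal ((32 + v0 + 4 * lip * (hi - lo) / (6 * C_L) ^ 3 + 12 * C_L * C_H * (hi - lo) * sqrt (hi - lo)) * R
      + 6 * C_L * C_H * h n powr min (real p) \<beta> + 6 * C_L * (dens_bound + 2 * C_H * (hi - lo)) * rate n)"
  proof (rule ennreal_leI)
    have dist: "x * (y * z + b) = x * y * z + x * b" for x y z b :: real by (simp add: algebra_simps)
    have "6 * C_L * ((dens_bound + 2 * C_H * (hi - lo)) * rate n + 2 * C_H * (hi - lo) / real n)
      = 6 * C_L * (dens_bound + 2 * C_H * (hi - lo)) * rate n + 6 * C_L * (2 * C_H * (hi - lo) / real n)"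
      by (rule dist)
    moreover have "(32 + v0 + 4 * lip * (hi - lo) / (6 * C_L) ^ 3 + 12 * C_L * C_H * (hi - lo) * sqrt (hi - lo)) * R
      = 32 * R + v0 * R + 4 * lip * (hi - lo) / (6 * C_L) ^ 3 * R + 12 * C_L * C_H * (hi - lo) * sqrt (hi - lo) * R"
      by (simp only: distrib_right)
    moreover have "6 * C_L * (C_H * h n powr min (real p) \<beta>) = 6 * C_L * C_H * h n powr min (real p) \<beta>"
      by simp
    ultimately show "2 / (real n * (real n - 1)) * ((ln (2 * (real (n ^ 4) + 1)) + 1) / \<theta>) + \<theta> * v0 / h n
      + lip / (h n)\<^sup>2 * ((hi - lo) / real (n ^ 4)) + 6 * C_L * (C_H * h n powr min (real p) \<beta>)
      + 6 * C_L * ((dens_bound + 2 * C_H * (hi - lo)) * rate n + 2 * C_H * (hi - lo) / real n)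
      \<le> (32 + v0 + 4 * lip * (hi - lo) / (6 * C_L) ^ 3 + 12 * C_L * C_H * (hi - lo) * sqrt (hi - lo)) * R
      + 6 * C_L * C_H * h n powr min (real p) \<beta> + 6 * C_L * (dens_bound + 2 * C_H * (hi - lo)) * rate n"
      using 1 2 3 4 by linarith
  qed
  finally show ?thesis by (simp add: R_def)
qed

definition "target n = h n powr min (real p) \<beta> + D_up M A f_WAA \<W> / sqrt (real n) + noise n"

lemma target_pos: "2 \<le> n \<Longrightarrow> 0 < target n"
  using noise_pos[of n] D_up_nonneg by (simp add: target_def add_nonneg_pos)

text \<open>\<open>D_up\<close> does not depend on \<open>n\<close>: if it is positive, \<open>1 / sqrt n\<close> is of the order of
  \<open>D_up / sqrt n\<close>; if it is 0, the conditional densities are degenerate and the rate is \<open>1 / n\<close>.\<close>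

lemma rate_le_target:
  assumes small: "small n"
  shows "rate n \<le> (4 / D_up M A f_WAA \<W> + 2 * sqrt (hi - lo)) * target n"
proof -
  have n: "2 \<le> n" by (rule small_ge_2[OF small])
  have noise: "noise n \<le> target n" and D: "D_up M A f_WAA \<W> / sqrt (real n) \<le> target n"
    using noise_pos[OF n] D_up_nonneg by (auto simp: target_def)
  show ?thesis
  proof (cases "D_up M A f_WAA \<W> = 0")
    case True
    have "rate n \<le> 2 * sqrt (hi - lo) * noise n"
      using inverse_le_noise[OF small] True by (simp add: rate_def)
    also have "\<dots> \<le> 2 * sqrt (hi - lo) * target n"
      using noise lo_less_hi by (intro mult_left_mono) auto
    \<comment> \<open>Division by 0 yields 0, so the summand with \<open>D_up\<close> in the
      denominator vanishes here.\<close>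
    finally show ?thesis using True by simp
  next
    case False
    then have pos: "0 < D_up M A f_WAA \<W>" using D_up_nonneg by simp
    have "rate n = 4 / D_up M A f_WAA \<W> * (D_up M A f_WAA \<W> / sqrt (real n))"
      using False by (simp add: rate_def)
    also have "\<dots> \<le> 4 / D_up M A f_WAA \<W> * target n"
      using D pos by (intro mult_left_mono) auto
    also have "\<dots> \<le> (4 / D_up M A f_WAA \<W> + 2 * sqrt (hi - lo)) * target n"
      using target_pos[OF n] lo_less_hi by (intro mult_right_mono) auto
    finally show ?thesis .
  qed
qed

text \<open>As \<open>ln n \<ge> 1\<close> from \<open>n = 3\<close> on, \<open>h ln n\<close>
  tending to 0 forces \<open>h\<close> to become small; the other limit does the same for
  \<open>noise\<close>.\<close>

lemma eventually_small: "eventually (\<lambda>n. small n \<and> 6 * C_L * noise n \<le> 1) sequentially"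
proof -
  have "eventually (\<lambda>n. h n * ln (real n) < (hi - lo) / 4) sequentially"
    using lo_less_hi by (intro order_tendstoD(2)[OF h_log]) simp
  moreover have "eventually (\<lambda>n. ln (real n) / ((real n)\<^sup>2 * h n) < (1 / (6 * C_L))\<^sup>2) sequentially"
    using C_L_pos by (intro order_tendstoD(2)[OF log_n2h]) simp
  moreover have "eventually (\<lambda>n::nat. 3 \<le> n) sequentially" by (rule eventually_ge_at_top)
  ultimately show ?thesis
  proof eventually_elim
    case (elim n)
    then have n: "2 \<le> n" by simp
    have "1 \<le> ln (real n)"
    proof -
      have "exp 1 \<le> real n" using exp_le elim(3) by linarith
      then have "ln (exp 1) \<le> ln (real n)" using n by (subst ln_le_cancel_iff) auto
      then show ?thesis by simp
    qed
    then have "h n * 1 \<le> h n * ln (real n)" using h_pos[OF n] by (intro mult_left_mono) auto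
    then have "small n" using elim(1) n by (simp add: small_def)
    moreover have "noise n \<le> 1 / (6 * C_L)"
      unfolding noise_def using elim(2) C_L_pos by (intro real_le_lsqrt) auto
    then have "6 * C_L * noise n \<le> 1" using C_L_pos by (simp add: field_simps)
    ultimately show ?case by simp
  qed
qed

text \<open>\<open>C1\<close> serves all \<open>n\<close> from \<open>n0\<close> on. For the
  finitely many remaining ones, \<open>C2\<close> sums the ratios of error to target, which is
  legitimate because the target is positive.\<close>

lemma expected_sup_error_rate:
  "\<exists>C::real. \<forall>n\<ge>2. expected_sup_error M A V W f_WAA \<W> k n \<le> ennreal (C * target n)"
proof -
  let ?err = "\<lambda>n. expected_sup_error M A V W f_WAA \<W> k n"
  define a1 where "a1 = 32 + v0 + 4 * lip * (hi - lo) / (6 * C_L) ^ 3 + 12 * C_L * C_H * (hi - lo) * sqrt (hi - lo)"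
  define a2 where "a2 = 6 * C_L * C_H"
  define a3 where "a3 = 6 * C_L * (dens_bound + 2 * C_H * (hi - lo))"
  define C1 where "C1 = a1 + a2 + a3 * (4 / D_up M A f_WAA \<W> + 2 * sqrt (hi - lo))"
  have a: "0 \<le> a1" "0 \<le> a2" "0 \<le> a3"
    using v0_pos lip_pos dens_bound_pos C_L_pos C_H_pos lo_less_hi by (auto simp: a1_def a2_def a3_def)
  then have C1: "0 \<le> C1" using D_up_nonneg lo_less_hi by (simp add: C1_def)
  have large: "?err n \<le> ennreal (C1 * target n)" if "small n" "6 * C_L * noise n \<le> 1" for n
  proof -
    have n: "2 \<le> n" by (rule small_ge_2[OF that(1)])
    have "?err n \<le> ennreal (a1 * noise n + a2 * h n powr min (real p) \<beta> + a3 * rate n)"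
      using expected_sup_error_le_rate[OF that] by (simp add: a1_def a2_def a3_def)
    also have "\<dots> \<le> ennreal (a1 * target n + a2 * target n + a3 * ((4 / D_up M A f_WAA \<W> + 2 * sqrt (hi - lo)) * target n))"
      using a rate_le_target[OF that(1)] noise_pos[OF n] D_up_nonneg
      by (intro ennreal_leI add_mono mult_left_mono) (auto simp: target_def)
    finally show ?thesis by (simp add: C1_def algebra_simps)
  qed
  obtain n0 where n0: "\<And>n. n0 \<le> n \<Longrightarrow> small n \<and> 6 * C_L * noise n \<le> 1"
    using eventually_small unfolding eventually_sequentially by blast
  define C2 where "C2 = (\<Sum>n\<in>{2..<n0}. enn2real (?err n) / target n)"
  have quotient_nonneg: "0 \<le> enn2real (?err n) / target n" if "2 \<le> n" for n
    using target_pos[OF that] by simp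
  have C2: "0 \<le> C2" unfolding C2_def using quotient_nonneg by (intro sum_nonneg) auto
  show ?thesis
  proof (intro exI[of _ "C1 + C2"] allI impI)
    fix n :: nat assume n: "2 \<le> n"
    show "?err n \<le> ennreal ((C1 + C2) * target n)"
    proof (cases "n0 \<le> n")
      case True
      have "?err n \<le> ennreal (C1 * target n)" using n0[OF True] by (intro large) auto
      also have "\<dots> \<le> ennreal ((C1 + C2) * target n)"
        using target_pos[OF n] C2 by (intro ennreal_leI mult_right_mono) auto
      finally show ?thesis .
    next
      case False
      have "enn2real (?err n) / target n \<le> C2"
        unfolding C2_def using False n quotient_nonneg by (intro member_le_sum) auto
      then have "enn2real (?err n) \<le> C2 * target n"
        using target_pos[OF n] by (simp add: field_simps)
      also have "\<dots> \<le> (C1 + C2) * target n"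
        using target_pos[OF n] C1 by (intro mult_right_mono) auto
      finally have "ennreal (enn2real (?err n)) \<le> ennreal ((C1 + C2) * target n)" by (rule ennreal_leI)
      \<comment> \<open>Finiteness makes \<open>enn2real\<close> lossless; it would send an infinite
        error to 0.\<close>
      then show ?thesis using expected_sup_error_finite[OF n] by simp
    qed
  qed
qed

end

theorem theorem3p1:
  fixes M :: "'w measure"
    and A :: "nat \<Rightarrow> 'w \<Rightarrow> real"
    and V :: "nat \<Rightarrow> nat \<Rightarrow> 'w \<Rightarrow> real"
    and W :: "real \<Rightarrow> real \<Rightarrow> real \<Rightarrow> real"
    and f_V :: "real \<Rightarrow> ennreal"
    and f_WAA :: "real \<Rightarrow> real \<Rightarrow> real \<Rightarrow> real"
    and \<A> \<W> :: "real set"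
    and \<beta> C_H C_L :: real
    and h :: "nat \<Rightarrow> real"
    and k :: "nat \<Rightarrow> real \<Rightarrow> real \<Rightarrow> real"
    and p :: nat
  assumes "dyadic_data M A V W f_V f_WAA \<A> \<W> \<beta> C_H"
    and "kernel_bandwidth \<W> h k p C_L"
  shows "\<exists>C::real. \<forall>n\<ge>2.
    expected_sup_error M A V W f_WAA \<W> k n
      \<le> ennreal (C * (h n powr min (real p) \<beta>
                      + D_up M A f_WAA \<W> / sqrt (real n)
                      + sqrt (ln (real n) / ((real n)\<^sup>2 * h n))))"
proof -
  interpret dyadic_data M A V W f_V f_WAA \<A> \<W> \<beta> C_H by fact
  interpret kernel_bandwidth \<W> h k p C_L by fact
  \<comment> \<open>A compact interval is a closed box, possibly empty or a single point; positive
    Lebesgue measure rules these out and gives \<open>lo < hi\<close>.\<close>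
  obtain lo hi where W_cbox: "\<W> = cbox lo hi"
    using W_set(1,2) is_interval_compact[of \<W>] by blast
  moreover from this have "lo < hi"
    using W_set(3) by (auto simp: emeasure_lborel_Icc_eq split: if_splits)
  ultimately interpret dyadic_kernel M A V W f_V f_WAA \<A> \<W> \<beta> C_H lo hi h k p C_L
    by unfold_locales simp_all
  show ?thesis using expected_sup_error_rate unfolding target_def noise_def .
qed

end
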